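(* For $\alpha<1$ and $f\in L^p(0,1)$ with $1\le p\le\infty$ there exists a unique function $u_N\in W^{2,p}_{loc}((0,1])$ satisfying $$-(x^{2\alpha}u_N'(x))'+u_N(x)=f(x)\ \text{ for a.e. } x\in(0,1],\qquad u_N(1)=0,$$ together with the following properties: (i) $u_N\in L^p(0,1)$ with $\|u_N\|_{L^p}\le C\|f\|_{L^p}$; (ii) $\lim_{x\to0^+}x^{2\alpha}u_N'(x)=0$, and in fact one has $\lim_{x\to0^+}x^{2\alpha-1+\frac1p}u_N'(x)=0$; (iii) $x^{2\alpha}u_N'\in W^{1,p}(0,1)$ with $\|x^{2\alpha}u_N'\|_{W^{1,p}}\le C\|f\|_{L^p}$; (iv) if $p>1$, then $x^{2\alpha-1}u_N'\in L^p(0,1)$ and $x^{2\alpha}u_N''\in L^p(0,1)$ with $\|x^{2\alpha-1}u_N'\|_{L^p}+\|x^{2\alpha}u_N''\|_{L^p}\le C\|f\|_{L^p}$. Additionally, $u_N$ satisfies: (v) if $0<\alpha<\frac12$, then $u_N\in C^{0,\frac12-\alpha}[0,1]$ with $\|u_N\|_{C^{0,\frac12-\alpha}}\le C\|f\|_{L^p}$; (vi) if $\alpha\le0$, then $u_N\in W^{1,p}(0,1)$ with $\|u_N\|_{W^{1,p}}\le C\|f\|_{L^p}$.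
   Context: All functions are real valued. $C>0$ denotes a constant depending on the parameters $\alpha$ and $p$ but not on $f$; its value may change from one occurrence to the next. $W^{k,p}(0,1)$ are the usual Sobolev spaces on the interval $(0,1)$; $W^{2,p}_{loc}((0,1])$ is the set of functions on $(0,1]$ belonging to $W^{2,p}(\delta,1)$ for every $\delta\in(0,1)$. $C^{0,\gamma}[0,1]$ is the space of Hölder continuous functions of exponent $\gamma$ on $[0,1]$ with its usual norm. Expressions such as $x^{2\alpha}u'$ denote the function $x\mapsto x^{2\alpha}u'(x)$ on $(0,1)$. For $p=\infty$, $\frac1p$ means $0$.
   Formalization: The second limit in (ii) is claimed only for p<∞, since for p=∞ (1/p=0) it is false: with α=0, f=1 the solution is u=1−cosh x/cosh 1 and u'(x)/x → −1/cosh 1. *)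

theory Defs
  imports "HOL-Analysis.Analysis" "HOL-Probability.Essential_Supremum"
begin

section \<open>Lebesgue spaces\<close>

text \<open>Functions are not identified when they agree almost everywhere.  For the top exponent the
  expression \<open>enn2real (1 / p)\<close> is \<open>0\<close>, as is conventional.\<close>

definition Lp_space :: "ennreal \<Rightarrow> real set \<Rightarrow> (real \<Rightarrow> real) set" where
  "Lp_space p S = {f \<in> borel_measurable (lebesgue_on S).
     if p = \<infinity> then esssup (lebesgue_on S) (\<lambda>x. ennreal \<bar>f x\<bar>) < \<infinity>
     else integrable (lebesgue_on S) (\<lambda>x. \<bar>f x\<bar> powr enn2real p)}"

definition Lp_norm :: "ennreal \<Rightarrow> real set \<Rightarrow> (real \<Rightarrow> real) \<Rightarrow> real" where
  "Lp_norm p S f =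
     (if p = \<infinity> then enn2real (esssup (lebesgue_on S) (\<lambda>x. ennreal \<bar>f x\<bar>))
      else (LINT x|lebesgue_on S. \<bar>f x\<bar> powr enn2real p) powr enn2real (1 / p))"


section \<open>Sobolev spaces on open intervals\<close>

text \<open>As in Brezis' textbook, the test functions are the compactly supported functions of
  class \<open>C\<^sup>1\<close>, and the spaces of higher order are defined by recursion on the order.\<close>

definition test_functions :: "real set \<Rightarrow> (real \<Rightarrow> real) set" where
  "test_functions S =
     {\<phi>. \<phi> C1_differentiable_on UNIV \<and> (\<exists>K. compact K \<and> K \<subseteq> S \<and> (\<forall>x. x \<notin> K \<longrightarrow> \<phi> x = 0))}"

definition locally_integrable :: "real set \<Rightarrow> (real \<Rightarrow> real) \<Rightarrow> bool" where
  "locally_integrable S u \<longleftrightarrow> (\<forall>K. compact K \<and> K \<subseteq> S \<longrightarrow> integrable (lebesgue_on K) u)"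

definition has_weak_deriv :: "real set \<Rightarrow> (real \<Rightarrow> real) \<Rightarrow> (real \<Rightarrow> real) \<Rightarrow> bool" where
  "has_weak_deriv S u v \<longleftrightarrow> locally_integrable S u \<and> locally_integrable S v \<and>
     (\<forall>\<phi>\<in>test_functions S.
        (LINT x|lebesgue_on S. u x * deriv \<phi> x) = - (LINT x|lebesgue_on S. v x * \<phi> x))"

text \<open>On an open set a weak derivative is unique up to a null set, so for a weakly differentiable
  function the choice below is immaterial in norms and almost-everywhere statements.\<close>

definition weak_deriv :: "real set \<Rightarrow> (real \<Rightarrow> real) \<Rightarrow> real \<Rightarrow> real" where
  "weak_deriv S u = (SOME v. has_weak_deriv S u v)"

primrec sobolev :: "nat \<Rightarrow> ennreal \<Rightarrow> real set \<Rightarrow> (real \<Rightarrow> real) set" where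
  "sobolev 0 p S = Lp_space p S"
| "sobolev (Suc k) p S = {u \<in> Lp_space p S. \<exists>v. has_weak_deriv S u v \<and> v \<in> sobolev k p S}"

primrec sobolev_norm :: "nat \<Rightarrow> ennreal \<Rightarrow> real set \<Rightarrow> (real \<Rightarrow> real) \<Rightarrow> real" where
  "sobolev_norm 0 p S u = Lp_norm p S u"
| "sobolev_norm (Suc k) p S u = Lp_norm p S u + sobolev_norm k p S (weak_deriv S u)"

definition W2p_loc :: "ennreal \<Rightarrow> (real \<Rightarrow> real) set" where
  "W2p_loc p = {u. \<forall>\<delta>\<in>{0<..<1}. u \<in> sobolev 2 p {\<delta><..<1}}"


section \<open>Hoelder spaces\<close>

definition holder_quotients :: "real \<Rightarrow> real set \<Rightarrow> (real \<Rightarrow> real) \<Rightarrow> real set" where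
  "holder_quotients \<gamma> S w =
     {\<bar>w x - w y\<bar> / \<bar>x - y\<bar> powr \<gamma> | x y. x \<in> S \<and> y \<in> S \<and> x \<noteq> y}"

definition holder_space :: "real \<Rightarrow> real set \<Rightarrow> (real \<Rightarrow> real) set" where
  "holder_space \<gamma> S = {w. bdd_above ((\<lambda>x. \<bar>w x\<bar>) ` S) \<and> bdd_above (holder_quotients \<gamma> S w)}"

definition holder_norm :: "real \<Rightarrow> real set \<Rightarrow> (real \<Rightarrow> real) \<Rightarrow> real" where
  "holder_norm \<gamma> S w = (SUP x\<in>S. \<bar>w x\<bar>) + Sup (holder_quotients \<gamma> S w)"


section \<open>The Neumann problem\<close>

text \<open>An element of \<open>W2p_loc p\<close> agrees almost everywhere on \<open>(0, 1]\<close> with exactly one continuous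
  function on \<open>(0, 1]\<close>, which is of class \<open>C\<^sup>1\<close>; the continuity requirement selects this
  representative, so that \<open>u 1\<close> makes sense and \<open>deriv u\<close> is the continuous representative of
  the weak derivative on \<open>(0, 1)\<close>.  Second-order derivatives are weak derivatives
  on \<open>(0, 1)\<close>.  Values of \<open>u\<close> outside \<open>(0, 1]\<close> are irrelevant.\<close>

definition flux :: "real \<Rightarrow> (real \<Rightarrow> real) \<Rightarrow> real \<Rightarrow> real" where
  "flux \<alpha> u = (\<lambda>x. x powr (2 * \<alpha>) * deriv u x)"

definition solves_problem :: "real \<Rightarrow> ennreal \<Rightarrow> (real \<Rightarrow> real) \<Rightarrow> (real \<Rightarrow> real) \<Rightarrow> bool" where
  "solves_problem \<alpha> p f u \<longleftrightarrow>
     u \<in> W2p_loc p \<and> continuous_on {0<..1} u \<and>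
     (AE x in lebesgue. x \<in> {0<..1} \<longrightarrow> - weak_deriv {0<..<1} (flux \<alpha> u) x + u x = f x) \<and>
     u 1 = 0"

text \<open>The second limit is required for finite exponents only, because for bounded \<open>f\<close> it is false
  with \<open>1 / p = 0\<close>: if \<open>\<alpha> = 0\<close> and \<open>f = 1\<close>, then the solution is \<open>u x = 1 - cosh x / cosh 1\<close>,
  and \<open>deriv u x / x\<close> tends to \<open>- 1 / cosh 1\<close> at \<open>0\<close>.\<close>

definition neumann_properties :: "real \<Rightarrow> ennreal \<Rightarrow> (real \<Rightarrow> real) \<Rightarrow> bool" where
  "neumann_properties \<alpha> p u \<longleftrightarrow>
     u \<in> Lp_space p {0<..<1} \<and>
     (flux \<alpha> u \<longlongrightarrow> 0) (at_right 0) \<and>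
     (p < \<infinity> \<longrightarrow>
        ((\<lambda>x. x powr (2 * \<alpha> - 1 + enn2real (1 / p)) * deriv u x) \<longlongrightarrow> 0) (at_right 0)) \<and>
     flux \<alpha> u \<in> sobolev 1 p {0<..<1} \<and>
     (p > 1 \<longrightarrow>
        (\<lambda>x. x powr (2 * \<alpha> - 1) * deriv u x) \<in> Lp_space p {0<..<1} \<and>
        (\<lambda>x. x powr (2 * \<alpha>) * weak_deriv {0<..<1} (deriv u) x) \<in> Lp_space p {0<..<1})"

end

theory Submission
  imports Defs "HOL-Real_Asymp.Real_Asymp"
begin

text \<open>Let \<open>g = x\<^bsup>2\<alpha>\<^esup> u'\<close> be the flux and \<open>w = u - f\<close>.  The equation says that \<open>g\<close> has the weak
  derivative \<open>w\<close>, and the Neumann condition says that \<open>g\<close> vanishes at \<open>0\<close>; together they read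
  \<open>g x = \<integral>\<^sub>0\<^sup>x w\<close>.

  \<^emph>\<open>Existence.\<close>  The homogeneous equation \<open>(x\<^bsup>2\<alpha>\<^esup> \<phi>')' = \<phi>\<close> has a solution that is regular at
  \<open>0\<close>, namely an entire power series with positive coefficients in the variable \<open>x\<^bsup>2-2\<alpha>\<^esup>\<close>
  (\<open>homogeneous_solution\<close>); on \<open>(0, 1]\<close> it lies between \<open>1\<close> and a constant.  With \<open>u = \<phi> v\<close> the
  equation becomes \<open>(x\<^bsup>2\<alpha>\<^esup> \<phi>\<^sup>2 v')' = - \<phi> f\<close>, which two integrations solve
  (\<open>neumann_solution_formula\<close>).  The resulting formula gives the pointwise bound
  \<open>\<bar>u x\<bar> \<le> M \<integral>\<^sub>x\<^sup>1 t\<^bsup>-2\<alpha>\<^esup> \<integral>\<^sub>0\<^sup>t \<bar>f\<bar>\<close>.  By Hoelder's inequality the inner integral is at most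
  \<open>t\<^bsup>1-1/p\<^esup> \<parallel>f\<parallel>\<close>, and because \<open>\<alpha> < 1\<close> the outer integral then grows at most like a power \<open>x\<^bsup>-e\<^esup>\<close> with
  \<open>e < 1/p\<close> (with \<open>e = 0\<close> if \<open>p = \<infinity>\<close>).  Hence \<open>\<parallel>u\<parallel> \<le> K \<parallel>f\<parallel>\<close> in \<open>L\<^sup>p\<close>.

  \<^emph>\<open>Estimates.\<close>  Now \<open>\<parallel>w\<parallel>\<close> is controlled by \<open>\<parallel>f\<parallel>\<close>, and everything else follows from
  \<open>\<bar>g x\<bar> \<le> \<integral>\<^sub>0\<^sup>x \<bar>w\<bar>\<close>.  Hoelder's inequality bounds \<open>g\<close> by \<open>\<parallel>w\<parallel>\<close> and gives the weighted limit at
  \<open>0\<close>; Hardy's inequality puts \<open>g / x = x\<^bsup>2\<alpha>-1\<^esup> u'\<close> into \<open>L\<^sup>p\<close> when \<open>p > 1\<close>, and then also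
  \<open>x\<^bsup>2\<alpha>\<^esup> u'' = w - 2 \<alpha> g / x\<close>; integrating \<open>\<bar>u'\<bar> \<le> x\<^bsup>-2\<alpha>\<^esup> \<parallel>w\<parallel>\<close> gives Hoelder continuity for
  \<open>0 < \<alpha> < 1/2\<close>, and the same bound places \<open>u\<close> in \<open>W\<^bsup>1,p\<^esup>\<close> for \<open>\<alpha> \<le> 0\<close>.

  \<^emph>\<open>Uniqueness.\<close>  For a difference of two solutions, \<open>g' = w\<close> and \<open>w' = x\<^bsup>-2\<alpha>\<^esup> g\<close> hold classically
  (here \<open>w\<close> is the difference itself).  The product \<open>g w\<close> is nondecreasing and tends to \<open>0\<close> at \<open>1\<close>, so
  it is nonpositive; it is half the derivative of \<open>g\<^sup>2\<close>, which tends to \<open>0\<close> at \<open>0\<close>, so \<open>g = 0\<close>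
  (\<open>homogeneous_problem_trivial\<close>).

  Passing between weak and classical derivatives rests on three facts: a product rule with \<open>C\<^sup>1\<close>
  factors, the weak differentiability of indefinite Lebesgue integrals (Fubini), and the lemma of
  du Bois-Reymond, by which a function with weak derivative \<open>0\<close> is constant almost everywhere.\<close>

section \<open>Integrability on subsets of the line\<close>

lemma integrable_lebesgue_on_subset:
  fixes f :: "real \<Rightarrow> real"
  assumes "integrable (lebesgue_on S) f" "T \<subseteq> S" "S \<in> sets lebesgue" "T \<in> sets lebesgue"
  shows "integrable (lebesgue_on T) f"
proof -
  have "integrable lebesgue (\<lambda>x. if x \<in> S then f x else 0)"
    using assms by (simp add: Lebesgue_Measure.integrable_restrict_UNIV)
  then have "integrable lebesgue (\<lambda>x. indicat_real T x *\<^sub>R (if x \<in> S then f x else 0))"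
    by (intro integrable_mult_indicator) (use assms in auto)
  also have "(\<lambda>x. indicat_real T x *\<^sub>R (if x \<in> S then f x else 0)) = (\<lambda>x. if x \<in> T then f x else 0)"
    using assms(2) by (auto simp: indicator_def fun_eq_iff)
  finally show ?thesis
    using assms by (simp add: Lebesgue_Measure.integrable_restrict_UNIV)
qed

lemma integrable_lebesgue_on_zero_outside:
  fixes f :: "real \<Rightarrow> real"
  assumes "integrable (lebesgue_on T) f" "T \<subseteq> S" "S \<in> sets lebesgue" "T \<in> sets lebesgue"
    "\<And>x. x \<in> S - T \<Longrightarrow> f x = 0"
  shows "integrable (lebesgue_on S) f"
proof -
  have "integrable lebesgue (\<lambda>x. if x \<in> T then f x else 0)"
    using assms by (simp add: Lebesgue_Measure.integrable_restrict_UNIV)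
  also have "(\<lambda>x. if x \<in> T then f x else 0) = (\<lambda>x. if x \<in> S then f x else 0)"
    using assms(2,5) by (auto simp: fun_eq_iff)
  finally show ?thesis
    using assms by (simp add: Lebesgue_Measure.integrable_restrict_UNIV)
qed

lemma integral_lebesgue_on_zero_outside:
  fixes f :: "real \<Rightarrow> real"
  assumes "T \<subseteq> S" "S \<in> sets lebesgue" "T \<in> sets lebesgue"
    "\<And>x. x \<in> S - T \<Longrightarrow> f x = 0"
  shows "(LINT x|lebesgue_on S. f x) = (LINT x|lebesgue_on T. f x)"
proof -
  have "(LINT x|lebesgue_on S. f x) = (LINT x|lebesgue_on S. (if x \<in> T then f x else 0))"
    using assms(4) by (intro Bochner_Integration.integral_cong) auto
  also have "\<dots> = (LINT x|lebesgue_on T. f x)"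
    using assms by (simp add: integral_restrict)
  finally show ?thesis .
qed

lemma integrable_mult_continuous_compact:
  fixes h k :: "real \<Rightarrow> real"
  assumes "integrable (lebesgue_on K) h" "compact K" "continuous_on K k"
  shows "integrable (lebesgue_on K) (\<lambda>x. h x * k x)"
proof -
  have K: "K \<in> sets lebesgue"
    using assms(2) by (simp add: compact_imp_closed)
  have "bounded (k ` K)"
    using assms compact_continuous_image compact_imp_bounded by blast
  then obtain B where B: "\<And>x. x \<in> K \<Longrightarrow> \<bar>k x\<bar> \<le> B"
    by (auto simp: bounded_iff)
  have [measurable]: "k \<in> borel_measurable (lebesgue_on K)"
    using assms K by (simp add: continuous_imp_measurable_on_sets_lebesgue)
  have [measurable]: "h \<in> borel_measurable (lebesgue_on K)"
    using assms by auto
  show ?thesis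
  proof (rule Bochner_Integration.integrable_bound)
    show "integrable (lebesgue_on K) (\<lambda>x. B * h x)"
      using assms by simp
    show "AE x in lebesgue_on K. norm (h x * k x) \<le> norm (B * h x)"
    proof (rule AE_I2)
      fix x assume "x \<in> space (lebesgue_on K)"
      then have "\<bar>k x\<bar> \<le> B" using B by simp
      then have "\<bar>k x\<bar> \<le> \<bar>B\<bar>" by linarith
      then show "norm (h x * k x) \<le> norm (B * h x)"
        using mult_right_mono[of "\<bar>k x\<bar>" "\<bar>B\<bar>" "\<bar>h x\<bar>"] by (simp add: abs_mult mult.commute)
    qed
  qed measurable
qed

lemma integrable_continuous_compact:
  fixes k :: "real \<Rightarrow> real"
  assumes "compact K" "continuous_on K k"
  shows "integrable (lebesgue_on K) k"
proof -
  have "K \<in> lmeasurable" using assms(1) by (simp add: lmeasurable_compact)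
  then have "integrable (lebesgue_on K) (\<lambda>x. 1::real)"
    using finite_measure.integrable_const finite_measure_lebesgue_on by blast
  from integrable_mult_continuous_compact[OF this assms] show ?thesis by simp
qed

lemma locally_integrableI_integrable:
  assumes "integrable (lebesgue_on S) h" "S \<in> sets lebesgue"
  shows "locally_integrable S h"
  unfolding locally_integrable_def
proof (intro allI impI)
  fix K assume "compact K \<and> K \<subseteq> S"
  then show "integrable (lebesgue_on K) h"
    using integrable_lebesgue_on_subset[OF assms(1) _ assms(2)] by (simp add: compact_imp_closed)
qed

lemma locally_integrable_continuous:
  assumes "continuous_on S h" shows "locally_integrable S h"
  unfolding locally_integrable_def
  using integrable_continuous_compact continuous_on_subset[OF assms] by blast

lemma locally_integrable_mult_continuous:
  assumes "locally_integrable S h" "continuous_on S k"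
  shows "locally_integrable S (\<lambda>x. h x * k x)"
  using assms(1) integrable_mult_continuous_compact continuous_on_subset[OF assms(2)]
  unfolding locally_integrable_def by blast

lemma locally_integrable_add:
  "locally_integrable S h \<Longrightarrow> locally_integrable S k \<Longrightarrow> locally_integrable S (\<lambda>x. h x + k x)"
  unfolding locally_integrable_def by auto

lemma locally_integrable_diff:
  "locally_integrable S h \<Longrightarrow> locally_integrable S k \<Longrightarrow> locally_integrable S (\<lambda>x. h x - k x)"
  unfolding locally_integrable_def by auto

lemma integrable_lebesgue_on_cong_AE:
  fixes f g :: "real \<Rightarrow> real"
  assumes "integrable (lebesgue_on S) f" "S \<in> sets lebesgue" "AE x in lebesgue_on S. f x = g x"
  shows "integrable (lebesgue_on S) g"
proof -
  have ae: "AE x in lebesgue. (if x \<in> S then f x else 0) = (if x \<in> S then g x else 0)"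
    using assms by (auto simp: AE_restrict_space_iff)
  have f: "integrable lebesgue (\<lambda>x. if x \<in> S then f x else 0)"
    using assms by (simp add: Lebesgue_Measure.integrable_restrict_UNIV)
  have "(\<lambda>x. if x \<in> S then g x else 0) \<in> borel_measurable lebesgue"
    using borel_measurable_AE[OF _ ae] f by auto
  then have "integrable lebesgue (\<lambda>x. if x \<in> S then g x else 0)"
    using integrable_cong_AE[OF _ _ ae] f by auto
  then show ?thesis
    using assms by (simp add: Lebesgue_Measure.integrable_restrict_UNIV)
qed

lemma AE_lebesgue_on_subset:
  assumes "AE x in lebesgue_on S. P x" "T \<subseteq> S" "S \<in> sets lebesgue" "T \<in> sets lebesgue"
  shows "AE x in lebesgue_on T. P x"
  using assms by (auto simp: AE_restrict_space_iff elim!: eventually_mono)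

lemma locally_integrable_cong_AE:
  assumes "locally_integrable S f" "S \<in> sets lebesgue" "AE x in lebesgue_on S. f x = g x"
  shows "locally_integrable S g"
  unfolding locally_integrable_def
proof (intro allI impI)
  fix K assume K: "compact K \<and> K \<subseteq> S"
  then have "K \<in> sets lebesgue" by (simp add: compact_imp_closed)
  with K assms show "integrable (lebesgue_on K) g"
    unfolding locally_integrable_def
    by (metis integrable_lebesgue_on_cong_AE AE_lebesgue_on_subset)
qed

section \<open>Test functions and weak derivatives\<close>

lemma test_functions_C1:
  assumes "\<phi> \<in> test_functions S"
  shows "(\<phi> has_real_derivative deriv \<phi> x) (at x)" "continuous_on A (deriv \<phi>)"
proof -
  obtain D where D: "\<And>x. (\<phi> has_vector_derivative D x) (at x)" "continuous_on UNIV D"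
    using assms unfolding test_functions_def C1_differentiable_on_def by auto
  then have *: "(\<phi> has_real_derivative D x) (at x)" for x
    by (simp add: has_real_derivative_iff_has_vector_derivative)
  then have "deriv \<phi> = D"
    by (intro ext DERIV_imp_deriv)
  with * D(2) show "(\<phi> has_real_derivative deriv \<phi> x) (at x)" "continuous_on A (deriv \<phi>)"
    by (auto intro: continuous_on_subset)
qed

lemma test_functions_continuous: "\<phi> \<in> test_functions S \<Longrightarrow> continuous_on A \<phi>"
  by (intro continuous_at_imp_continuous_on ballI DERIV_isCont[OF test_functions_C1(1)])

lemma test_functions_support:
  assumes "\<phi> \<in> test_functions {a<..<b}" "a < b"
  obtains c d where "a < c" "c < d" "d < b" "\<And>x. x \<notin> {c..d} \<Longrightarrow> \<phi> x = 0"
    "\<And>x. x \<notin> {c..d} \<Longrightarrow> deriv \<phi> x = 0"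
proof -
  obtain K where K: "compact K" "K \<subseteq> {a<..<b}" "\<And>x. x \<notin> K \<Longrightarrow> \<phi> x = 0"
    using assms unfolding test_functions_def by auto
  obtain c0 d0 where cd: "a < c0" "c0 < b" "a < d0" "d0 < b" "K \<subseteq> {c0..d0}"
  proof (cases "K = {}")
    case True
    then show ?thesis using that[of "(a+b)/2" "(a+b)/2"] assms by auto
  next
    case False
    have bdd: "bdd_above K" "bdd_below K"
      using K(1) by (simp_all add: compact_imp_bounded bounded_imp_bdd_above bounded_imp_bdd_below)
    have "Inf K \<in> K" "Sup K \<in> K"
      using False K(1) bdd by (simp_all add: compact_imp_closed closed_contains_Inf closed_contains_Sup)
    moreover have "K \<subseteq> {Inf K..Sup K}"
      using bdd by (auto intro: cInf_lower cSup_upper)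
    ultimately show ?thesis using that[of "Inf K" "Sup K"] K(2) by (metis greaterThanLessThan_iff subsetD)
  qed
  define c where "c = (a + min c0 d0)/2"
  define d where "d = (b + max c0 d0)/2"
  have c: "a < c" "c < c0" "c < d" "d < b" "d0 < d" using cd by (auto simp: c_def d_def min_def max_def)
  have z: "\<phi> x = 0" if "x \<notin> {c..d}" for x
    using that cd c by (intro K(3)) auto
  have "deriv \<phi> x = 0" if "x \<notin> {c..d}" for x
  proof -
    have "open (- {c..d})" "x \<in> - {c..d}" using that by auto
    then have "((\<lambda>x. 0::real) has_field_derivative deriv \<phi> x) (at x)"
      by (rule has_field_derivative_transform_within_open[OF test_functions_C1(1)[OF assms(1), of x]]) (use z in auto)
    then show ?thesis by (metis DERIV_const DERIV_unique)
  qed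
  with z c that show ?thesis by blast
qed

lemma test_functionsI:
  assumes "a < c" "d < b" "\<And>x. x \<notin> {c..d} \<Longrightarrow> \<phi> x = 0"
    "\<And>x. (\<phi> has_real_derivative \<phi>' x) (at x)" "continuous_on UNIV \<phi>'"
  shows "\<phi> \<in> test_functions {a<..<b}"
  unfolding test_functions_def C1_differentiable_on_def
  using assms
  by (auto simp: has_real_derivative_iff_has_vector_derivative intro!: exI[of _ \<phi>'] exI[of _ "{c..d}"])

lemma locally_integrable_integrable_mult:
  assumes "locally_integrable {a<..<b} h" "continuous_on {a<..<b} k"
    "a < c" "d < b" "\<And>x. x \<notin> {c..d} \<Longrightarrow> k x = 0"
  shows "integrable (lebesgue_on {a<..<b}) (\<lambda>x. h x * k x)"
proof (rule integrable_lebesgue_on_zero_outside[of "{c..d}"])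
  have "{c..d} \<subseteq> {a<..<b}" using assms by auto
  then show "integrable (lebesgue_on {c..d}) (\<lambda>x. h x * k x)"
    using assms unfolding locally_integrable_def
    by (intro integrable_mult_continuous_compact) (auto intro: continuous_on_subset)
qed (use assms in auto)

text \<open>This is the inner integral that appears when the order of integration is exchanged in
  \<open>has_weak_deriv_indefinite\<close>.\<close>

lemma integral_test_function:
  assumes \<phi>: "\<phi> \<in> test_functions {a<..<b}" "a < b" and x: "x \<in> {a..b}"
  shows "(LINT t|lebesgue_on {a<..<b}. (if x < t then deriv \<phi> t else 0)) = - \<phi> x"
proof -
  let ?M = "lebesgue_on {a<..<b}"
  obtain c d where cd: "a < c" "c < d" "d < b" "\<And>x. x \<notin> {c..d} \<Longrightarrow> \<phi> x = 0"
    using test_functions_support[OF \<phi>] by metis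
  have "((deriv \<phi>) has_integral (\<phi> b - \<phi> x)) {x..b}"
    using x test_functions_C1[OF \<phi>(1)]
    by (intro fundamental_theorem_of_calculus)
       (auto simp: has_real_derivative_iff_has_vector_derivative intro: has_vector_derivative_at_within)
  moreover have "\<phi> b = 0" using cd by auto
  ultimately have i: "integral {x..b} (deriv \<phi>) = - \<phi> x" by auto
  have int: "integrable (lebesgue_on {x..b}) (deriv \<phi>)"
    using test_functions_C1[OF \<phi>(1)] by (intro integrable_continuous_compact) auto
  have "(LINT t|?M. (if x < t then deriv \<phi> t else 0)) = 
     (LINT t|lebesgue_on {x<..<b}. (if x < t then deriv \<phi> t else 0))"
    using x by (intro integral_lebesgue_on_zero_outside) auto
  also have "\<dots> = (LINT t|lebesgue_on {x<..<b}. deriv \<phi> t)"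
    by (intro Bochner_Integration.integral_cong) auto
  also have "\<dots> = integral {x<..<b} (deriv \<phi>)"
    by (intro lebesgue_integral_eq_integral integrable_lebesgue_on_subset[OF int]) auto
  also have "\<dots> = integral {x..b} (deriv \<phi>)"
    by (simp add: integral_open_interval_real)
  finally show ?thesis using i by simp
qed

lemma integral_deriv_test_function:
  assumes \<phi>: "\<phi> \<in> test_functions {a<..<b}" "a < b"
  shows "(LINT t|lebesgue_on {a<..<b}. deriv \<phi> t) = 0"
proof -
  let ?M = "lebesgue_on {a<..<b}"
  obtain c d where cd: "a < c" "c < d" "d < b" "\<And>x. x \<notin> {c..d} \<Longrightarrow> \<phi> x = 0"
    using test_functions_support[OF \<phi>] by metis
  have "(LINT t|?M. deriv \<phi> t) = (LINT t|?M. (if a < t then deriv \<phi> t else 0))"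
    by (intro Bochner_Integration.integral_cong) auto
  then show ?thesis using integral_test_function[OF \<phi>, of a] cd by auto
qed

lemma integrable_test_function:
  assumes "\<phi> \<in> test_functions {a<..<b}" "locally_integrable {a<..<b} h" "a < b"
  shows "integrable (lebesgue_on {a<..<b}) (\<lambda>x. h x * \<phi> x)"
    "integrable (lebesgue_on {a<..<b}) (\<lambda>x. h x * deriv \<phi> x)"
proof -
  obtain c d where cd: "a < c" "c < d" "d < b" "\<And>x. x \<notin> {c..d} \<Longrightarrow> \<phi> x = 0"
    "\<And>x. x \<notin> {c..d} \<Longrightarrow> deriv \<phi> x = 0"
    using test_functions_support[OF assms(1,3)] by metis
  show "integrable (lebesgue_on {a<..<b}) (\<lambda>x. h x * \<phi> x)"
    "integrable (lebesgue_on {a<..<b}) (\<lambda>x. h x * deriv \<phi> x)"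
    using cd assms(2) test_functions_C1[OF assms(1)] test_functions_continuous[OF assms(1)]
    by (auto intro!: locally_integrable_integrable_mult)
qed

lemma has_weak_deriv_const:
  assumes "a < b" shows "has_weak_deriv {a<..<b} (\<lambda>_. k) (\<lambda>_. 0)"
  unfolding has_weak_deriv_def
  using integral_deriv_test_function[OF _ assms] by (auto intro!: locally_integrable_continuous)

lemma has_weak_deriv_add:
  assumes "has_weak_deriv {a<..<b} u v" "has_weak_deriv {a<..<b} u' v'" "a < b"
  shows "has_weak_deriv {a<..<b} (\<lambda>x. u x + u' x) (\<lambda>x. v x + v' x)"
  using assms unfolding has_weak_deriv_def
  by (auto simp: distrib_right integrable_test_function intro!: locally_integrable_add)

text \<open>The product of a test function with \<open>\<theta>\<close> is again a test function, although \<open>\<theta>\<close> may be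
  unbounded near the end points, because the support stays away from them.\<close>

lemma has_weak_deriv_mult:
  assumes w: "has_weak_deriv {a<..<b} u v" and "a < b"
    and \<theta>: "\<And>x. x \<in> {a<..<b} \<Longrightarrow> (\<theta> has_real_derivative \<theta>' x) (at x)"
    and \<theta>': "continuous_on {a<..<b} \<theta>'"
  shows "has_weak_deriv {a<..<b} (\<lambda>x. u x * \<theta> x) (\<lambda>x. v x * \<theta> x + u x * \<theta>' x)"
proof -
  let ?M = "lebesgue_on {a<..<b}"
  have u: "locally_integrable {a<..<b} u" and v: "locally_integrable {a<..<b} v"
    using w by (auto simp: has_weak_deriv_def)
  have c\<theta>: "continuous_on {a<..<b} \<theta>"
    by (intro continuous_at_imp_continuous_on ballI DERIV_isCont[OF \<theta>])
  show ?thesis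
    unfolding has_weak_deriv_def
  proof (intro conjI ballI)
    fix \<phi> assume \<phi>: "\<phi> \<in> test_functions {a<..<b}"
    obtain c d where cd: "a < c" "c < d" "d < b" "\<And>x. x \<notin> {c..d} \<Longrightarrow> \<phi> x = 0"
      "\<And>x. x \<notin> {c..d} \<Longrightarrow> deriv \<phi> x = 0"
      using test_functions_support[OF \<phi> \<open>a < b\<close>] by metis
    define D where "D x = (if x \<in> {a<..<b} then \<theta>' x * \<phi> x + deriv \<phi> x * \<theta> x else 0)" for x
    have D: "((\<lambda>x. \<theta> x * \<phi> x) has_real_derivative D x) (at x)" for x
    proof (cases "x \<in> {a<..<b}")
      case True
      then show ?thesis using \<theta> test_functions_C1(1)[OF \<phi>]
        by (auto simp: D_def intro!: derivative_eq_intros)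
    next
      case False
      have "((\<lambda>x. 0) has_real_derivative 0) (at x)" by simp
      then have "((\<lambda>x. \<theta> x * \<phi> x) has_real_derivative 0) (at x)"
        by (rule has_field_derivative_transform_within_open[where S = "- {c..d}"]) (use cd False in auto)
      then show ?thesis using False by (auto simp: D_def)
    qed
    have "continuous_on ({a<..<b} \<union> (- {c..d})) D"
    proof (rule continuous_on_open_Un)
      show "continuous_on {a<..<b} D"
      proof (rule continuous_on_eq)
        show "continuous_on {a<..<b} (\<lambda>x. \<theta>' x * \<phi> x + deriv \<phi> x * \<theta> x)"
          using c\<theta> \<theta>' test_functions_C1(2)[OF \<phi>] test_functions_continuous[OF \<phi>]
          by (intro continuous_intros)
      qed (auto simp: D_def)
      show "continuous_on (- {c..d}) D"
        by (rule continuous_on_eq[of _ "\<lambda>_. 0"]) (use cd in \<open>auto simp: D_def\<close>)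
    qed auto
    moreover have "{a<..<b} \<union> (- {c..d}) = UNIV" using cd by auto
    ultimately have cD: "continuous_on UNIV D" by simp
    have t: "(\<lambda>x. \<theta> x * \<phi> x) \<in> test_functions {a<..<b}"
      by (rule test_functionsI[OF cd(1,3) _ D cD]) (use cd in auto)
    have dt: "deriv (\<lambda>x. \<theta> x * \<phi> x) = D"
      using DERIV_imp_deriv[OF D] by auto
    have li: "locally_integrable {a<..<b} (\<lambda>x. u x * \<theta>' x)" "locally_integrable {a<..<b} (\<lambda>x. u x * \<theta> x)"
      "locally_integrable {a<..<b} (\<lambda>x. v x * \<theta> x)"
      using u v c\<theta> \<theta>' by (auto intro: locally_integrable_mult_continuous)
    note i = integrable_test_function[OF \<phi> li(1) \<open>a < b\<close>] integrable_test_function[OF \<phi> li(2) \<open>a < b\<close>]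
      integrable_test_function[OF \<phi> li(3) \<open>a < b\<close>]
    have "(LINT x|?M. u x * D x) = - (LINT x|?M. v x * (\<theta> x * \<phi> x))"
      using w t dt unfolding has_weak_deriv_def by metis
    moreover have "(LINT x|?M. u x * D x)
      = (LINT x|?M. u x * \<theta>' x * \<phi> x + u x * \<theta> x * deriv \<phi> x)"
      by (intro Bochner_Integration.integral_cong) (auto simp: D_def algebra_simps)
    moreover have "\<dots> = (LINT x|?M. u x * \<theta>' x * \<phi> x) + (LINT x|?M. u x * \<theta> x * deriv \<phi> x)"
      using i by (intro Bochner_Integration.integral_add) auto
    moreover have "(LINT x|?M. (v x * \<theta> x + u x * \<theta>' x) * \<phi> x)
      = (LINT x|?M. v x * \<theta> x * \<phi> x + u x * \<theta>' x * \<phi> x)"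
      by (simp add: distrib_right)
    moreover have "\<dots> = (LINT x|?M. v x * \<theta> x * \<phi> x) + (LINT x|?M. u x * \<theta>' x * \<phi> x)"
      using i by (intro Bochner_Integration.integral_add) auto
    ultimately show "(LINT x|?M. u x * \<theta> x * deriv \<phi> x) =
         - (LINT x|?M. (v x * \<theta> x + u x * \<theta>' x) * \<phi> x)"
      by (simp add: mult.assoc)
  qed (use u v c\<theta> \<theta>' in \<open>auto intro!: locally_integrable_mult_continuous locally_integrable_add\<close>)
qed

lemma has_weak_deriv_C1:
  assumes "a < b" "\<And>x. x \<in> {a<..<b} \<Longrightarrow> (\<theta> has_real_derivative \<theta>' x) (at x)"
    "continuous_on {a<..<b} \<theta>'"
  shows "has_weak_deriv {a<..<b} \<theta> \<theta>'"
  using has_weak_deriv_mult[OF has_weak_deriv_const[OF assms(1), of 1] assms] by simp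

lemma has_weak_deriv_diff:
  assumes "has_weak_deriv {a<..<b} u v" "has_weak_deriv {a<..<b} u' v'" "a < b"
  shows "has_weak_deriv {a<..<b} (\<lambda>x. u x - u' x) (\<lambda>x. v x - v' x)"
  using has_weak_deriv_add[OF assms(1) has_weak_deriv_mult[OF assms(2,3), of "\<lambda>_. -1" "\<lambda>_. 0"] assms(3)]
  by simp

lemma has_weak_deriv_cong_AE:
  assumes "has_weak_deriv {a<..<b} u v" "a < b"
    and u: "AE x in lebesgue_on {a<..<b}. u x = u' x" and v: "AE x in lebesgue_on {a<..<b}. v x = v' x"
  shows "has_weak_deriv {a<..<b} u' v'"
proof -
  let ?M = "lebesgue_on {a<..<b}"
  have l: "locally_integrable {a<..<b} u" "locally_integrable {a<..<b} v"
    using assms unfolding has_weak_deriv_def by blast+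
  have l': "locally_integrable {a<..<b} u'" "locally_integrable {a<..<b} v'"
    using l u v by (auto intro: locally_integrable_cong_AE)
  show ?thesis unfolding has_weak_deriv_def
  proof (intro conjI ballI l')
    fix \<phi> assume \<phi>: "\<phi> \<in> test_functions {a<..<b}"
    note i = integrable_test_function[OF \<phi> l(1) \<open>a < b\<close>] integrable_test_function[OF \<phi> l(2) \<open>a < b\<close>]
      integrable_test_function[OF \<phi> l'(1) \<open>a < b\<close>] integrable_test_function[OF \<phi> l'(2) \<open>a < b\<close>]
    have "(LINT x|?M. u' x * deriv \<phi> x) = (LINT x|?M. u x * deriv \<phi> x)"
      by (intro integral_cong_AE borel_measurable_integrable i eventually_mono[OF u]) simp
    moreover have "(LINT x|?M. v' x * \<phi> x) = (LINT x|?M. v x * \<phi> x)"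
      by (intro integral_cong_AE borel_measurable_integrable i eventually_mono[OF v]) simp
    ultimately show "(LINT x|?M. u' x * deriv \<phi> x) = - (LINT x|?M. v' x * \<phi> x)"
      using assms(1) \<phi> unfolding has_weak_deriv_def by auto
  qed
qed

text \<open>Integration by parts for an absolutely continuous function: Fubini's theorem moves the
  integral from \<open>h\<close> to the derivative of the test function.\<close>

lemma has_weak_deriv_indefinite:
  assumes h: "integrable (lebesgue_on {a<..<b}) h" and "a < b"
  shows "has_weak_deriv {a<..<b} (\<lambda>x. integral {a..x} h) h"
proof -
  let ?M = "lebesgue_on {a<..<b}"
  interpret M: finite_measure ?M
    by (rule finite_measure_lebesgue_on) auto
  interpret MM: pair_sigma_finite ?M ?M ..
  have hab: "h integrable_on {a..b}"
    using has_integral_integral_lebesgue_on[OF h] integrable_on_Icc_iff_Ioo by auto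
  have H: "integral {a..x} h = (LINT t|?M. (if t < x then h t else 0))" if "x \<in> {a<..<b}" for x
  proof -
    have "(LINT t|?M. (if t < x then h t else 0)) = (LINT t|lebesgue_on {a<..<x}. (if t < x then h t else 0))"
      using that by (intro integral_lebesgue_on_zero_outside) auto
    also have "\<dots> = (LINT t|lebesgue_on {a<..<x}. h t)"
      by (intro Bochner_Integration.integral_cong) auto
    also have "\<dots> = integral {a<..<x} h"
      using that by (intro lebesgue_integral_eq_integral integrable_lebesgue_on_subset[OF h]) auto
    finally show ?thesis by (simp add: integral_open_interval_real)
  qed
  show ?thesis
    unfolding has_weak_deriv_def
  proof (intro conjI ballI)
    show "locally_integrable {a<..<b} (\<lambda>x. integral {a..x} h)"
      by (intro locally_integrable_continuous continuous_on_subset[OF indefinite_integral_continuous_1[OF hab]]) auto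
    show "locally_integrable {a<..<b} h"
      using h by (intro locally_integrableI_integrable) auto
    fix \<phi> assume \<phi>: "\<phi> \<in> test_functions {a<..<b}"
    have "bounded (deriv \<phi> ` {a..b})"
      using test_functions_C1(2)[OF \<phi>] compact_continuous_image compact_imp_bounded by blast
    then obtain B where B: "\<And>x. x \<in> {a..b} \<Longrightarrow> \<bar>deriv \<phi> x\<bar> \<le> B"
      by (metis bounded_iff imageI real_norm_def)
    have [measurable]: "deriv \<phi> \<in> borel_measurable borel"
      using test_functions_C1(2)[OF \<phi>] by (rule borel_measurable_continuous_onI)
    have [measurable]: "(\<lambda>x. x) \<in> ?M \<rightarrow>\<^sub>M borel"
      by (simp add: continuous_imp_measurable_on_sets_lebesgue)
    have [measurable]: "deriv \<phi> \<in> borel_measurable ?M"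
      using test_functions_C1(2)[OF \<phi>] by (simp add: continuous_imp_measurable_on_sets_lebesgue)
    have [measurable]: "h \<in> borel_measurable ?M" using h by auto
    have int: "integrable (?M \<Otimes>\<^sub>M ?M) (\<lambda>(x,t). (if t < x then h t else 0) * deriv \<phi> x)"
    proof (rule Bochner_Integration.integrable_bound)
      show "integrable (?M \<Otimes>\<^sub>M ?M) (\<lambda>(x,t). B * h t)"
        by (rule MM.Fubini_integrable) (use h in auto)
      show "AE x in ?M \<Otimes>\<^sub>M ?M. norm (case x of (x, t) \<Rightarrow> (if t < x then h t else 0) * deriv \<phi> x)
         \<le> norm (case x of (x, t) \<Rightarrow> B * h t)"
      proof (rule AE_I2)
        fix y assume "y \<in> space (?M \<Otimes>\<^sub>M ?M)"
        then obtain x t where y: "y = (x, t)" "x \<in> {a..b}" by (auto simp: space_pair_measure)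
        have "\<bar>deriv \<phi> x\<bar> \<le> \<bar>B\<bar>" using B[OF y(2)] by linarith
        then show "norm (case y of (x, t) \<Rightarrow> (if t < x then h t else 0) * deriv \<phi> x)
         \<le> norm (case y of (x, t) \<Rightarrow> B * h t)"
          using y mult_right_mono[of "\<bar>deriv \<phi> x\<bar>" "\<bar>B\<bar>" "\<bar>h t\<bar>"] by (simp add: abs_mult mult.commute)
      qed
    qed measurable
    have "(LINT x|?M. integral {a..x} h * deriv \<phi> x)
       = (LINT x|?M. (LINT t|?M. (if t < x then h t else 0) * deriv \<phi> x))"
      using H by (intro Bochner_Integration.integral_cong) auto
    also have "\<dots> = (LINT t|?M. (LINT x|?M. (if t < x then h t else 0) * deriv \<phi> x))"
      using MM.Fubini_integral[OF int] by simp
    also have "\<dots> = (LINT t|?M. h t * (LINT x|?M. (if t < x then deriv \<phi> x else 0)))"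
    proof (intro Bochner_Integration.integral_cong refl)
      fix t
      have "(\<lambda>x. (if t < x then h t else 0) * deriv \<phi> x) = (\<lambda>x. h t * (if t < x then deriv \<phi> x else 0))"
        by auto
      then show "(LINT x|?M. (if t < x then h t else 0) * deriv \<phi> x) = h t * (LINT x|?M. (if t < x then deriv \<phi> x else 0))"
        by simp
    qed
    also have "\<dots> = (LINT t|?M. - (h t * \<phi> t))"
      using integral_test_function[OF \<phi> \<open>a < b\<close>]
      by (intro Bochner_Integration.integral_cong) auto
    finally show "(LINT x|?M. integral {a..x} h * deriv \<phi> x) = - (LINT x|?M. h x * \<phi> x)"
      by simp
  qed
qed

lemma has_weak_deriv_subset:
  assumes w: "has_weak_deriv {a<..<b} u v" and cd: "a \<le> c" "c < d" "d \<le> b"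
  shows "has_weak_deriv {c<..<d} u v"
proof -
  have sub: "{c<..<d} \<subseteq> {a<..<b}" using cd by auto
  have li: "locally_integrable {c<..<d} u" "locally_integrable {c<..<d} v"
    using w sub unfolding has_weak_deriv_def locally_integrable_def by (meson order_trans)+
  show ?thesis
    unfolding has_weak_deriv_def
  proof (intro conjI ballI li)
    fix \<phi> assume \<phi>: "\<phi> \<in> test_functions {c<..<d}"
    then have \<phi>': "\<phi> \<in> test_functions {a<..<b}"
      using sub unfolding test_functions_def by blast
    obtain c' d' where "c < c'" "d' < d" "\<And>x. x \<notin> {c'..d'} \<Longrightarrow> \<phi> x = 0" "\<And>x. x \<notin> {c'..d'} \<Longrightarrow> deriv \<phi> x = 0"
      using test_functions_support[OF \<phi> cd(2)] by metis
    then have z: "\<phi> x = 0" "deriv \<phi> x = 0" if "x \<notin> {c<..<d}" for x using that by auto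
    have "(LINT x|lebesgue_on {a<..<b}. u x * deriv \<phi> x) = (LINT x|lebesgue_on {c<..<d}. u x * deriv \<phi> x)"
      "(LINT x|lebesgue_on {a<..<b}. v x * \<phi> x) = (LINT x|lebesgue_on {c<..<d}. v x * \<phi> x)"
      using sub z by (auto intro!: integral_lebesgue_on_zero_outside)
    then show "(LINT x|lebesgue_on {c<..<d}. u x * deriv \<phi> x) = - (LINT x|lebesgue_on {c<..<d}. v x * \<phi> x)"
      using w \<phi>' unfolding has_weak_deriv_def by auto
  qed
qed

section \<open>The lemma of du Bois-Reymond and regularity\<close>

text \<open>The positive and the negative part of \<open>v\<close> are densities of finite measures that agree on all
  half-lines, hence are equal.  Comparing measures requires Borel sets, so \<open>v\<close> is first replaced by
  an almost everywhere equal Borel function.\<close>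

lemma AE_zero_if_tail_integrals_zero:
  fixes v :: "real \<Rightarrow> real"
  assumes v: "integrable lebesgue v" and z: "\<And>x. (LINT t|lebesgue. indicator {x<..} t * v t) = 0"
  shows "AE x in lebesgue. v x = 0"
proof -
  obtain w where w[measurable]: "w \<in> borel_measurable lborel" and vw: "AE x in lborel. v x = w x"
    using completion_ex_borel_measurable_real[of v lborel] v by auto
  have vw': "AE x in lebesgue. v x = w x" using vw by (rule AE_completion)
  have "integrable lebesgue w"
    using v vw' integrable_cong_AE[of v lebesgue w] measurable_completion[OF w] by auto
  then have iw: "integrable lborel w" by (simp add: integrable_completion)
  have zw: "(LINT t|lborel. indicator {x<..} t * w t) = 0" for x
  proof -
    have "(LINT t|lborel. indicator {x<..} t * w t) = (LINT t|lebesgue. indicator {x<..} t * w t)"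
      by (rule integral_completion[symmetric]) measurable
    also have "\<dots> = (LINT t|lebesgue. indicator {x<..} t * v t)"
    proof (rule integral_cong_AE)
      show "AE t in lebesgue. indicator {x<..} t * w t = indicator {x<..} t * v t"
        using vw' by (auto elim!: eventually_mono)
      show "(\<lambda>t. indicator {x<..} t * w t) \<in> borel_measurable lebesgue"
        by (intro measurable_completion) measurable
      have [measurable]: "v \<in> borel_measurable lebesgue" using v by auto
      show "(\<lambda>t. indicator {x<..} t * v t) \<in> borel_measurable lebesgue"
        by (intro borel_measurable_times borel_measurable_indicator) auto
    qed
    finally show ?thesis using z by simp
  qed
  have ip: "integrable lborel (\<lambda>t. max 0 (w t))" "integrable lborel (\<lambda>t. max 0 (- w t))"
    using iw by auto
  have ii: "integrable lborel (\<lambda>t. indicator {x<..} t * max 0 (w t))" "integrable lborel (\<lambda>t. indicator {x<..} t * max 0 (- w t))" for x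
    using integrable_mult_indicator[OF _ ip(1), of "{x<..}"] integrable_mult_indicator[OF _ ip(2), of "{x<..}"]
    by auto
  have sx: "{x<..} \<in> sets borel" for x :: real by simp
  have em: "emeasure (density lborel (\<lambda>t. ennreal (max 0 (f t)))) {x<..} = ennreal (LINT t|lborel. indicator {x<..} t * max 0 (f t))"
    if "f \<in> borel_measurable borel" "integrable lborel (\<lambda>t. indicator {x<..} t * max 0 (f t))" for f and x :: real
  proof -
    have "emeasure (density lborel (\<lambda>t. ennreal (max 0 (f t)))) {x<..} = (\<integral>\<^sup>+t. ennreal (indicator {x<..} t * max 0 (f t)) \<partial>lborel)"
      using that sx[of x] by (subst emeasure_density) (auto intro!: nn_integral_cong split: split_indicator)
    also have "\<dots> = ennreal (LINT t|lborel. indicator {x<..} t * max 0 (f t))"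
      using that by (intro nn_integral_eq_integral) auto
    finally show ?thesis .
  qed
  have "density lborel (\<lambda>t. ennreal (max 0 (w t))) = density lborel (\<lambda>t. ennreal (max 0 (- w t)))"
  proof (rule measure_eqI_lessThan)
    fix x
    show "emeasure (density lborel (\<lambda>t. ennreal (max 0 (w t)))) {x<..} < \<infinity>"
      using em[of w x] ii by simp
    have "(LINT t|lborel. indicator {x<..} t * max 0 (w t)) - (LINT t|lborel. indicator {x<..} t * max 0 (- w t))
      = (LINT t|lborel. indicator {x<..} t * max 0 (w t) - indicator {x<..} t * max 0 (- w t))"
      using ii by simp
    also have "(\<lambda>t. indicator {x<..} t * max 0 (w t) - indicator {x<..} t * max 0 (- w t)) = (\<lambda>t. indicator {x<..} t * w t)"
      by (auto simp: fun_eq_iff max_def)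
    finally show "emeasure (density lborel (\<lambda>t. ennreal (max 0 (w t)))) {x<..} = emeasure (density lborel (\<lambda>t. ennreal (max 0 (- w t)))) {x<..}"
      using em[of w x] em[of "\<lambda>t. - w t" x] ii zw by simp
  qed auto
  then have "AE t in lborel. ennreal (max 0 (w t)) = ennreal (max 0 (- w t))"
    by (subst (asm) sigma_finite_measure.density_unique_iff[OF sigma_finite_lborel]) auto
  then have "AE t in lborel. w t = 0"
    by eventually_elim (auto simp: max_def ennreal_eq_0_iff split: if_splits)
  then have "AE t in lebesgue. w t = 0" by (rule AE_completion)
  with vw' show ?thesis by eventually_elim auto
qed

text \<open>The squared positive part is the building block of test functions: it vanishes on a half-line and
  is continuously differentiable.\<close>

lemma has_real_derivative_max_squared:
  "((\<lambda>y::real. (max 0 y)\<^sup>2) has_real_derivative 2 * max 0 x) (at x)"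
proof -
  consider "x > 0" | "x < 0" | "x = 0" by linarith
  then show ?thesis
  proof cases
    case 1
    have "((\<lambda>y::real. y\<^sup>2) has_real_derivative 2 * x) (at x)" by (auto intro!: derivative_eq_intros)
    then have "((\<lambda>y::real. (max 0 y)\<^sup>2) has_real_derivative 2 * x) (at x)"
      by (rule has_field_derivative_transform_within_open[where S = "{0<..}"]) (use 1 in auto)
    then show ?thesis using 1 by simp
  next
    case 2
    have "((\<lambda>y::real. 0) has_real_derivative 0) (at x)" by simp
    then have "((\<lambda>y::real. (max 0 y)\<^sup>2) has_real_derivative 0) (at x)"
      by (rule has_field_derivative_transform_within_open[where S = "{..<0}"]) (use 2 in auto)
    then show ?thesis using 2 by simp
  next
    case 3
    have "((\<lambda>h::real. max 0 h) \<longlongrightarrow> max 0 0) (at 0)"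
      by (intro tendsto_intros)
    moreover have "\<forall>\<^sub>F h::real in at 0. max 0 h = ((max 0 (0 + h))\<^sup>2 - (max 0 0)\<^sup>2) / h"
      by (auto simp: eventually_at_filter max_def power2_eq_square intro!: always_eventually)
    ultimately show ?thesis
      unfolding DERIV_def 3 using tendsto_cong by force
  qed
qed

text \<open>The squares make this function continuously differentiable across \<open>s\<close> and \<open>t\<close>, where it is cut
  off.\<close>

definition bump :: "real \<Rightarrow> real \<Rightarrow> real \<Rightarrow> real" where
  "bump s t x = (max 0 (x - s))\<^sup>2 * (max 0 (t - x))\<^sup>2"

lemma bump_nonneg: "0 \<le> bump s t x" and
  bump_pos: "s < x \<Longrightarrow> x < t \<Longrightarrow> 0 < bump s t x" and
  bump_zero: "x \<notin> {s<..<t} \<Longrightarrow> bump s t x = 0"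
  by (auto simp: bump_def max_def)

lemma bump_cutoff_test_function:
  assumes "a < s" "t < b"
  shows "(\<lambda>x. 1 - exp (- n * bump s t x)) \<in> test_functions {a<..<b}"
proof (rule test_functionsI[OF assms])
  define b' where "b' x = 2 * max 0 (x - s) * (max 0 (t - x))\<^sup>2 - (max 0 (x - s))\<^sup>2 * (2 * max 0 (t - x))" for x
  have d: "(bump s t has_real_derivative b' x) (at x)" for x
  proof -
    have 1: "((\<lambda>x. (max 0 (x - s))\<^sup>2) has_real_derivative 2 * max 0 (x - s) * 1) (at x)"
      by (rule DERIV_chain2[where f = "\<lambda>y. (max 0 y)\<^sup>2", OF has_real_derivative_max_squared]) (auto intro!: derivative_eq_intros)
    have 2: "((\<lambda>x. (max 0 (t - x))\<^sup>2) has_real_derivative 2 * max 0 (t - x) * -1) (at x)"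
      by (rule DERIV_chain2[where f = "\<lambda>y. (max 0 y)\<^sup>2", OF has_real_derivative_max_squared]) (auto intro!: derivative_eq_intros)
    show ?thesis
      using DERIV_mult[OF 1 2] unfolding bump_def[abs_def] by (simp add: b'_def algebra_simps)
  qed
  have cb: "continuous_on UNIV (bump s t)"
    by (intro continuous_at_imp_continuous_on ballI DERIV_isCont[OF d])
  show "((\<lambda>x. 1 - exp (- n * bump s t x)) has_real_derivative n * b' x * exp (- n * bump s t x)) (at x)" for x
    by (auto intro!: derivative_eq_intros d)
  show "continuous_on UNIV (\<lambda>x. n * b' x * exp (- n * bump s t x))"
    unfolding b'_def by (intro continuous_intros cb)
qed (auto simp: bump_zero)

text \<open>The functions \<open>1 - exp (- n b)\<close>, with \<open>b\<close> the bump on \<open>(s, t)\<close>, are test functions that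
  increase to the indicator function of \<open>(s, t)\<close>.  So the integral of \<open>v\<close> over every such interval is
  \<open>0\<close>, and \<open>AE_zero_if_tail_integrals_zero\<close> applies on compact subintervals.\<close>

lemma AE_zero_if_orthogonal_to_test_functions:
  assumes "a < b" and v: "locally_integrable {a<..<b} v"
    and z: "\<And>\<phi>. \<phi> \<in> test_functions {a<..<b} \<Longrightarrow> (LINT x|lebesgue_on {a<..<b}. v x * \<phi> x) = 0"
  shows "AE x in lebesgue_on {a<..<b}. v x = 0"
proof -
  let ?M = "lebesgue_on {a<..<b}"
  have interval: "(LINT x|lebesgue_on {s<..<t}. v x) = 0" if st: "a < s" "t < b" for s t
  proof -
    have K: "{s..t} \<subseteq> {a<..<b}" using st by auto
    have vi: "integrable (lebesgue_on {s..t}) v"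
      using v K unfolding locally_integrable_def by auto
    then have [measurable]: "v \<in> borel_measurable (lebesgue_on {s..t})" by auto
    let ?\<rho> = "\<lambda>n x. 1 - exp (- real n * bump s t x)"
    have m: "?\<rho> n \<in> borel_measurable (lebesgue_on {s..t})" for n
      by (intro continuous_imp_measurable_on_sets_lebesgue test_functions_continuous[OF bump_cutoff_test_function[OF st]]) auto
    have lim: "(\<lambda>n. LINT x|lebesgue_on {s..t}. v x * ?\<rho> n x) \<longlonglongrightarrow> (LINT x|lebesgue_on {s..t}. (if x \<in> {s<..<t} then v x else 0))"
    proof (rule integral_dominated_convergence[where w = "\<lambda>x. norm (v x)"])
      show "AE x in lebesgue_on {s..t}. (\<lambda>n. v x * ?\<rho> n x) \<longlonglongrightarrow> (if x \<in> {s<..<t} then v x else 0)"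
      proof (rule AE_I2)
        fix x
        show "(\<lambda>n. v x * ?\<rho> n x) \<longlonglongrightarrow> (if x \<in> {s<..<t} then v x else 0)"
        proof (cases "x \<in> {s<..<t}")
          case True
          then have "0 < bump s t x" by (auto intro: bump_pos)
          then have "(\<lambda>n. ?\<rho> n x) \<longlonglongrightarrow> 1" by real_asymp
          from tendsto_mult_left[OF this, of "v x"] show ?thesis using True by simp
        next
          case False
          then show ?thesis using bump_zero[OF False] by auto
        qed
      qed
      show "AE x in lebesgue_on {s..t}. norm (v x * ?\<rho> n x) \<le> norm (v x)" for n
      proof (rule AE_I2)
        fix x
        have "exp (- real n * bump s t x) \<le> 1" using bump_nonneg by simp
        then have "\<bar>?\<rho> n x\<bar> \<le> 1" by (simp add: abs_if)
        then show "norm (v x * ?\<rho> n x) \<le> norm (v x)"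
          by (simp only: real_norm_def abs_mult mult_left_le abs_ge_zero)
      qed
      show "(\<lambda>x. if x \<in> {s<..<t} then v x else 0) \<in> borel_measurable (lebesgue_on {s..t})"
        using borel_measurable_if_lebesgue_on[of "{s<..<t}" "{s..t}" v] vi
          integrable_lebesgue_on_subset[OF vi, of "{s<..<t}"] by (auto simp: greaterThanLessThan_subseteq_atLeastAtMost_iff)
    qed (use vi m in \<open>auto intro!: borel_measurable_times\<close>)
    have zero: "(LINT x|lebesgue_on {s..t}. v x * ?\<rho> n x) = 0" for n
    proof -
      have "(LINT x|lebesgue_on {s..t}. v x * ?\<rho> n x) = (LINT x|?M. v x * ?\<rho> n x)"
        using K by (intro integral_lebesgue_on_zero_outside[symmetric]) (auto simp: bump_zero)
      then show ?thesis using z[OF bump_cutoff_test_function[OF st]] by simp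
    qed
    have "(LINT x|lebesgue_on {s..t}. (if x \<in> {s<..<t} then v x else 0)) = 0"
      using lim unfolding zero by (simp only: LIMSEQ_const_iff)
    then show ?thesis
      by (subst (asm) integral_restrict) auto
  qed
  have compact_case: "AE x in lebesgue. x \<in> {c<..<d} \<longrightarrow> v x = 0" if cd: "a < c" "d < b" for c d
  proof -
    have K: "{c..d} \<subseteq> {a<..<b}" using cd by auto
    have "integrable (lebesgue_on {c..d}) v"
      using v K unfolding locally_integrable_def by auto
    then have vi: "integrable (lebesgue_on {c<..<d}) v"
      by (rule integrable_lebesgue_on_subset) auto
    have "AE x in lebesgue. (if x \<in> {c<..<d} then v x else 0) = 0"
    proof (rule AE_zero_if_tail_integrals_zero)
      show "integrable lebesgue (\<lambda>x. if x \<in> {c<..<d} then v x else 0)"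
        using vi by (subst Lebesgue_Measure.integrable_restrict_UNIV) auto
      fix x
      have "(LINT t|lebesgue. indicator {x<..} t * (if t \<in> {c<..<d} then v t else 0))
         = (LINT t|lebesgue. (if t \<in> {max c x<..<d} then v t else 0))"
        by (intro Bochner_Integration.integral_cong) (auto simp: indicator_def)
      also have "\<dots> = (LINT t|lebesgue_on {max c x<..<d}. v t)"
        by (rule Lebesgue_Measure.integral_restrict_UNIV) auto
      also have "\<dots> = 0" using cd by (intro interval) auto
      finally show "(LINT t|lebesgue. indicator {x<..} t * (if t \<in> {c<..<d} then v t else 0)) = 0" .
    qed
    then show ?thesis by eventually_elim auto
  qed
  have "AE x in lebesgue. \<forall>n::nat. x \<in> {a + inverse (Suc n)<..<b - inverse (Suc n)} \<longrightarrow> v x = 0"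
    unfolding AE_all_countable by (intro allI compact_case) auto
  then have "AE x in lebesgue. x \<in> {a<..<b} \<longrightarrow> v x = 0"
  proof eventually_elim
    case (elim x)
    show ?case
    proof
      assume x: "x \<in> {a<..<b}"
      then have "0 < min (x - a) (b - x)" by auto
      then obtain n where "inverse (Suc n) < min (x - a) (b - x)"
        using reals_Archimedean by blast
      then have "x \<in> {a + inverse (Suc n)<..<b - inverse (Suc n)}" by auto
      with elim show "v x = 0" by blast
    qed
  qed
  then show ?thesis by (simp add: AE_restrict_space_iff)
qed

text \<open>The vanishing integral makes the antiderivative vanish on both sides of the support.\<close>

lemma antiderivative_test_function:
  assumes f: "continuous_on UNIV f" and cd: "a < c" "c < d" "d < b" "\<And>x. x \<notin> {c..d} \<Longrightarrow> f x = 0"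
    and z: "integral {c..d} f = 0"
  obtains \<phi> where "\<phi> \<in> test_functions {a<..<b}" "deriv \<phi> = f"
proof -
  define \<phi> where "\<phi> x = integral {a..x} f" for x
  have i: "(f has_integral 0) {c..d}"
    using z integrable_integral[OF integrable_continuous_real[OF continuous_on_subset[OF f]], of c d] by auto
  have \<phi>0: "\<phi> x = 0" if "x \<notin> {c..d}" for x
  proof (cases "x < c")
    case True
    then show ?thesis unfolding \<phi>_def using cd(4) by (intro integral_unique has_integral_is_0) auto
  next
    case False
    then show ?thesis unfolding \<phi>_def using that cd
      by (intro integral_unique has_integral_on_superset[OF i]) auto
  qed
  have D: "(\<phi> has_real_derivative f x) (at x)" for x
  proof (cases "x \<in> {c..d}")
    case True
    then have x: "x \<in> {a<..<b}" using cd by auto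
    have "(\<phi> has_real_derivative f x) (at x within {a..b})"
      unfolding \<phi>_def using x by (intro integral_has_real_derivative continuous_on_subset[OF f]) auto
    moreover have "at x within {a..b} = at x" using x by (intro at_within_interior) auto
    ultimately show ?thesis by simp
  next
    case False
    have "((\<lambda>x. 0) has_real_derivative 0) (at x)" by simp
    then have "(\<phi> has_real_derivative 0) (at x)"
      by (rule has_field_derivative_transform_within_open[where S = "- {c..d}"]) (use \<phi>0 False in auto)
    then show ?thesis using False cd by auto
  qed
  have "\<phi> \<in> test_functions {a<..<b}"
    by (rule test_functionsI[OF cd(1,3) \<phi>0 D f])
  moreover have "deriv \<phi> = f" using DERIV_imp_deriv[OF D] by auto
  ultimately show ?thesis using that by blast
qed

text \<open>Fix a test function \<open>\<eta>\<close> with integral \<open>k \<noteq> 0\<close>.  Any test function \<open>\<psi>\<close> minus a suitable multiple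
  of \<open>\<eta>\<close> has integral \<open>0\<close>, hence is the derivative of a test function and is orthogonal to \<open>w\<close>.
  This says that \<open>w\<close> minus the constant \<open>(\<integral> w \<eta>) / k\<close> is orthogonal to \<open>\<psi>\<close>.\<close>

lemma weak_deriv_zero_imp_const:
  assumes "a < b" and w: "has_weak_deriv {a<..<b} w (\<lambda>_. 0)"
  shows "\<exists>c. AE x in lebesgue_on {a<..<b}. w x = c"
proof -
  let ?M = "lebesgue_on {a<..<b}"
  have lw: "locally_integrable {a<..<b} w" using w by (simp add: has_weak_deriv_def)
  define s where "s = a + (b - a)/4"
  define t where "t = b - (b - a)/4"
  have st: "a < s" "s < t" "t < b" using \<open>a < b\<close> by (auto simp: s_def t_def field_simps)
  define \<eta> where "\<eta> x = 1 - exp (- 1 * bump s t x)" for x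
  have \<eta>: "\<eta> \<in> test_functions {a<..<b}"
    unfolding \<eta>_def by (rule bump_cutoff_test_function) (use st in auto)
  have l1: "locally_integrable {a<..<b} (\<lambda>_. 1)"
    by (intro locally_integrable_continuous continuous_intros)
  have i1: "integrable ?M \<phi>" if "\<phi> \<in> test_functions {a<..<b}" for \<phi>
    using integrable_test_function(1)[OF that l1 \<open>a < b\<close>] by simp
  define k where "k = (LINT x|?M. \<eta> x)"
  have "k \<noteq> 0"
  proof
    assume "k = 0"
    moreover have "0 \<le> \<eta> x" for x using bump_nonneg by (auto simp: \<eta>_def)
    ultimately have "AE x in ?M. \<eta> x = 0"
      using integral_nonneg_eq_0_iff_AE[OF i1[OF \<eta>]] by (auto simp: k_def)
    then have "AE x in lebesgue. x \<in> {a<..<b} \<longrightarrow> \<eta> x = 0" by (simp add: AE_restrict_space_iff)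
    then have "AE x in lebesgue. x \<notin> {s<..<t}"
    proof eventually_elim
      case (elim x)
      show ?case
      proof
        assume x: "x \<in> {s<..<t}"
        then have "0 < bump s t x" by (auto intro: bump_pos)
        then show False using elim x st by (auto simp: \<eta>_def)
      qed
    qed
    then have "negligible {s<..<t}" by (subst negligible_iff_null_sets, subst AE_iff_null_sets) auto
    then show False using open_not_negligible[of "{s<..<t}"] st by auto
  qed
  define C where "C = (LINT x|?M. w x * \<eta> x) / k"
  have "AE x in ?M. w x - C = 0"
  proof (rule AE_zero_if_orthogonal_to_test_functions[OF \<open>a < b\<close>])
    have lC: "locally_integrable {a<..<b} (\<lambda>_. C)" by (intro locally_integrable_continuous continuous_intros)
    show "locally_integrable {a<..<b} (\<lambda>x. w x - C)"
      by (intro locally_integrable_diff lw lC)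
    fix \<psi> assume \<psi>: "\<psi> \<in> test_functions {a<..<b}"
    define \<kappa> where "\<kappa> = (LINT x|?M. \<psi> x) / k"
    define f where "f x = \<psi> x - \<kappa> * \<eta> x" for x
    obtain c1 d1 where 1: "a < c1" "c1 < d1" "d1 < b" "\<And>x. x \<notin> {c1..d1} \<Longrightarrow> \<psi> x = 0"
      using test_functions_support[OF \<psi> \<open>a < b\<close>] by metis
    obtain c2 d2 where 2: "a < c2" "c2 < d2" "d2 < b" "\<And>x. x \<notin> {c2..d2} \<Longrightarrow> \<eta> x = 0"
      using test_functions_support[OF \<eta> \<open>a < b\<close>] by metis
    define c where "c = min c1 c2"
    define d where "d = max d1 d2"
    have cd: "a < c" "c < d" "d < b" using 1 2 by (auto simp: c_def d_def)
    have f0: "f x = 0" if "x \<notin> {c..d}" for x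
    proof -
      have "x \<notin> {c1..d1}" "x \<notin> {c2..d2}" using that by (auto simp: c_def d_def)
      then show ?thesis using 1(4) 2(4) by (simp add: f_def)
    qed
    have cf: "continuous_on A f" for A
      unfolding f_def using test_functions_continuous[OF \<psi>] test_functions_continuous[OF \<eta>] by (intro continuous_intros)
    have "(LINT x|?M. f x) = (LINT x|?M. \<psi> x) - \<kappa> * k"
      unfolding f_def k_def using i1[OF \<psi>] i1[OF \<eta>] by simp
    then have "(LINT x|?M. f x) = 0" using \<open>k \<noteq> 0\<close> by (simp add: \<kappa>_def)
    moreover have "(LINT x|?M. f x) = (LINT x|lebesgue_on {c..d}. f x)"
      using cd f0 by (intro integral_lebesgue_on_zero_outside) auto
    moreover have "\<dots> = integral {c..d} f"
      by (intro lebesgue_integral_eq_integral integrable_continuous_compact cf) auto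
    ultimately have "integral {c..d} f = 0" by simp
    then obtain \<phi> where "\<phi> \<in> test_functions {a<..<b}" "deriv \<phi> = f"
      using antiderivative_test_function[OF cf cd f0] by metis
    then have "(LINT x|?M. w x * f x) = 0" using w by (auto simp: has_weak_deriv_def)
    moreover have "(LINT x|?M. w x * f x) = (LINT x|?M. w x * \<psi> x - \<kappa> * (w x * \<eta> x))"
      by (simp add: f_def algebra_simps)
    moreover have "\<dots> = (LINT x|?M. w x * \<psi> x) - \<kappa> * (LINT x|?M. w x * \<eta> x)"
      using integrable_test_function(1)[OF \<psi> lw \<open>a < b\<close>] integrable_test_function(1)[OF \<eta> lw \<open>a < b\<close>] by simp
    moreover have "(LINT x|?M. (w x - C) * \<psi> x) = (LINT x|?M. w x * \<psi> x) - C * (LINT x|?M. \<psi> x)"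
      using integrable_test_function(1)[OF \<psi> lw \<open>a < b\<close>] i1[OF \<psi>] by (simp add: left_diff_distrib)
    ultimately show "(LINT x|?M. (w x - C) * \<psi> x) = 0"
      by (simp add: C_def \<kappa>_def field_simps)
  qed
  then show ?thesis by (intro exI[of _ C]) simp
qed

lemma has_weak_deriv_unique:
  assumes "a < b" "has_weak_deriv {a<..<b} u v" "has_weak_deriv {a<..<b} u v'"
  shows "AE x in lebesgue_on {a<..<b}. v x = v' x"
proof -
  let ?M = "lebesgue_on {a<..<b}"
  have l: "locally_integrable {a<..<b} v" "locally_integrable {a<..<b} v'"
    using assms by (auto simp: has_weak_deriv_def)
  have "AE x in ?M. v x - v' x = 0"
  proof (rule AE_zero_if_orthogonal_to_test_functions[OF \<open>a < b\<close>])
    fix \<phi> assume \<phi>: "\<phi> \<in> test_functions {a<..<b}"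
    have "(LINT x|?M. (v x - v' x) * \<phi> x) = (LINT x|?M. v x * \<phi> x) - (LINT x|?M. v' x * \<phi> x)"
      using integrable_test_function(1)[OF \<phi> l(1) \<open>a < b\<close>] integrable_test_function(1)[OF \<phi> l(2) \<open>a < b\<close>]
      by (simp add: left_diff_distrib)
    then show "(LINT x|?M. (v x - v' x) * \<phi> x) = 0"
      using assms(2,3) \<phi> by (auto simp: has_weak_deriv_def)
  qed (intro locally_integrable_diff l)
  then show ?thesis by eventually_elim simp
qed

lemma weak_deriv_AE_eq:
  assumes "a < b" "has_weak_deriv {a<..<b} u v"
  shows "AE x in lebesgue_on {a<..<b}. weak_deriv {a<..<b} u x = v x"
    "has_weak_deriv {a<..<b} u (weak_deriv {a<..<b} u)"
proof -
  show *: "has_weak_deriv {a<..<b} u (weak_deriv {a<..<b} u)"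
    unfolding weak_deriv_def by (rule someI[where P = "has_weak_deriv {a<..<b} u", OF assms(2)])
  show "AE x in lebesgue_on {a<..<b}. weak_deriv {a<..<b} u x = v x"
    by (rule has_weak_deriv_unique[OF assms(1) * assms(2)])
qed

lemma continuous_AE_zero_imp_zero:
  fixes f :: "real \<Rightarrow> real"
  assumes "AE x in lebesgue_on S. f x = 0" "open S" "continuous_on S f" "x \<in> S"
  shows "f x = 0"
proof (rule ccontr)
  assume "f x \<noteq> 0"
  let ?U = "S \<inter> f -` (- {0})"
  have "open ?U" using assms by (intro continuous_open_preimage) auto
  moreover have "?U \<noteq> {}" using \<open>f x \<noteq> 0\<close> assms by auto
  ultimately have "\<not> negligible ?U" by (rule open_not_negligible)
  moreover have "AE x in lebesgue. x \<notin> ?U"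
    using assms(1,2) by (auto simp: AE_restrict_space_iff elim!: eventually_mono)
  moreover have "?U \<in> sets lebesgue" using \<open>open ?U\<close> by simp
  ultimately show False by (simp only: negligible_iff_null_sets AE_iff_null_sets) auto
qed

lemma same_weak_deriv_differ_by_const:
  assumes "a < b" "has_weak_deriv {a<..<b} u v" "has_weak_deriv {a<..<b} u' v"
    and c: "continuous_on {a<..<b} u" "continuous_on {a<..<b} u'"
  obtains k where "\<And>x. x \<in> {a<..<b} \<Longrightarrow> u x = u' x + k"
proof -
  have "has_weak_deriv {a<..<b} (\<lambda>x. u x - u' x) (\<lambda>_. 0)"
    using has_weak_deriv_diff[OF assms(2,3,1)] by simp
  then obtain k where "AE x in lebesgue_on {a<..<b}. u x - u' x = k"
    using weak_deriv_zero_imp_const[OF \<open>a < b\<close>] by blast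
  then have k: "AE x in lebesgue_on {a<..<b}. u x - u' x - k = 0"
    by eventually_elim simp
  have "u x - u' x - k = 0" if "x \<in> {a<..<b}" for x
    by (rule continuous_AE_zero_imp_zero[OF k _ _ that]) (auto intro!: continuous_intros c)
  then show ?thesis using that[of k] by (simp add: algebra_simps)
qed

lemma continuous_weak_deriv_imp_C1:
  assumes "a < b" "has_weak_deriv {a<..<b} u v" "continuous_on {a<..<b} u" "continuous_on {a<..<b} v"
    "integrable (lebesgue_on {a<..<b}) v" "x \<in> {a<..<b}"
  shows "(u has_real_derivative v x) (at x)"
proof -
  define P where "P x = integral {a..x} v" for x
  have vi: "v integrable_on {a..b}"
    using has_integral_integral_lebesgue_on[OF assms(5)] integrable_on_Icc_iff_Ioo by auto
  have P: "has_weak_deriv {a<..<b} P v"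
    unfolding P_def by (rule has_weak_deriv_indefinite[OF assms(5,1)])
  have cP: "continuous_on {a<..<b} P"
    unfolding P_def by (rule continuous_on_subset[OF indefinite_integral_continuous_1[OF vi]]) auto
  obtain k where k: "\<And>x. x \<in> {a<..<b} \<Longrightarrow> u x = P x + k"
    using same_weak_deriv_differ_by_const[OF assms(1,2) P assms(3) cP] by metis
  have "isCont v x" using assms(4,6) by (simp add: continuous_on_eq_continuous_at)
  then have "(P has_vector_derivative v x) (at x within ({a..b} - {}))"
    unfolding P_def using assms(6)
    by (intro integral_has_vector_derivative_continuous_at[OF vi]) (auto intro: continuous_at_imp_continuous_at_within)
  moreover have "at x within {a..b} = at x" using assms(6) by (intro at_within_interior) auto
  ultimately have "(P has_real_derivative v x) (at x)" by (simp add: has_real_derivative_iff_has_vector_derivative)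
  then have "((\<lambda>x. P x + k) has_real_derivative v x) (at x)" by (auto intro!: derivative_eq_intros)
  then show ?thesis
    by (rule has_field_derivative_transform_within_open[where S = "{a<..<b}"]) (use k assms(6) in auto)
qed

text \<open>The function \<open>v\<close> and the indefinite integral of \<open>v2\<close> have the same weak derivative, so \<open>v\<close> has a continuous
  representative; it is then the classical derivative of \<open>u\<close>.\<close>

lemma second_weak_deriv_imp_C1:
  assumes "a < b" "has_weak_deriv {a<..<b} u v" "has_weak_deriv {a<..<b} v v2"
    "integrable (lebesgue_on {a<..<b}) v" "integrable (lebesgue_on {a<..<b}) v2" "continuous_on {a<..<b} u"
  obtains D where "continuous_on {a<..<b} D" "\<And>x. x \<in> {a<..<b} \<Longrightarrow> (u has_real_derivative D x) (at x)"
proof -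
  let ?M = "lebesgue_on {a<..<b}"
  define V where "V x = integral {a..x} v2" for x
  have v2i: "v2 integrable_on {a..b}"
    using has_integral_integral_lebesgue_on[OF assms(5)] integrable_on_Icc_iff_Ioo by auto
  have V: "has_weak_deriv {a<..<b} V v2"
    unfolding V_def by (rule has_weak_deriv_indefinite[OF assms(5,1)])
  have cV: "continuous_on {a<..<b} V"
    unfolding V_def by (rule continuous_on_subset[OF indefinite_integral_continuous_1[OF v2i]]) auto
  have "has_weak_deriv {a<..<b} (\<lambda>x. v x - V x) (\<lambda>_. 0)"
    using has_weak_deriv_diff[OF assms(3) V assms(1)] by simp
  then obtain k where k: "AE x in ?M. v x - V x = k"
    using weak_deriv_zero_imp_const[OF \<open>a < b\<close>] by blast
  define D where "D x = V x + k" for x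
  have cD: "continuous_on {a<..<b} D" unfolding D_def by (intro continuous_intros cV)
  have ae: "AE x in ?M. v x = D x" using k by eventually_elim (simp add: D_def)
  have "has_weak_deriv {a<..<b} u D"
    by (rule has_weak_deriv_cong_AE[OF assms(2,1) _ ae]) auto
  moreover have "integrable ?M D"
    using integrable_lebesgue_on_cong_AE[OF assms(4) _ ae] by auto
  ultimately have "(u has_real_derivative D x) (at x)" if "x \<in> {a<..<b}" for x
    using continuous_weak_deriv_imp_C1[OF assms(1) _ assms(6) cD] that by blast
  with cD that show ?thesis by blast
qed

section \<open>Lebesgue spaces\<close>

text \<open>Arguments about \<open>L\<^sup>p\<close> split into the cases of the supremum norm and a real exponent.\<close>

lemma exponent_cases:
  fixes p :: ennreal
  assumes "1 \<le> p"
  obtains "p = \<infinity>" | r where "1 \<le> r" "p = ennreal r" "enn2real p = r" "enn2real (1 / p) = 1 / r" "p \<noteq> \<infinity>"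
proof (cases p rule: ennreal_cases)
  case (real r)
  then have "1 \<le> r" using assms by (simp add: ennreal_le_iff flip: ennreal_1)
  moreover have "1 / p = ennreal (1 / r)"
    using real \<open>1 \<le> r\<close> divide_ennreal[of 1 r] by simp
  ultimately show ?thesis using real that(2)[of r] by simp
qed (use that in auto)

lemma Lp_space_measurable: "f \<in> Lp_space p S \<Longrightarrow> f \<in> borel_measurable (lebesgue_on S)"
  by (simp add: Lp_space_def)

lemma Lp_norm_nonneg: "0 \<le> Lp_norm p S f"
  by (simp add: Lp_norm_def)

lemma Lp_infinityI:
  assumes "f \<in> borel_measurable (lebesgue_on S)" "AE x in lebesgue_on S. \<bar>f x\<bar> \<le> B" "0 \<le> B"
  shows "f \<in> Lp_space \<infinity> S" "Lp_norm \<infinity> S f \<le> B"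
proof -
  have "esssup (lebesgue_on S) (\<lambda>x. ennreal \<bar>f x\<bar>) \<le> ennreal B"
    using assms by (intro esssup_I) (auto intro!: ennreal_leI)
  then show "f \<in> Lp_space \<infinity> S" "Lp_norm \<infinity> S f \<le> B"
    using assms by (auto simp: Lp_space_def Lp_norm_def enn2real_leI intro: le_less_trans)
qed

lemma Lp_infinity_AE:
  assumes "f \<in> Lp_space \<infinity> S"
  shows "AE x in lebesgue_on S. \<bar>f x\<bar> \<le> Lp_norm \<infinity> S f"
proof -
  let ?e = "esssup (lebesgue_on S) (\<lambda>x. ennreal \<bar>f x\<bar>)"
  have "?e < \<infinity>" using assms by (simp add: Lp_space_def)
  then have e: "ennreal (Lp_norm \<infinity> S f) = ?e" by (simp add: Lp_norm_def)
  show ?thesis using esssup_AE[of "\<lambda>x. ennreal \<bar>f x\<bar>" "lebesgue_on S"]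
    unfolding e[symmetric] by eventually_elim (simp add: ennreal_le_iff Lp_norm_nonneg)
qed

lemma Lp_space_finite:
  assumes "1 \<le> r"
  shows "f \<in> Lp_space (ennreal r) S \<longleftrightarrow> f \<in> borel_measurable (lebesgue_on S) \<and> integrable (lebesgue_on S) (\<lambda>x. \<bar>f x\<bar> powr r)"
    "Lp_norm (ennreal r) S f = (LINT x|lebesgue_on S. \<bar>f x\<bar> powr r) powr (1 / r)"
proof -
  have "1 / ennreal r = ennreal (1 / r)" using assms divide_ennreal[of 1 r] by simp
  then show "f \<in> Lp_space (ennreal r) S \<longleftrightarrow> f \<in> borel_measurable (lebesgue_on S) \<and> integrable (lebesgue_on S) (\<lambda>x. \<bar>f x\<bar> powr r)"
    "Lp_norm (ennreal r) S f = (LINT x|lebesgue_on S. \<bar>f x\<bar> powr r) powr (1 / r)"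
    using assms by (auto simp: Lp_space_def Lp_norm_def)
qed

lemma Lp_finiteI:
  assumes "1 \<le> r" "f \<in> borel_measurable (lebesgue_on S)" "integrable (lebesgue_on S) g"
    "AE x in lebesgue_on S. \<bar>f x\<bar> powr r \<le> g x" "(LINT x|lebesgue_on S. g x) \<le> B powr r" "0 \<le> B"
  shows "f \<in> Lp_space (ennreal r) S" "Lp_norm (ennreal r) S f \<le> B"
proof -
  let ?M = "lebesgue_on S"
  have i: "integrable ?M (\<lambda>x. \<bar>f x\<bar> powr r)"
  proof (rule Bochner_Integration.integrable_bound[OF assms(3)])
    show "(\<lambda>x. \<bar>f x\<bar> powr r) \<in> borel_measurable ?M" using assms(2) by measurable
    show "AE x in ?M. norm (\<bar>f x\<bar> powr r) \<le> norm (g x)"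
      using assms(4) by eventually_elim auto
  qed
  then show "f \<in> Lp_space (ennreal r) S" using assms by (simp add: Lp_space_finite)
  have "(LINT x|?M. \<bar>f x\<bar> powr r) \<le> (LINT x|?M. g x)"
    using i assms by (intro integral_mono_AE)
  then have "(LINT x|?M. \<bar>f x\<bar> powr r) \<le> B powr r" using assms by linarith
  then have "(LINT x|?M. \<bar>f x\<bar> powr r) powr (1/r) \<le> (B powr r) powr (1/r)"
    using assms by (intro powr_mono2) auto
  then show "Lp_norm (ennreal r) S f \<le> B" using assms by (simp add: Lp_space_finite powr_powr)
qed

lemma Lp_norm_powr:
  assumes "1 \<le> r"
  shows "Lp_norm (ennreal r) S f powr r = (LINT x|lebesgue_on S. \<bar>f x\<bar> powr r)"
  using assms by (simp add: Lp_space_finite powr_powr)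

lemma Lp_dominated:
  assumes p: "1 \<le> p" and f: "f \<in> Lp_space p S" and g: "g \<in> borel_measurable (lebesgue_on S)"
    and le: "AE x in lebesgue_on S. \<bar>g x\<bar> \<le> c * \<bar>f x\<bar>" and c: "0 \<le> c"
  shows "g \<in> Lp_space p S" "Lp_norm p S g \<le> c * Lp_norm p S f"
proof -
  let ?M = "lebesgue_on S"
  have "g \<in> Lp_space p S \<and> Lp_norm p S g \<le> c * Lp_norm p S f"
  proof (cases rule: exponent_cases[OF p])
    case 1
    have "AE x in ?M. \<bar>g x\<bar> \<le> c * Lp_norm p S f"
      using le Lp_infinity_AE[OF f[unfolded 1]] unfolding 1
      by eventually_elim (meson c mult_left_mono order_trans)
    then show ?thesis using Lp_infinityI[OF g, of "c * Lp_norm p S f"] c 1 Lp_norm_nonneg by auto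
  next
    case (2 r)
    have i: "integrable ?M (\<lambda>x. c powr r * \<bar>f x\<bar> powr r)"
      using f 2 by (simp add: Lp_space_finite)
    have "AE x in ?M. \<bar>g x\<bar> powr r \<le> c powr r * \<bar>f x\<bar> powr r"
      using le
    proof eventually_elim
      case (elim x)
      have "\<bar>g x\<bar> powr r \<le> (c * \<bar>f x\<bar>) powr r" using elim 2 by (intro powr_mono2) auto
      then show ?case using c by (simp add: powr_mult)
    qed
    moreover have "(LINT x|?M. c powr r * \<bar>f x\<bar> powr r) \<le> (c * Lp_norm p S f) powr r"
      using 2 c Lp_norm_powr[of r S f] Lp_norm_nonneg by (simp add: powr_mult)
    ultimately show ?thesis
      using Lp_finiteI[OF 2(1) g i, of "c * Lp_norm p S f"] 2 c Lp_norm_nonneg by auto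
  qed
  then show "g \<in> Lp_space p S" "Lp_norm p S g \<le> c * Lp_norm p S f" by auto
qed

text \<open>The crude constant \<open>2\<close>, which replaces Minkowski's inequality, comes from
  \<open>\<bar>f + g\<bar> \<le> 2 max \<bar>f\<bar> \<bar>g\<bar>\<close> and suffices because only the existence of constants matters.\<close>

lemma Lp_add:
  assumes p: "1 \<le> p" and f: "f \<in> Lp_space p S" and g: "g \<in> Lp_space p S"
  shows "(\<lambda>x. f x + g x) \<in> Lp_space p S" "Lp_norm p S (\<lambda>x. f x + g x) \<le> 2 * (Lp_norm p S f + Lp_norm p S g)"
proof -
  let ?M = "lebesgue_on S"
  have [measurable]: "f \<in> borel_measurable ?M" "g \<in> borel_measurable ?M"
    using f g Lp_space_measurable by auto
  have "(\<lambda>x. f x + g x) \<in> Lp_space p S \<and> Lp_norm p S (\<lambda>x. f x + g x) \<le> 2 * (Lp_norm p S f + Lp_norm p S g)"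
  proof (cases rule: exponent_cases[OF p])
    case 1
    have "AE x in ?M. \<bar>f x + g x\<bar> \<le> 2 * (Lp_norm p S f + Lp_norm p S g)"
      using Lp_infinity_AE[OF f[unfolded 1]] Lp_infinity_AE[OF g[unfolded 1]] unfolding 1
    proof eventually_elim
      case (elim x)
      then show ?case using Lp_norm_nonneg[of \<infinity> S f] Lp_norm_nonneg[of \<infinity> S g] abs_triangle_ineq[of "f x" "g x"]
        by (simp add: algebra_simps)
    qed
    then show ?thesis using Lp_infinityI[of "\<lambda>x. f x + g x" S "2 * (Lp_norm p S f + Lp_norm p S g)"] 1
        Lp_norm_nonneg[of p S f] Lp_norm_nonneg[of p S g] by auto
  next
    case (2 r)
    let ?A = "Lp_norm p S f" and ?B = "Lp_norm p S g"
    have n: "0 \<le> ?A" "0 \<le> ?B" by (rule Lp_norm_nonneg)+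
    have if': "integrable ?M (\<lambda>x. \<bar>f x\<bar> powr r)" and ig: "integrable ?M (\<lambda>x. \<bar>g x\<bar> powr r)"
      using f g 2 by (simp_all add: Lp_space_finite)
    have i: "integrable ?M (\<lambda>x. 2 powr r * (\<bar>f x\<bar> powr r + \<bar>g x\<bar> powr r))"
      using if' ig by simp
    have ae: "AE x in ?M. \<bar>f x + g x\<bar> powr r \<le> 2 powr r * (\<bar>f x\<bar> powr r + \<bar>g x\<bar> powr r)"
    proof (rule AE_I2)
      fix x
      have "\<bar>f x + g x\<bar> powr r \<le> (2 * max \<bar>f x\<bar> \<bar>g x\<bar>) powr r" using 2 by (intro powr_mono2) auto
      also have "\<dots> = 2 powr r * (max \<bar>f x\<bar> \<bar>g x\<bar>) powr r" by (simp add: powr_mult)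
      also have "(max \<bar>f x\<bar> \<bar>g x\<bar>) powr r \<le> \<bar>f x\<bar> powr r + \<bar>g x\<bar> powr r"
        by (simp add: max_def)
      finally show "\<bar>f x + g x\<bar> powr r \<le> 2 powr r * (\<bar>f x\<bar> powr r + \<bar>g x\<bar> powr r)" by simp
    qed
    have eq: "(LINT x|?M. 2 powr r * (\<bar>f x\<bar> powr r + \<bar>g x\<bar> powr r)) = 2 powr r * (?A powr r + ?B powr r)"
      using if' ig 2 by (simp add: Lp_norm_powr)
    have "?A powr r + ?B powr r \<le> (?A + ?B) powr r"
    proof (cases "?A + ?B = 0")
      case True
      then have "?A = 0" "?B = 0" using n by linarith+
      then show ?thesis by simp
    next
      case False
      then have s: "0 < ?A + ?B" using n by linarith
      have *: "a powr r \<le> a * (?A + ?B) powr (r - 1)" if "0 \<le> a" "a \<le> ?A + ?B" for a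
      proof (cases "a = 0")
        case False
        then have "a powr r = a * a powr (r - 1)" using that by (simp add: powr_diff)
        then show ?thesis using that 2 by (auto intro!: mult_left_mono powr_mono2)
      qed simp
      have "?A powr r + ?B powr r \<le> (?A + ?B) * (?A + ?B) powr (r - 1)"
        using *[of ?A] *[of ?B] n by (simp add: distrib_right)
      then show ?thesis using s by (simp add: powr_diff)
    qed
    then have "2 powr r * (?A powr r + ?B powr r) \<le> 2 powr r * (?A + ?B) powr r"
      by (rule mult_left_mono) simp
    also have "\<dots> = (2 * (?A + ?B)) powr r"
      using n by (subst powr_mult) auto
    finally have "(LINT x|?M. 2 powr r * (\<bar>f x\<bar> powr r + \<bar>g x\<bar> powr r)) \<le> (2 * (?A + ?B)) powr r"
      unfolding eq .
    then show ?thesis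
      using Lp_finiteI[OF 2(1) _ i ae, of "2 * (?A + ?B)"] 2 n by auto
  qed
  then show "(\<lambda>x. f x + g x) \<in> Lp_space p S" "Lp_norm p S (\<lambda>x. f x + g x) \<le> 2 * (Lp_norm p S f + Lp_norm p S g)"
    by auto
qed

lemma Lp_diff:
  assumes p: "1 \<le> p" and f: "f \<in> Lp_space p S" and g: "g \<in> Lp_space p S"
  shows "(\<lambda>x. f x - g x) \<in> Lp_space p S" "Lp_norm p S (\<lambda>x. f x - g x) \<le> 2 * (Lp_norm p S f + Lp_norm p S g)"
proof -
  have m: "(\<lambda>x. - g x) \<in> borel_measurable (lebesgue_on S)"
    using Lp_space_measurable[OF g] by measurable
  note g' = Lp_dominated[OF p g m, of 1]
  show "(\<lambda>x. f x - g x) \<in> Lp_space p S" "Lp_norm p S (\<lambda>x. f x - g x) \<le> 2 * (Lp_norm p S f + Lp_norm p S g)"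
    using Lp_add[OF p f, of "\<lambda>x. - g x"] g' by auto
qed

lemma Lp_cong_AE:
  assumes "1 \<le> p" "f \<in> Lp_space p S" "S \<in> sets lebesgue" "AE x in lebesgue_on S. f x = g x"
  shows "g \<in> Lp_space p S" "Lp_norm p S g \<le> Lp_norm p S f"
proof -
  let ?M = "lebesgue_on S"
  have ae: "AE x in lebesgue. (if x \<in> S then f x else 0) = (if x \<in> S then g x else 0)"
    using assms by (auto simp: AE_restrict_space_iff)
  have "(\<lambda>x. if x \<in> S then f x else 0) \<in> borel_measurable lebesgue"
    using Lp_space_measurable[OF assms(2)] assms(3) by (simp add: borel_measurable_if)
  then have "(\<lambda>x. if x \<in> S then g x else 0) \<in> borel_measurable lebesgue"
    using borel_measurable_AE[OF _ ae] by auto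
  then have m: "g \<in> borel_measurable ?M" using assms(3) by (simp add: borel_measurable_if)
  have "AE x in ?M. \<bar>g x\<bar> \<le> 1 * \<bar>f x\<bar>" using assms(4) by eventually_elim simp
  from Lp_dominated[OF assms(1,2) m this] show "g \<in> Lp_space p S" "Lp_norm p S g \<le> Lp_norm p S f"
    by auto
qed

lemma Lp_subset:
  assumes p: "1 \<le> p" and f: "f \<in> Lp_space p S" and "T \<subseteq> S" "S \<in> sets lebesgue" "T \<in> sets lebesgue"
  shows "f \<in> Lp_space p T" "Lp_norm p T f \<le> Lp_norm p S f"
proof -
  have m: "f \<in> borel_measurable (lebesgue_on T)"
    using measurable_restrict_mono[OF Lp_space_measurable[OF f] \<open>T \<subseteq> S\<close>] .
  have "f \<in> Lp_space p T \<and> Lp_norm p T f \<le> Lp_norm p S f"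
  proof (cases rule: exponent_cases[OF p])
    case 1
    have "AE x in lebesgue_on T. \<bar>f x\<bar> \<le> Lp_norm p S f"
      using AE_lebesgue_on_subset[OF Lp_infinity_AE[OF f[unfolded 1]] assms(3-5)] unfolding 1 .
    then show ?thesis using Lp_infinityI[OF m, of "Lp_norm p S f"] Lp_norm_nonneg[of p S f] 1 by simp
  next
    case (2 r)
    have i: "integrable (lebesgue_on S) (\<lambda>x. \<bar>f x\<bar> powr r)" using f 2 by (simp add: Lp_space_finite)
    have "(LINT x|lebesgue_on T. \<bar>f x\<bar> powr r) \<le> (LINT x|lebesgue_on S. \<bar>f x\<bar> powr r)"
      using assms i by (intro integral_mono_lebesgue_on_AE) auto
    moreover have "integrable (lebesgue_on T) (\<lambda>x. \<bar>f x\<bar> powr r)"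
      using i assms by (intro integrable_lebesgue_on_subset[OF i])
    ultimately show ?thesis
      using Lp_finiteI[OF 2(1) m, of "\<lambda>x. \<bar>f x\<bar> powr r" "Lp_norm p S f"] 2 Lp_norm_nonneg
      by (auto simp: Lp_norm_powr)
  qed
  then show "f \<in> Lp_space p T" "Lp_norm p T f \<le> Lp_norm p S f" by auto
qed

section \<open>Inequalities of Hoelder and Hardy\<close>

text \<open>Weighted arithmetic and geometric means of \<open>y\<^bsup>1-r\<^esup> h\<^bsup>1-r\<^esup> z\<^sup>r\<close> and \<open>y h\<close> with weights \<open>1/r\<close> and
  \<open>1 - 1/r\<close>: the powers of \<open>y\<close> and \<open>h\<close> cancel in the geometric mean.\<close>

lemma weighted_Young:
  fixes z h y r :: real
  assumes "1 \<le> r" "0 < h" "0 < y" "0 \<le> z"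
  shows "z \<le> y powr (1 - r) * (h powr (1 - r) * z powr r) / r + (1 - 1 / r) * y * h"
proof (cases "z = 0")
  case True
  then show ?thesis using assms by simp
next
  case False
  then have z: "0 < z" using assms by simp
  have "(y powr (1 - r) * (h powr (1 - r) * z powr r)) powr (1/r) * (y * h) powr (1 - 1/r)
     \<le> 1/r * (y powr (1 - r) * (h powr (1 - r) * z powr r)) + (1 - 1/r) * (y * h)"
    using assms z by (intro Youngs_inequality_0) auto
  also have "(y powr (1 - r) * (h powr (1 - r) * z powr r)) powr (1/r) * (y * h) powr (1 - 1/r)
     = (y powr ((1 - r) / r) * y powr (1 - 1/r)) * (h powr ((1 - r) / r) * h powr (1 - 1/r)) * z"
    using assms z by (simp add: powr_mult powr_powr)
  also have "\<dots> = y powr ((1 - r) / r + (1 - 1/r)) * h powr ((1 - r) / r + (1 - 1/r)) * z"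
    by (simp add: powr_add)
  also have "(1 - r) / r + (1 - 1/r) = 0" using assms by (simp add: field_simps)
  finally show ?thesis using assms by simp
qed

text \<open>Hoelder's inequality for \<open>\<bar>f\<bar> = h\<^bsup>1-1/r\<^esup> (h\<^bsup>1/r-1\<^esup> \<bar>f\<bar>)\<close>.  It holds also for \<open>r = 1\<close>, where the conjugate
  exponent is infinite.  Integrate Young's inequality with a free parameter \<open>y\<close> and choose the best \<open>y\<close>.\<close>

lemma weighted_Holder:
  fixes f h :: "'a \<Rightarrow> real"
  assumes r: "1 \<le> r" and f[measurable]: "f \<in> borel_measurable M" and h: "integrable M h" "\<And>x. x \<in> space M \<Longrightarrow> 0 < h x"
    and J: "integrable M (\<lambda>x. h x powr (1 - r) * \<bar>f x\<bar> powr r)"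
  shows "integrable M f"
    "(LINT x|M. \<bar>f x\<bar>) powr r \<le> (LINT x|M. h x) powr (r - 1) * (LINT x|M. h x powr (1 - r) * \<bar>f x\<bar> powr r)"
proof -
  have pw: "\<bar>f x\<bar> \<le> y powr (1 - r) * (h x powr (1 - r) * \<bar>f x\<bar> powr r) / r + (1 - 1 / r) * y * h x"
    if "x \<in> space M" "0 < y" for x y
    using that weighted_Young[of r "h x" y "\<bar>f x\<bar>"] r h by auto
  have i: "integrable M (\<lambda>x. y powr (1 - r) * (h x powr (1 - r) * \<bar>f x\<bar> powr r) / r + (1 - 1 / r) * y * h x)" for y
    using J h by simp
  show fi: "integrable M f"
  proof (rule Bochner_Integration.integrable_bound[OF i[of 1] f])
    show "AE x in M. norm (f x) \<le> norm (1 powr (1 - r) * (h x powr (1 - r) * \<bar>f x\<bar> powr r) / r + (1 - 1 / r) * 1 * h x)"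
      using pw[of _ 1] by (intro AE_I2) force
  qed
  define I where "I = (LINT x|M. \<bar>f x\<bar>)"
  define m where "m = (LINT x|M. h x)"
  define j where "j = (LINT x|M. h x powr (1 - r) * \<bar>f x\<bar> powr r)"
  have le: "I \<le> y powr (1 - r) * j / r + (1 - 1 / r) * y * m" if "0 < y" for y
  proof -
    have "I \<le> (LINT x|M. y powr (1 - r) * (h x powr (1 - r) * \<bar>f x\<bar> powr r) / r + (1 - 1 / r) * y * h x)"
      unfolding I_def using fi i pw that by (intro integral_mono) auto
    also have "\<dots> = y powr (1 - r) * j / r + (1 - 1 / r) * y * m"
      using J h unfolding j_def m_def by simp
    finally show ?thesis .
  qed
  have m0: "0 \<le> m" unfolding m_def using h by (intro integral_nonneg_AE AE_I2) (auto intro: less_imp_le)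
  have j0: "0 \<le> j" unfolding j_def by simp
  have I0: "0 \<le> I" unfolding I_def by simp
  have "I powr r \<le> m powr (r - 1) * j"
  proof (cases "m = 0 \<or> j = 0")
    case True
    have "AE x in M. f x = 0"
    proof (cases "m = 0")
      case True
      have "AE x in M. 0 \<le> h x" using h by (intro AE_I2) (auto intro: less_imp_le)
      then have "AE x in M. h x = 0"
        using True integral_nonneg_eq_0_iff_AE[OF h(1)] by (auto simp: m_def)
      then have "AE x in M. False" using AE_space by eventually_elim (use h(2) in force)
      then show ?thesis by eventually_elim simp
    next
      case False
      then have "AE x in M. h x powr (1 - r) * \<bar>f x\<bar> powr r = 0"
        using \<open>m = 0 \<or> j = 0\<close> integral_nonneg_eq_0_iff_AE[OF J] by (auto simp: j_def)
      then show ?thesis using AE_space by eventually_elim (use h(2) in force)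
    qed
    then have "AE x in M. \<bar>f x\<bar> = 0" by eventually_elim simp
    then have "I = 0" unfolding I_def by (rule integral_eq_zero_AE)
    then show ?thesis using j0 by simp
  next
    case False
    then have m: "0 < m" and j: "0 < j" using m0 j0 by auto
    \<comment> \<open>With this \<open>y\<close> the two terms of the bound are in the proportion \<open>1/r : 1 - 1/r\<close> and add up to \<open>y m\<close>.\<close>
    define y where "y = (j / m) powr (1 / r)"
    have y: "0 < y" using m j by (simp add: y_def)
    have yr: "y powr r = j / m" using m j r by (simp add: y_def powr_powr)
    have "y powr (1 - r) * j = y powr (1 - r) * (y powr r * m)" using yr m by simp
    also have "\<dots> = y powr (1 - r + r) * m" by (simp only: powr_add mult.assoc)
    finally have "y powr (1 - r) * j = y * m" using y by simp
    then have "I \<le> y * m / r + (1 - 1 / r) * y * m" using le[OF y] by simp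
    also have "\<dots> = y * m" using r by (simp add: field_simps)
    finally have "I powr r \<le> (y * m) powr r" using I0 r by (intro powr_mono2) auto
    also have "\<dots> = j / m * m powr r" using y m yr by (simp add: powr_mult)
    also have "\<dots> = m powr (r - 1) * j" using m by (simp add: powr_diff)
    finally show ?thesis .
  qed
  then show "(LINT x|M. \<bar>f x\<bar>) powr r \<le> (LINT x|M. h x) powr (r - 1) * (LINT x|M. h x powr (1 - r) * \<bar>f x\<bar> powr r)"
    by (simp add: I_def m_def j_def)
qed

lemma Lp_Holder_interval:
  assumes p: "1 \<le> p" and f: "f \<in> Lp_space p {s<..<t}" and t: "s < t"
  shows "integrable (lebesgue_on {s<..<t}) f"
    "(LINT x|lebesgue_on {s<..<t}. \<bar>f x\<bar>) \<le> (t - s) powr (1 - enn2real (1 / p)) * Lp_norm p {s<..<t} f"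
proof -
  let ?M = "lebesgue_on {s<..<t}"
  have fm: "f \<in> borel_measurable ?M" using f by (rule Lp_space_measurable)
  have c: "integrable ?M (\<lambda>_. c)" "(LINT x|?M. c) = (t - s) * c" for c :: real
  proof -
    interpret finite_measure ?M by (rule finite_measure_lebesgue_on) auto
    show "integrable ?M (\<lambda>_. c)" by simp
    show "(LINT x|?M. c) = (t - s) * c" using t by (simp add: measure_restrict_space)
  qed
  have "integrable ?M f \<and> (LINT x|?M. \<bar>f x\<bar>) \<le> (t - s) powr (1 - enn2real (1 / p)) * Lp_norm p {s<..<t} f"
  proof (cases rule: exponent_cases[OF p])
    case 1
    let ?N = "Lp_norm p {s<..<t} f"
    have ae: "AE x in ?M. \<bar>f x\<bar> \<le> ?N" using Lp_infinity_AE f 1 by auto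
    have fi: "integrable ?M f"
      by (rule Bochner_Integration.integrable_bound[OF c(1)[of ?N] fm]) (use ae in \<open>auto elim!: eventually_mono\<close>)
    then have "(LINT x|?M. \<bar>f x\<bar>) \<le> (LINT x|?M. ?N)"
      using ae c by (intro integral_mono_AE) auto
    also have "\<dots> = (t - s) * ?N" by (rule c(2))
    finally show ?thesis using fi 1 t by simp
  next
    case (2 r)
    have J: "integrable ?M (\<lambda>x. 1 powr (1 - r) * \<bar>f x\<bar> powr r)" using f 2 by (simp add: Lp_space_finite)
    note H = weighted_Holder[OF 2(1) fm c(1)[of 1] _ J]
    have "(LINT x|?M. \<bar>f x\<bar>) powr r \<le> (t - s) powr (r - 1) * (LINT x|?M. \<bar>f x\<bar> powr r)"
      using H(2) c(2)[of 1] t by simp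
    then have "((LINT x|?M. \<bar>f x\<bar>) powr r) powr (1/r) \<le> ((t - s) powr (r - 1) * (LINT x|?M. \<bar>f x\<bar> powr r)) powr (1/r)"
      using 2 by (intro powr_mono2) auto
    moreover have "(r - 1) / r = 1 - 1 / r" using 2 by (simp add: field_simps)
    ultimately have "(LINT x|?M. \<bar>f x\<bar>) \<le> (t - s) powr (1 - 1/r) * Lp_norm p {s<..<t} f"
      using 2 t by (simp add: powr_powr powr_mult Lp_space_finite)
    then show ?thesis using H(1) 2 by simp
  qed
  then show "integrable (lebesgue_on {s<..<t}) f"
    "(LINT x|lebesgue_on {s<..<t}. \<bar>f x\<bar>) \<le> (t - s) powr (1 - enn2real (1 / p)) * Lp_norm p {s<..<t} f" by auto
qed

lemma Lp_Holder:
  assumes p: "1 \<le> p" and f: "f \<in> Lp_space p {0<..<t}" and t: "0 < t"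
  shows "integrable (lebesgue_on {0<..<t}) f"
    "(LINT x|lebesgue_on {0<..<t}. \<bar>f x\<bar>) \<le> t powr (1 - enn2real (1 / p)) * Lp_norm p {0<..<t} f"
  using Lp_Holder_interval[OF p f t] by simp_all

lemma integrable_powr_from_0:
  fixes a t :: real
  assumes "-1 < a" "0 \<le> t"
  shows "integrable (lebesgue_on {0<..<t}) (\<lambda>x. x powr a)"
    "(LINT x|lebesgue_on {0<..<t}. x powr a) = t powr (a + 1) / (a + 1)"
proof -
  have h: "((\<lambda>x. x powr a) has_integral (t powr (a + 1) / (a + 1))) {0..t}"
    using assms by (rule has_integral_powr_from_0)
  then have "(\<lambda>x. x powr a) absolutely_integrable_on {0..t}"
    by (intro nonnegative_absolutely_integrable_1) auto
  then have "integrable (lebesgue_on {0..t}) (\<lambda>x. x powr a)"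
    by (simp add: integrable_restrict_space set_integrable_def)
  then show i: "integrable (lebesgue_on {0<..<t}) (\<lambda>x. x powr a)"
    by (rule integrable_lebesgue_on_subset) auto
  have "(LINT x|lebesgue_on {0<..<t}. x powr a) = integral {0<..<t} (\<lambda>x. x powr a)"
    by (rule lebesgue_integral_eq_integral[OF i]) auto
  also have "\<dots> = integral {0..t} (\<lambda>x. x powr a)" by (simp add: integral_open_interval_real)
  finally show "(LINT x|lebesgue_on {0<..<t}. x powr a) = t powr (a + 1) / (a + 1)"
    using h by (simp add: integral_unique)
qed

text \<open>The critical power \<open>x\<^bsup>-1/p\<^esup>\<close> misses \<open>L\<^sup>p\<close> by a logarithm if \<open>p\<close> is finite; for \<open>p = \<infinity>\<close> it is the constant
  function, which is bounded.\<close>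

lemma Lp_powr:
  assumes p: "1 \<le> p" and e: "e = 0 \<or> (0 < e \<and> e < enn2real (1 / p))"
  shows "(\<lambda>x. x powr - e) \<in> Lp_space p {0<..<1}"
proof -
  have m: "(\<lambda>x::real. x powr - e) \<in> borel_measurable (lebesgue_on {0<..<1})"
    by (intro continuous_imp_measurable_on_sets_lebesgue continuous_intros) auto
  show ?thesis
  proof (cases rule: exponent_cases[OF p])
    case 1
    have "AE x in lebesgue_on {0<..<1}. \<bar>x powr - e\<bar> \<le> 1"
      using e 1 by (intro AE_I2) auto
    then show ?thesis using Lp_infinityI[OF m] 1 by auto
  next
    case (2 r)
    have "e * r < 1 / r * r" if "e < 1 / r" using that 2(1) by (intro mult_strict_right_mono) auto
    then have er: "e * r < 1" using e 2 by auto
    have i: "integrable (lebesgue_on {0<..<1}) (\<lambda>x. x powr (- (e * r)))"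
      using er by (intro integrable_powr_from_0) auto
    show ?thesis unfolding 2 Lp_space_finite[OF 2(1)] using m i by (simp add: powr_powr)
  qed
qed

abbreviation mean_abs :: "(real \<Rightarrow> real) \<Rightarrow> real \<Rightarrow> real" where
  "mean_abs h \<equiv> \<lambda>x. integral {0..x} (\<lambda>t. \<bar>h t\<bar>) / x"

lemma powr_tail_integral_le:
  fixes a s t :: real
  assumes "0 < a" "0 < s" "s \<le> t"
  shows "integral {s..t} (\<lambda>x. x powr (- 1 - a)) \<le> s powr - a / a"
    "(\<lambda>x. x powr (- 1 - a)) integrable_on {s..t}"
proof -
  have "((\<lambda>x. x powr (- 1 - a)) has_integral (- (t powr - a) / a - (- (s powr - a) / a))) {s..t}"
  proof (rule fundamental_theorem_of_calculus)
    show "s \<le> t" by fact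
    fix x assume "x \<in> {s..t}"
    then have x: "0 < x" using assms by auto
    then have "((\<lambda>x. - (x powr - a) / a) has_real_derivative - (- a * x powr (- a - 1)) / a) (at x)"
      by (intro DERIV_cdivide DERIV_minus has_real_derivative_powr)
    also have "- (- a * x powr (- a - 1)) / a = x powr (- 1 - a)"
      using assms by (simp add: minus_diff_commute)
    finally show "((\<lambda>x. - (x powr - a) / a) has_vector_derivative x powr (- 1 - a)) (at x within {s..t})"
      by (simp add: has_real_derivative_iff_has_vector_derivative has_vector_derivative_at_within)
  qed
  then have *: "(\<lambda>x. x powr (- 1 - a)) integrable_on {s..t}"
    "integral {s..t} (\<lambda>x. x powr (- 1 - a)) = s powr - a / a - t powr - a / a"
    by (simp_all add: has_integral_iff)
  have "0 \<le> t powr - a / a" using assms by simp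
  with * show "integral {s..t} (\<lambda>x. x powr (- 1 - a)) \<le> s powr - a / a"
    "(\<lambda>x. x powr (- 1 - a)) integrable_on {s..t}"
    by linarith+
qed

lemma continuous_indefinite_LINT:
  fixes h :: "real \<Rightarrow> real"
  assumes "integrable (lebesgue_on {0<..<1}) h"
  shows "continuous_on {0..1} (\<lambda>x. integral {0..x} h)"
    "\<And>x. x \<in> {0..1} \<Longrightarrow> integral {0..x} h = (LINT t|lebesgue_on {0<..<x}. h t)"
    "h integrable_on {0..1}"
proof -
  show hi: "h integrable_on {0..1}"
    using has_integral_integral_lebesgue_on[OF assms] integrable_on_Icc_iff_Ioo by auto
  then show "continuous_on {0..1} (\<lambda>x. integral {0..x} h)" by (rule indefinite_integral_continuous_1)
  fix x :: real assume x: "x \<in> {0..1}"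
  have "integrable (lebesgue_on {0<..<x}) h"
    by (rule integrable_lebesgue_on_subset[OF assms]) (use x in auto)
  then show "integral {0..x} h = (LINT t|lebesgue_on {0<..<x}. h t)"
    by (simp add: lebesgue_integral_eq_integral integral_open_interval_real)
qed

lemma indefinite_integral_tendsto_zero:
  fixes h :: "real \<Rightarrow> real"
  assumes "integrable (lebesgue_on {0<..<1}) h"
  shows "((\<lambda>x. integral {0..x} h) \<longlongrightarrow> 0) (at_right 0)"
proof -
  have "((\<lambda>x. integral {0..x} h) \<longlongrightarrow> integral {0..0} h) (at 0 within {0..1})"
    using continuous_indefinite_LINT(1)[OF assms, unfolded continuous_on_def] by (rule bspec) simp
  then show ?thesis by (simp add: at_within_Icc_at_right)
qed

lemma nn_integral_truncated:
  fixes h :: "real \<Rightarrow> real"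
  assumes h: "integrable (lebesgue_on {0<..<1}) h" "\<And>x. 0 \<le> h x" and x: "x \<in> {0<..<1}"
  shows "(\<integral>\<^sup>+t. ennreal (if t < x then h t else 0) \<partial>lebesgue_on {0<..<1}) = ennreal (LINT t|lebesgue_on {0<..<x}. h t)"
proof -
  let ?M = "lebesgue_on {0<..<1}"
  have i: "integrable (lebesgue_on {0<..<x}) h"
    by (rule integrable_lebesgue_on_subset[OF h(1)]) (use x in auto)
  have "integrable (lebesgue_on {0<..<x}) (\<lambda>t. if t < x then h t else 0)"
    using i by (subst Bochner_Integration.integrable_cong[where g = h]) auto
  then have "integrable ?M (\<lambda>t. if t < x then h t else 0)"
    by (rule integrable_lebesgue_on_zero_outside) (use x in auto)
  then have "(\<integral>\<^sup>+t. ennreal (if t < x then h t else 0) \<partial>?M) = ennreal (LINT t|?M. (if t < x then h t else 0))"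
    using h by (intro nn_integral_eq_integral) auto
  also have "(LINT t|?M. (if t < x then h t else 0)) = (LINT t|lebesgue_on {0<..<x}. (if t < x then h t else 0))"
    using x by (intro integral_lebesgue_on_zero_outside) auto
  also have "\<dots> = (LINT t|lebesgue_on {0<..<x}. h t)"
    by (intro Bochner_Integration.integral_cong) auto
  finally show ?thesis .
qed

lemma nn_integral_powr_tail_le:
  assumes a: "0 < a" and s: "s \<in> {0<..<1}"
  shows "(\<integral>\<^sup>+x. ennreal (if s < x then x powr (- 1 - a) else 0) \<partial>lebesgue_on {0<..<1}) \<le> ennreal (s powr - a / a)"
proof -
  let ?M = "lebesgue_on {0<..<1}"
  have c: "continuous_on {s..1} (\<lambda>x. x powr (- 1 - a))" using s by (intro continuous_intros) auto
  have i: "integrable (lebesgue_on {s<..<1}) (\<lambda>x. x powr (- 1 - a))"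
    by (rule integrable_lebesgue_on_subset[OF integrable_continuous_compact[OF _ c]]) auto
  have "integrable (lebesgue_on {s<..<1}) (\<lambda>t. if s < t then t powr (- 1 - a) else 0)"
    using i by (subst Bochner_Integration.integrable_cong[where g = "\<lambda>t. t powr (- 1 - a)"]) auto
  then have "integrable ?M (\<lambda>t. if s < t then t powr (- 1 - a) else 0)"
    by (rule integrable_lebesgue_on_zero_outside) (use s in auto)
  then have "(\<integral>\<^sup>+x. ennreal (if s < x then x powr (- 1 - a) else 0) \<partial>?M) = ennreal (LINT t|?M. (if s < t then t powr (- 1 - a) else 0))"
    by (intro nn_integral_eq_integral) auto
  also have "(LINT t|?M. (if s < t then t powr (- 1 - a) else 0)) = (LINT t|lebesgue_on {s<..<1}. (if s < t then t powr (- 1 - a) else 0))"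
    using s by (intro integral_lebesgue_on_zero_outside) auto
  also have "\<dots> = (LINT t|lebesgue_on {s<..<1}. t powr (- 1 - a))"
    by (intro Bochner_Integration.integral_cong) auto
  also have "\<dots> = integral {s..1} (\<lambda>x. x powr (- 1 - a))"
    using i by (simp add: lebesgue_integral_eq_integral integral_open_interval_real)
  also have "ennreal \<dots> \<le> ennreal (s powr - a / a)"
    using powr_tail_integral_le(1)[OF a, of s 1] s by (intro ennreal_leI) auto
  finally show ?thesis .
qed

text \<open>Hoelder's inequality on \<open>(0, x)\<close> with the weight \<open>s\<^bsup>a-1\<^esup>\<close>, \<open>a = 1 - 1/r\<close>, bounds the \<open>r\<close>-th power of
  the average of \<open>\<bar>h\<bar>\<close> over \<open>(0, x)\<close> by a multiple of \<open>x\<^bsup>-1-a\<^esup> \<integral>\<^sub>0\<^sup>x s\<^sup>a \<bar>h s\<bar>\<^sup>r ds\<close>.  Integrating over \<open>x\<close> first,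
  \<open>\<integral>\<^sub>s\<^sup>1 x\<^bsup>-1-a\<^esup> dx \<le> s\<^bsup>-a\<^esup> / a\<close> removes the factor \<open>s\<^sup>a\<close>.\<close>

lemma Hardy_inequality_finite:
  assumes r: "1 < r" and h: "h \<in> Lp_space (ennreal r) {0<..<1}"
  shows "mean_abs h \<in> Lp_space (ennreal r) {0<..<1}"
    "Lp_norm (ennreal r) {0<..<1} (mean_abs h) \<le> r / (r - 1) * Lp_norm (ennreal r) {0<..<1} h"
proof -
  define M where "M = lebesgue_on {0<..<1::real}"
  define a where "a = 1 - 1 / r"
  have a: "0 < a" "a < 1" using r by (auto simp: a_def)
  interpret M: finite_measure M
    unfolding M_def by (rule finite_measure_lebesgue_on) auto
  interpret MM: pair_sigma_finite M M ..
  define H where "H x = \<bar>h x\<bar> powr r" for x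
  define G where "G x = integral {0..x} (\<lambda>t. \<bar>h t\<bar>)" for x
  have hr: "1 \<le> r" using r by simp
  have hm: "h \<in> borel_measurable M" and Hi: "integrable M H"
    using h hr by (auto simp: Lp_space_finite M_def H_def[abs_def])
  have p1: "1 \<le> ennreal r" using hr by (simp flip: ennreal_1)
  have h1: "integrable M h" using Lp_Holder(1)[OF p1 h] by (simp add: M_def)
  then have ah: "integrable (lebesgue_on {0<..<1}) (\<lambda>t. \<bar>h t\<bar>)" by (simp add: M_def)
  note Gc = continuous_indefinite_LINT[OF ah, folded G_def]
  have xm: "(\<lambda>x. x) \<in> M \<rightarrow>\<^sub>M borel"
    unfolding M_def by (simp add: continuous_imp_measurable_on_sets_lebesgue)
  have Gm: "G \<in> borel_measurable M"
    unfolding M_def by (intro continuous_imp_measurable_on_sets_lebesgue continuous_on_subset[OF Gc(1)]) auto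
  have pm: "(\<lambda>x. x powr c) \<in> borel_measurable M" for c :: real
    using xm by measurable
  note [measurable] = hm Gm xm pm
  have sHi: "integrable M (\<lambda>s. s powr a * H s)"
  proof (rule Bochner_Integration.integrable_bound[OF Hi])
    show "(\<lambda>s. s powr a * H s) \<in> borel_measurable M" unfolding H_def by measurable
    show "AE s in M. norm (s powr a * H s) \<le> norm (H s)"
      using a by (intro AE_I2) (auto simp: M_def H_def abs_mult mult_left_le_one_le powr_le1)
  qed
  have G0: "0 \<le> G x" for x
    unfolding G_def by (cases "(\<lambda>t. \<bar>h t\<bar>) integrable_on {0..x}") (auto intro: integral_nonneg simp: not_integrable_integral)
  have key: "(G x / x) powr r \<le> a powr (1 - r) * (x powr (- 1 - a) * (LINT s|lebesgue_on {0<..<x}. s powr a * H s))" if x: "x \<in> {0<..<1}" for x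
  proof -
    let ?N = "lebesgue_on {0<..<x}"
    have sub: "integrable ?N f" if "integrable M f" for f :: "real \<Rightarrow> real"
      by (rule integrable_lebesgue_on_subset[OF that[unfolded M_def]]) (use x in auto)
    have w: "integrable ?N (\<lambda>s. s powr (a - 1))" "(LINT s|?N. s powr (a - 1)) = x powr a / a"
      using integrable_powr_from_0[of "a - 1" x] a x by auto
    have e: "(a - 1) * (1 - r) = a" using r by (simp add: a_def field_simps)
    have J: "integrable ?N (\<lambda>s. (s powr (a - 1)) powr (1 - r) * \<bar>h s\<bar> powr r)"
      using sub[OF sHi] by (simp add: powr_powr e H_def)
    have "(LINT s|?N. \<bar>h s\<bar>) powr r \<le> (LINT s|?N. s powr (a - 1)) powr (r - 1) * (LINT s|?N. (s powr (a - 1)) powr (1 - r) * \<bar>h s\<bar> powr r)"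
      by (rule weighted_Holder(2)[OF hr _ w(1) _ J]) (use sub[OF h1] in auto)
    then have "G x powr r \<le> (x powr a / a) powr (r - 1) * (LINT s|?N. s powr a * H s)"
      using Gc(2)[of x] x w(2) by (simp add: powr_powr e H_def)
    then have "G x powr r / x powr r \<le> (x powr a / a) powr (r - 1) * (LINT s|?N. s powr a * H s) / x powr r"
      by (rule divide_right_mono) auto
    moreover have "(x powr a / a) powr (r - 1) / x powr r = a powr (1 - r) * x powr (- 1 - a)"
    proof -
      have "(x powr a / a) powr (r - 1) / x powr r = x powr (a * (r - 1) - r) * (1 / a powr (r - 1))"
      proof -
        have "(x powr a / a) powr (r - 1) = x powr (a * (r - 1)) * (1 / a powr (r - 1))"
          using a x by (simp add: powr_divide powr_powr)
        moreover have "x powr (a * (r - 1) - r) = x powr (a * (r - 1)) / x powr r"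
          by (rule powr_diff)
        ultimately show ?thesis by simp
      qed
      also have "1 / a powr (r - 1) = a powr (1 - r)" using a by (simp add: powr_diff)
      also have "a * (r - 1) - r = - 1 - a" using r by (simp add: a_def field_simps)
      finally show ?thesis by simp
    qed
    moreover have "(G x / x) powr r = G x powr r / x powr r" using G0 x by (simp add: powr_divide)
    moreover have "(x powr a / a) powr (r - 1) * L / x powr r = (x powr a / a) powr (r - 1) / x powr r * L" for L
      by simp
    ultimately show ?thesis by (simp only: mult.assoc)
  qed
  have inner: "ennreal (LINT s|lebesgue_on {0<..<x}. s powr a * H s) = (\<integral>\<^sup>+s. ennreal (if s < x then s powr a * H s else 0) \<partial>M)"
    if "x \<in> {0<..<1}" for x
    unfolding M_def using sHi that by (intro nn_integral_truncated[symmetric]) (auto simp: M_def H_def)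
  have Hm[measurable]: "H \<in> borel_measurable M" using Hi by auto
  let ?k = "\<lambda>x s. ennreal (s powr a * H s) * ennreal (if s < x then x powr (- 1 - a) else 0)"
  have fi: "(\<integral>\<^sup>+x. ennreal ((G x / x) powr r) \<partial>M) \<le> ennreal (a powr - r * (LINT s|M. H s))"
  proof -
    have "(\<integral>\<^sup>+x. ennreal ((G x / x) powr r) \<partial>M)
      \<le> (\<integral>\<^sup>+x. ennreal (a powr (1 - r)) * (\<integral>\<^sup>+s. ?k x s \<partial>M) \<partial>M)"
    proof (rule nn_integral_mono)
      fix x assume "x \<in> space M"
      then have x: "x \<in> {0<..<1}" by (simp add: M_def)
      have "ennreal ((G x / x) powr r) \<le> ennreal (a powr (1 - r) * (x powr (- 1 - a) * (LINT s|lebesgue_on {0<..<x}. s powr a * H s)))"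
        by (intro ennreal_leI key x)
      also have "\<dots> = ennreal (a powr (1 - r)) * (ennreal (x powr (- 1 - a)) * (\<integral>\<^sup>+s. ennreal (if s < x then s powr a * H s else 0) \<partial>M))"
        by (simp add: ennreal_mult' inner[OF x])
      also have "ennreal (x powr (- 1 - a)) * (\<integral>\<^sup>+s. ennreal (if s < x then s powr a * H s else 0) \<partial>M)
        = (\<integral>\<^sup>+s. ennreal (x powr (- 1 - a)) * ennreal (if s < x then s powr a * H s else 0) \<partial>M)"
        by (rule nn_integral_cmult[symmetric]) measurable
      also have "\<dots> = (\<integral>\<^sup>+s. ?k x s \<partial>M)"
        by (intro nn_integral_cong) (auto simp: mult.commute)
      finally show "ennreal ((G x / x) powr r) \<le> ennreal (a powr (1 - r)) * (\<integral>\<^sup>+s. ?k x s \<partial>M)" .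
    qed
    also have "\<dots> = ennreal (a powr (1 - r)) * (\<integral>\<^sup>+x. \<integral>\<^sup>+s. ?k x s \<partial>M \<partial>M)"
      by (rule nn_integral_cmult) measurable
    also have "(\<integral>\<^sup>+x. \<integral>\<^sup>+s. ?k x s \<partial>M \<partial>M)
      = (\<integral>\<^sup>+s. \<integral>\<^sup>+x. ?k x s \<partial>M \<partial>M)"
      by (rule MM.Fubini') measurable
    also have "\<dots> \<le> (\<integral>\<^sup>+s. ennreal (H s / a) \<partial>M)"
    proof (rule nn_integral_mono)
      fix s assume "s \<in> space M"
      then have s: "s \<in> {0<..<1}" by (simp add: M_def)
      have "(\<integral>\<^sup>+x. ?k x s \<partial>M)
        = ennreal (s powr a * H s) * (\<integral>\<^sup>+x. ennreal (if s < x then x powr (- 1 - a) else 0) \<partial>M)"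
        by (rule nn_integral_cmult) measurable
      also have "\<dots> \<le> ennreal (s powr a * H s) * ennreal (s powr - a / a)"
        using nn_integral_powr_tail_le[OF a(1) s] unfolding M_def by (rule mult_left_mono) simp
      also have "\<dots> = ennreal (s powr a * H s * (s powr - a / a))"
        by (rule ennreal_mult'[symmetric]) (simp add: H_def)
      also have "s powr a * H s * (s powr - a / a) = H s / a"
        using s by (simp add: powr_minus field_simps)
      finally show "(\<integral>\<^sup>+x. ?k x s \<partial>M) \<le> ennreal (H s / a)" .
    qed
    also have "(\<integral>\<^sup>+s. ennreal (H s / a) \<partial>M) = ennreal (LINT s|M. H s / a)"
    proof (rule nn_integral_eq_integral)
      show "integrable M (\<lambda>s. H s / a)" using Hi by simp
      show "AE s in M. 0 \<le> H s / a" using a by (simp add: H_def)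
    qed
    finally have "(\<integral>\<^sup>+x. ennreal ((G x / x) powr r) \<partial>M) \<le> ennreal (a powr (1 - r)) * ennreal (LINT s|M. H s / a)"
      by (simp add: mult_left_mono)
    also have "\<dots> = ennreal (a powr (1 - r) * (LINT s|M. H s / a))"
      by (rule ennreal_mult'[symmetric]) (use a in \<open>auto simp: H_def intro!: integral_nonneg_AE\<close>)
    also have "a powr (1 - r) * (LINT s|M. H s / a) = a powr - r * (LINT s|M. H s)"
      using a by (simp add: powr_diff powr_minus field_simps)
    finally show ?thesis .
  qed
  have Gi: "integrable M (\<lambda>x. (G x / x) powr r)"
    using fi by (intro integrableI_bounded) (auto simp: less_top[symmetric] top_unique)
  have "(LINT x|M. (G x / x) powr r) \<le> a powr - r * (LINT s|M. H s)"
    using fi nn_integral_eq_integral[OF Gi] by (simp add: H_def)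
  also have "\<dots> = (1 / a * Lp_norm (ennreal r) {0<..<1} h) powr r"
    using Lp_norm_powr[OF hr, of "{0<..<1}" h] a Lp_norm_nonneg[of "ennreal r" "{0<..<1}" h]
    by (simp add: powr_mult powr_divide powr_minus M_def H_def[abs_def] divide_inverse inverse_powr)
  finally have le: "(LINT x|M. (G x / x) powr r) \<le> (1 / a * Lp_norm (ennreal r) {0<..<1} h) powr r" .
  have ae: "AE x in M. \<bar>G x / x\<bar> powr r \<le> (G x / x) powr r"
    using G0 by (intro AE_I2) (auto simp: M_def)
  have m: "(\<lambda>x. G x / x) \<in> borel_measurable M" by measurable
  have aa: "1 / a = r / (r - 1)" using r by (simp add: a_def field_simps)
  note F = Lp_finiteI[OF hr m[unfolded M_def] Gi[unfolded M_def] ae[unfolded M_def] le[unfolded M_def aa]]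
  have nn: "0 \<le> r / (r - 1) * Lp_norm (ennreal r) {0<..<1} h"
    using r Lp_norm_nonneg[of "ennreal r" "{0<..<1}" h] by simp
  show "mean_abs h \<in> Lp_space (ennreal r) {0<..<1}"
    "Lp_norm (ennreal r) {0<..<1} (mean_abs h) \<le> r / (r - 1) * Lp_norm (ennreal r) {0<..<1} h"
    using F(1)[OF nn] F(2)[OF nn] unfolding G_def by auto
qed

lemma Hardy_inequality:
  assumes p: "1 < p"
  shows "\<exists>K>0. \<forall>h\<in>Lp_space p {0<..<1}.
    mean_abs h \<in> Lp_space p {0<..<1} \<and>
    Lp_norm p {0<..<1} (mean_abs h) \<le> K * Lp_norm p {0<..<1} h"
proof -
  have p1: "1 \<le> p" using p by simp
  show ?thesis
  proof (cases rule: exponent_cases[OF p1])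
    case 1
    show ?thesis
    proof (intro exI[of _ 1] conjI ballI)
      fix h assume h: "h \<in> Lp_space p {0<..<1}"
      let ?N = "Lp_norm p {0<..<1} h" and ?G = "mean_abs h"
      have hi: "integrable (lebesgue_on {0<..<1}) h" by (rule Lp_Holder(1)[OF p1 h]) simp
      then have ah: "integrable (lebesgue_on {0<..<1}) (\<lambda>t. \<bar>h t\<bar>)" by simp
      note Gc = continuous_indefinite_LINT[OF ah]
      have m: "?G \<in> borel_measurable (lebesgue_on {0<..<1})"
        by (intro continuous_imp_measurable_on_sets_lebesgue continuous_intros continuous_on_subset[OF Gc(1)]) auto
      have "AE x in lebesgue_on {0<..<1}. \<bar>?G x\<bar> \<le> ?N"
      proof (rule AE_I2)
        fix x assume "x \<in> space (lebesgue_on {0<..<1::real})"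
        then have x: "x \<in> {0<..<1}" by simp
        have s: "h \<in> Lp_space p {0<..<x}" "Lp_norm p {0<..<x} h \<le> ?N"
          using x by (auto intro!: Lp_subset[OF p1 h])
        have "(LINT t|lebesgue_on {0<..<x}. \<bar>h t\<bar>) \<le> x * Lp_norm p {0<..<x} h"
          using Lp_Holder(2)[OF p1 s(1)] x 1 by simp
        also have "\<dots> \<le> x * ?N" using s(2) x by simp
        finally have "integral {0..x} (\<lambda>t. \<bar>h t\<bar>) \<le> x * ?N" using Gc(2)[of x] x by simp
        moreover have "0 \<le> integral {0..x} (\<lambda>t. \<bar>h t\<bar>)" using Gc(2)[of x] x by simp
        ultimately show "\<bar>?G x\<bar> \<le> ?N" using x by (simp add: field_simps)
      qed
      from Lp_infinityI[OF m this Lp_norm_nonneg]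
      show "?G \<in> Lp_space p {0<..<1}" "Lp_norm p {0<..<1} ?G \<le> 1 * ?N" by (auto simp: 1)
    qed simp
  next
    case (2 r)
    then have "1 < r" using p by (simp add: ennreal_less_iff flip: ennreal_1)
    then show ?thesis using Hardy_inequality_finite 2 by (intro exI[of _ "r / (r - 1)"]) auto
  qed
qed

section \<open>A solution of the homogeneous equation\<close>

text \<open>Substituting \<open>\<Sum>n. c\<^sub>n x\<^bsup>n b\<^esup>\<close> with \<open>b = 2 - 2 \<alpha>\<close> into \<open>(x\<^bsup>2\<alpha>\<^esup> \<phi>')' = \<phi>\<close> and comparing coefficients
  gives this recursion.\<close>

primrec frobenius_coeff :: "real \<Rightarrow> nat \<Rightarrow> real" where
  "frobenius_coeff b 0 = 1"
| "frobenius_coeff b (Suc n) = frobenius_coeff b n / (b * (real n + 1) * (1 + real n * b))"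

lemma frobenius_coeff_bounds:
  assumes "0 < b"
  shows "0 < frobenius_coeff b n" "frobenius_coeff b n \<le> inverse (fact n) * (1 / b) ^ n"
proof -
  have den: "0 < b * (real n + 1) * (1 + real n * b)" for n
    using assms by (intro mult_pos_pos add_pos_nonneg add_nonneg_pos) auto
  show pos: "0 < frobenius_coeff b n" for n
    using den by (induction n) simp_all
  show "frobenius_coeff b n \<le> inverse (fact n) * (1 / b) ^ n"
  proof (induction n)
    case (Suc n)
    have "frobenius_coeff b (Suc n) \<le> frobenius_coeff b n / (b * (real n + 1))"
    proof -
      have "b * (real n + 1) * 1 \<le> b * (real n + 1) * (1 + real n * b)"
        using assms by (intro mult_left_mono) auto
      then show ?thesis using pos[of n] assms den[of n]
        by (auto intro!: divide_left_mono)
    qed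
    also have "\<dots> \<le> (inverse (fact n) * (1 / b) ^ n) / (b * (real n + 1))"
      using Suc assms by (intro divide_right_mono) auto
    also have "\<dots> = inverse (fact (Suc n)) * (1 / b) ^ Suc n"
      using assms by (simp add: field_simps)
    finally show ?case .
  qed simp
qed

lemma frobenius_coeff_summable:
  assumes "0 < b"
  shows "summable (\<lambda>n. frobenius_coeff b n * z ^ n)"
proof (rule summable_comparison_test')
  show "summable (\<lambda>n. inverse (fact n) * (\<bar>z\<bar> / b) ^ n)" by (rule summable_exp)
  fix n
  have "\<bar>frobenius_coeff b n * z ^ n\<bar> = frobenius_coeff b n * \<bar>z\<bar> ^ n"
    using frobenius_coeff_bounds(1)[OF assms, of n] by (simp add: abs_mult power_abs)
  also have "\<dots> \<le> inverse (fact n) * (1 / b) ^ n * \<bar>z\<bar> ^ n"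
    using frobenius_coeff_bounds(2)[OF assms, of n] by (intro mult_right_mono) auto
  finally show "norm (frobenius_coeff b n * z ^ n) \<le> inverse (fact n) * (\<bar>z\<bar> / b) ^ n"
    by (simp add: power_divide)
qed

text \<open>The recursion as a statement on the coefficients of \<open>b F' + b\<^sup>2 z F'' = F\<close>, which is the
  homogeneous equation in the variable \<open>z = x\<^sup>b\<close>.\<close>

lemma diffs_frobenius_coeff:
  assumes "0 < b"
  shows "b * diffs (frobenius_coeff b) n + b\<^sup>2 * (real n * diffs (frobenius_coeff b) n) = frobenius_coeff b n"
proof -
  have "0 < 1 + real n * b" "0 < real n + 1" using assms by (auto intro: add_pos_nonneg)
  then have "b * (real n + 1) * (1 + real n * b) * frobenius_coeff b (Suc n) = frobenius_coeff b n" using assms by simp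
  then show ?thesis by (simp add: diffs_def power2_eq_square algebra_simps del: frobenius_coeff.simps)
qed

lemma powser_nonneg_bounds:
  fixes c :: "nat \<Rightarrow> real"
  assumes "\<And>n. 0 \<le> c n" "\<And>z. summable (\<lambda>n. c n * z ^ n)" "0 \<le> z" "z \<le> 1"
  shows "c 0 \<le> (\<Sum>n. c n * z ^ n)" "(\<Sum>n. c n * z ^ n) \<le> (\<Sum>n. c n * 1 ^ n)"
proof -
  have "(\<Sum>n\<in>{0}. c n * z ^ n) \<le> (\<Sum>n. c n * z ^ n)"
    using assms by (intro sum_le_suminf) auto
  then show "c 0 \<le> (\<Sum>n. c n * z ^ n)" by simp
  show "(\<Sum>n. c n * z ^ n) \<le> (\<Sum>n. c n * 1 ^ n)"
    using assms assms(2)[of 1] by (intro suminf_le mult_left_mono power_mono) auto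
qed

text \<open>The function \<open>q\<close> is the flux \<open>x\<^bsup>2\<alpha>\<^esup> \<phi>'\<close>.  In terms of the power series \<open>F\<close> it is
  \<open>b x F' (x\<^sup>b)\<close>, because \<open>2 \<alpha> + b - 1 = 1\<close>.\<close>

lemma homogeneous_solution:
  fixes \<alpha> :: real
  assumes \<alpha>: "\<alpha> < 1"
  obtains \<phi> q M where "1 \<le> M"
    "\<And>x. 0 < x \<Longrightarrow> (\<phi> has_real_derivative x powr (- 2 * \<alpha>) * q x) (at x)"
    "\<And>x. 0 < x \<Longrightarrow> (q has_real_derivative \<phi> x) (at x)"
    "\<And>x. x \<in> {0<..1} \<Longrightarrow> 1 \<le> \<phi> x \<and> \<phi> x \<le> M \<and> 0 \<le> q x \<and> q x \<le> M * x"
proof -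
  define b where "b = 2 - 2 * \<alpha>"
  have b: "0 < b" using \<alpha> by (simp add: b_def)
  let ?c = "frobenius_coeff b"
  define F where "F z = (\<Sum>n. ?c n * z ^ n)" for z
  define F1 where "F1 z = (\<Sum>n. diffs ?c n * z ^ n)" for z
  define F2 where "F2 z = (\<Sum>n. diffs (diffs ?c) n * z ^ n)" for z
  have s0: "summable (\<lambda>n. ?c n * z ^ n)" for z by (rule frobenius_coeff_summable[OF b])
  have s1: "summable (\<lambda>n. diffs ?c n * z ^ n)" for z using termdiff_converges_all[OF s0] .
  have s2: "summable (\<lambda>n. diffs (diffs ?c) n * z ^ n)" for z using termdiff_converges_all[OF s1] .
  have dF: "(F has_real_derivative F1 z) (at z)" for z
    unfolding F_def[abs_def] F1_def by (rule termdiffs_strong_converges_everywhere[OF s0])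
  have dF1: "(F1 has_real_derivative F2 z) (at z)" for z
    unfolding F1_def[abs_def] F2_def by (rule termdiffs_strong_converges_everywhere[OF s1])
  have ode: "b * F1 z + b\<^sup>2 * (z * F2 z) = F z" for z
  proof -
    have "(\<lambda>n. real n * diffs ?c n * z ^ (n - Suc 0)) sums F2 z"
      unfolding F2_def by (rule diffs_equiv[OF s2])
    then have "(\<lambda>n. z * (real n * diffs ?c n * z ^ (n - Suc 0))) sums (z * F2 z)"
      by (rule sums_mult)
    moreover have "z * (real n * diffs ?c n * z ^ (n - Suc 0)) = real n * diffs ?c n * z ^ n" for n
      by (cases n) auto
    ultimately have 2: "(\<lambda>n. real n * diffs ?c n * z ^ n) sums (z * F2 z)" by simp
    have 1: "(\<lambda>n. diffs ?c n * z ^ n) sums F1 z"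
      unfolding F1_def by (rule summable_sums[OF s1])
    have "(\<lambda>n. b * (diffs ?c n * z ^ n) + b\<^sup>2 * (real n * diffs ?c n * z ^ n)) sums (b * F1 z + b\<^sup>2 * (z * F2 z))"
      by (intro sums_add sums_mult 1 2)
    moreover have "b * (diffs ?c n * z ^ n) + b\<^sup>2 * (real n * diffs ?c n * z ^ n) = ?c n * z ^ n" for n
      using diffs_frobenius_coeff[OF b, of n] by (metis (no_types, opaque_lifting) distrib_right mult.assoc)
    ultimately have "(\<lambda>n. ?c n * z ^ n) sums (b * F1 z + b\<^sup>2 * (z * F2 z))" by simp
    then show ?thesis unfolding F_def by (simp add: sums_unique)
  qed
  have c0: "0 \<le> ?c n" for n using frobenius_coeff_bounds(1)[OF b, of n] by simp
  then have d0: "0 \<le> diffs ?c n" for n by (simp add: diffs_def del: frobenius_coeff.simps)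
  define M where "M = max (F 1) (b * F1 1)"
  define \<phi> where "\<phi> x = F (x powr b)" for x
  define q where "q x = b * x * F1 (x powr b)" for x
  show ?thesis
  proof (rule that[of M \<phi> q])
    have "1 \<le> F 1" using powser_nonneg_bounds(1)[OF c0 s0, of 1] by (simp add: F_def)
    then show "1 \<le> M" by (simp add: M_def)
    fix x :: real assume x: "0 < x"
    have dx: "((\<lambda>x. x powr b) has_real_derivative b * x powr (b - 1)) (at x)"
      by (rule has_real_derivative_powr[OF x])
    have "(\<phi> has_real_derivative F1 (x powr b) * (b * x powr (b - 1))) (at x)"
      unfolding \<phi>_def[abs_def] by (rule DERIV_chain2[OF dF dx])
    also have "F1 (x powr b) * (b * x powr (b - 1)) = x powr (- 2 * \<alpha>) * q x"
    proof -
      have "x powr (b - 1) = x powr (- 2 * \<alpha>) * x"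
        using x powr_add[of x "- 2 * \<alpha>" 1] by (simp add: b_def)
      then show ?thesis by (simp add: q_def)
    qed
    finally show "(\<phi> has_real_derivative x powr (- 2 * \<alpha>) * q x) (at x)" .
    have "((\<lambda>x. F1 (x powr b)) has_real_derivative F2 (x powr b) * (b * x powr (b - 1))) (at x)"
      by (rule DERIV_chain2[OF dF1 dx])
    then have "(q has_real_derivative b * F1 (x powr b) + F2 (x powr b) * (b * x powr (b - 1)) * (b * x)) (at x)"
      unfolding q_def[abs_def] by (auto intro!: derivative_eq_intros)
    also have "b * F1 (x powr b) + F2 (x powr b) * (b * x powr (b - 1)) * (b * x) = \<phi> x"
    proof -
      have "x powr (b - 1) * x = x powr b"
        using x powr_add[of x "b - 1" 1] by simp
      moreover have "F2 (x powr b) * (b * x powr (b - 1)) * (b * x) = b\<^sup>2 * ((x powr (b - 1) * x) * F2 (x powr b))"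
        by (simp only: power2_eq_square mult_ac)
      ultimately have "F2 (x powr b) * (b * x powr (b - 1)) * (b * x) = b\<^sup>2 * (x powr b * F2 (x powr b))"
        by simp
      then show ?thesis unfolding \<phi>_def ode[of "x powr b", symmetric] by linarith
    qed
    finally show "(q has_real_derivative \<phi> x) (at x)" .
  next
    fix x :: real assume x: "x \<in> {0<..1}"
    then have z: "0 \<le> x powr b" "x powr b \<le> 1" using b by (auto intro: powr_le1)
    have "1 \<le> F (x powr b)" "F (x powr b) \<le> F 1"
      using powser_nonneg_bounds[OF c0 s0 z] by (simp_all add: F_def)
    moreover have "0 \<le> F1 (x powr b)" "F1 (x powr b) \<le> F1 1"
      using powser_nonneg_bounds[OF d0 s1 z] d0[of 0] by (auto simp: F1_def)
    moreover have "b * x * F1 (x powr b) \<le> b * x * F1 1"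
      using calculation x b by (intro mult_left_mono) auto
    moreover have "b * x * F1 1 \<le> M * x"
      using x mult_right_mono[of "b * F1 1" M x] by (simp add: M_def mult_ac)
    ultimately have "1 \<le> F (x powr b)" "F (x powr b) \<le> M" "0 \<le> F1 (x powr b)" "b * x * F1 (x powr b) \<le> M * x"
      by (simp_all add: M_def)
    then show "1 \<le> \<phi> x \<and> \<phi> x \<le> M \<and> 0 \<le> q x \<and> q x \<le> M * x"
      using x b by (simp add: \<phi>_def q_def)
  qed
qed

section \<open>Reduction of order\<close>

lemma tail_integral_powr:
  assumes "0 < a" "- 1 - a \<le> c" "x \<in> {0<..1::real}"
  shows "integral {x..1} (\<lambda>t. t powr c) \<le> x powr - a / a"
proof -
  have "integral {x..1} (\<lambda>t. t powr c) \<le> integral {x..1} (\<lambda>t. t powr (- 1 - a))"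
  proof (rule integral_le)
    show "(\<lambda>t. t powr c) integrable_on {x..1}"
      using assms by (intro integrable_continuous_real continuous_intros) auto
    show "(\<lambda>t. t powr (- 1 - a)) integrable_on {x..1}"
      using assms by (intro integrable_continuous_real continuous_intros) auto
    show "t powr c \<le> t powr (- 1 - a)" if "t \<in> {x..1}" for t
      using that assms by (intro powr_mono') auto
  qed
  also have "\<dots> \<le> x powr - a / a" using assms by (intro powr_tail_integral_le) auto
  finally show ?thesis .
qed

text \<open>A solution \<open>u\<close> together with its flux \<open>g\<close>.  The flux is carried along as a function of
  its own because \<open>deriv u\<close> is the derivative of \<open>u\<close> only at the points of \<open>(0, 1)\<close>.\<close>

locale flux_pair =
  fixes \<alpha> :: real and f u g :: "real \<Rightarrow> real"
  assumes cu: "continuous_on {0<..1} u" and u1: "u 1 = 0"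
    and cg: "continuous_on {0<..<1} g"
    and du: "\<And>x. x \<in> {0<..<1} \<Longrightarrow> (u has_real_derivative x powr (- 2 * \<alpha>) * g x) (at x)"
    and wd: "has_weak_deriv {0<..<1} g (\<lambda>x. u x - f x)"
    and g0: "(g \<longlongrightarrow> 0) (at_right 0)"

text \<open>The solution operator for the equation without the term of order zero, applied to \<open>\<bar>f\<bar>\<close>.  It dominates
  the solution up to a constant factor.\<close>

abbreviation iterated_integral :: "real \<Rightarrow> (real \<Rightarrow> real) \<Rightarrow> real \<Rightarrow> real" where
  "iterated_integral \<alpha> f x \<equiv> integral {x..1} (\<lambda>t. t powr (- 2 * \<alpha>) * integral {0..t} (\<lambda>s. \<bar>f s\<bar>))"

text \<open>Reduction of order.  With \<open>H t = \<integral>\<^sub>0\<^sup>t \<phi> f\<close>, the formula is \<open>u = \<phi> v\<close> where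
  \<open>v x = \<integral>\<^sub>x\<^sup>1 t\<^bsup>-2\<alpha>\<^esup> H t / (\<phi> t)\<^sup>2 dt\<close>; the flux is \<open>g = q v - H / \<phi>\<close>.  Only \<open>H\<close> fails to be \<open>C\<^sup>1\<close>, and it
  occurs in \<open>g\<close> with a \<open>C\<^sup>1\<close> factor, so the weak derivative of \<open>g\<close> comes from the product rule.\<close>

lemma neumann_solution_formula:
  fixes \<alpha> :: real
  assumes \<alpha>: "\<alpha> < 1"
  obtains M where "0 \<le> M" "\<And>f. integrable (lebesgue_on {0<..<1}) f \<Longrightarrow>
    \<exists>u g. flux_pair \<alpha> f u g \<and> (\<forall>x\<in>{0<..<1}. \<bar>u x\<bar> \<le> M * iterated_integral \<alpha> f x)"
proof -
  obtain \<phi> q M where M: "1 \<le> M"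
    and d\<phi>: "\<And>x. 0 < x \<Longrightarrow> (\<phi> has_real_derivative x powr (- 2 * \<alpha>) * q x) (at x)"
    and dq: "\<And>x. 0 < x \<Longrightarrow> (q has_real_derivative \<phi> x) (at x)"
    and bd: "\<And>x. x \<in> {0<..1} \<Longrightarrow> 1 \<le> \<phi> x \<and> \<phi> x \<le> M \<and> 0 \<le> q x \<and> q x \<le> M * x"
    by (rule homogeneous_solution[OF \<alpha>]) blast
  have c\<phi>: "continuous_on {0<..} \<phi>" by (intro continuous_at_imp_continuous_on ballI DERIV_isCont[OF d\<phi>]) auto
  have cq: "continuous_on {0<..} q" by (intro continuous_at_imp_continuous_on ballI DERIV_isCont[OF dq]) auto
  show ?thesis
  proof (rule that[of "M\<^sup>2"])
    fix f :: "real \<Rightarrow> real" assume f: "integrable (lebesgue_on {0<..<1}) f"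
    define A where "A t = integral {0..t} (\<lambda>s. \<bar>f s\<bar>)" for t
    define H where "H t = integral {0..t} (\<lambda>s. \<phi> s * f s)" for t
    define k where "k t = t powr (- 2 * \<alpha>) * H t / (\<phi> t)\<^sup>2" for t
    define v where "v x = integral {x..1} k" for x
    define u where "u x = \<phi> x * v x" for x
    define g where "g x = q x * v x - H x / \<phi> x" for x
    have fa: "integrable (lebesgue_on {0<..<1}) (\<lambda>s. \<bar>f s\<bar>)" using f by simp
    have fm: "f \<in> borel_measurable (lebesgue_on {0<..<1})" using f by auto
    have \<phi>m: "\<phi> \<in> borel_measurable (lebesgue_on {0<..<1})"
      by (intro continuous_imp_measurable_on_sets_lebesgue continuous_on_subset[OF c\<phi>]) auto
    have \<phi>f: "\<bar>\<phi> s * f s\<bar> \<le> M * \<bar>f s\<bar>" if "s \<in> {0<..<1}" for s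
      using bd[of s] that mult_right_mono[of "\<bar>\<phi> s\<bar>" M "\<bar>f s\<bar>"] by (auto simp: abs_mult)
    have \<phi>fi: "integrable (lebesgue_on {0<..<1}) (\<lambda>s. \<phi> s * f s)"
    proof (rule Bochner_Integration.integrable_bound)
      show "integrable (lebesgue_on {0<..<1}) (\<lambda>s. M * \<bar>f s\<bar>)" using fa by simp
      show "(\<lambda>s. \<phi> s * f s) \<in> borel_measurable (lebesgue_on {0<..<1})" using fm \<phi>m by measurable
      show "AE s in lebesgue_on {0<..<1}. norm (\<phi> s * f s) \<le> norm (M * \<bar>f s\<bar>)"
        using \<phi>f M by (intro AE_I2) auto
    qed
    note Ac = continuous_indefinite_LINT[OF fa, folded A_def]
    note Hc = continuous_indefinite_LINT[OF \<phi>fi, folded H_def]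
    have HA: "\<bar>H t\<bar> \<le> M * A t" if t: "t \<in> {0..1}" for t
    proof -
      have i: "integrable (lebesgue_on {0<..<t}) (\<lambda>s. \<phi> s * f s)" "integrable (lebesgue_on {0<..<t}) (\<lambda>s. \<bar>f s\<bar>)"
        using t by (auto intro!: integrable_lebesgue_on_subset[OF \<phi>fi] integrable_lebesgue_on_subset[OF fa])
      have "\<bar>H t\<bar> \<le> (LINT s|lebesgue_on {0<..<t}. \<bar>\<phi> s * f s\<bar>)"
        using Hc(2)[OF t] by simp
      also have "\<dots> \<le> (LINT s|lebesgue_on {0<..<t}. M * \<bar>f s\<bar>)"
        using i \<phi>f t by (intro integral_mono) auto
      finally show ?thesis using Ac(2)[OF t] by simp
    qed
    have A0: "0 \<le> A t" if "t \<in> {0..1}" for t using Ac(2)[OF that] by simp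
    have k: "\<bar>k t\<bar> \<le> M * (t powr (- 2 * \<alpha>) * A t)" if t: "t \<in> {0<..1}" for t
    proof -
      have "1 \<le> (\<phi> t)\<^sup>2" using bd[OF t] by (simp add: one_le_power)
      then have "\<bar>k t\<bar> \<le> \<bar>t powr (- 2 * \<alpha>) * H t\<bar>"
        using divide_left_mono[of 1 "(\<phi> t)\<^sup>2" "\<bar>t powr (- 2 * \<alpha>) * H t\<bar>"] bd[OF t] by (simp add: k_def abs_divide)
      also have "\<dots> = t powr (- 2 * \<alpha>) * \<bar>H t\<bar>" by (simp add: abs_mult)
      also have "\<dots> \<le> t powr (- 2 * \<alpha>) * (M * A t)" using HA[of t] t by (intro mult_left_mono) auto
      finally show ?thesis by (simp add: mult_ac)
    qed
    have ck: "continuous_on {0<..1} k"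
      unfolding k_def using bd by (intro continuous_intros continuous_on_subset[OF c\<phi>] continuous_on_subset[OF Hc(1)]) force+
    have ck': "continuous_on {x..1} k" if "0 < x" for x
      by (rule continuous_on_subset[OF ck]) (use that in auto)
    have cA: "continuous_on {x..1} (\<lambda>t. t powr (- 2 * \<alpha>) * A t)" if "0 < x" for x
      using that by (intro continuous_intros continuous_on_subset[OF Ac(1)]) auto
    have vb: "\<bar>v x\<bar> \<le> M * integral {x..1} (\<lambda>t. t powr (- 2 * \<alpha>) * A t)" if x: "x \<in> {0<..1}" for x
    proof -
      have "norm (v x) \<le> integral {x..1} (\<lambda>t. M * (t powr (- 2 * \<alpha>) * A t))"
        unfolding v_def
      proof (rule integral_norm_bound_integral)
        show "k integrable_on {x..1}" using ck' x by (auto intro: integrable_continuous_real)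
        show "(\<lambda>t. M * (t powr (- 2 * \<alpha>) * A t)) integrable_on {x..1}"
          using cA x by (intro integrable_continuous_real continuous_on_mult_left) auto
      qed (use k x in auto)
      then show ?thesis by simp
    qed
    have dv: "(v has_real_derivative - k x) (at x)" if x: "x \<in> {0<..<1}" for x
    proof -
      have "(v has_vector_derivative - k x) (at x within {x/2..1})"
        unfolding v_def using x by (intro integral_has_vector_derivative' ck') auto
      moreover have "at x within {x/2..1} = at x" using x by (intro at_within_interior) auto
      ultimately show ?thesis by (simp add: has_real_derivative_iff_has_vector_derivative)
    qed
    have cv: "continuous_on {0<..1} v"
    proof (rule continuous_on_eq_continuous_within[THEN iffD2], rule ballI)
      fix x :: real assume x: "x \<in> {0<..1}"
      have "continuous_on {x/2..1} v"
        unfolding v_def using x by (intro indefinite_integral_continuous_1' integrable_continuous_real ck') auto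
      then have "continuous (at x within {x/2..1}) v"
        using x by (auto simp: continuous_on_eq_continuous_within)
      moreover have "at x within {x/2..1} = at x within {0<..1}"
        by (rule at_within_nhd[of x "{x/2<..}"]) (use x in auto)
      ultimately show "continuous (at x within {0<..1}) v" by simp
    qed
    have \<phi>0: "\<phi> x \<noteq> 0" if "x \<in> {0<..1}" for x using bd[OF that] by auto
    have du: "(u has_real_derivative x powr (- 2 * \<alpha>) * g x) (at x)" if x: "x \<in> {0<..<1}" for x
    proof -
      have "(u has_real_derivative (x powr (- 2 * \<alpha>) * q x) * v x + (- k x) * \<phi> x) (at x)"
        unfolding u_def using x by (intro DERIV_mult d\<phi> dv) auto
      also have "(x powr (- 2 * \<alpha>) * q x) * v x + (- k x) * \<phi> x = x powr (- 2 * \<alpha>) * g x"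
        using \<phi>0[of x] x by (simp add: g_def k_def power2_eq_square right_diff_distrib)
      finally show ?thesis .
    qed
    have cg: "continuous_on {0<..<1} g"
      unfolding g_def using \<phi>0
      by (intro continuous_intros continuous_on_subset[OF c\<phi>] continuous_on_subset[OF cq] continuous_on_subset[OF cv]
          continuous_on_subset[OF Hc(1)]) force+
    have cu: "continuous_on {0<..1} u"
      unfolding u_def by (intro continuous_intros continuous_on_subset[OF c\<phi>] cv) auto
    have u1: "u 1 = 0" by (simp add: u_def v_def)
    have wd: "has_weak_deriv {0<..<1} g (\<lambda>x. u x - f x)"
    proof -
      let ?r = "\<lambda>x. - (x powr (- 2 * \<alpha>) * q x) / (\<phi> x)\<^sup>2"
      have "has_weak_deriv {0<..<1} (\<lambda>x. q x * v x) (\<lambda>x. \<phi> x * v x + (- k x) * q x)"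
      proof (rule has_weak_deriv_C1)
        show "((\<lambda>x. q x * v x) has_real_derivative \<phi> x * v x + (- k x) * q x) (at x)" if "x \<in> {0<..<1}" for x
          using that by (intro DERIV_mult dq dv) auto
        show "continuous_on {0<..<1} (\<lambda>x. \<phi> x * v x + (- k x) * q x)"
          by (intro continuous_intros continuous_on_subset[OF c\<phi>] continuous_on_subset[OF cq] continuous_on_subset[OF cv]
              continuous_on_subset[OF ck]) auto
      qed simp
      moreover have "has_weak_deriv {0<..<1} (\<lambda>x. H x * (1 / \<phi> x)) (\<lambda>x. (\<phi> x * f x) * (1 / \<phi> x) + H x * ?r x)"
      proof (rule has_weak_deriv_mult)
        show "has_weak_deriv {0<..<1} H (\<lambda>x. \<phi> x * f x)"
          unfolding H_def by (rule has_weak_deriv_indefinite[OF \<phi>fi]) simp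
        show "((\<lambda>x. 1 / \<phi> x) has_real_derivative ?r x) (at x)" if "x \<in> {0<..<1}" for x
          using that \<phi>0[of x] d\<phi>[of x] by (auto intro!: derivative_eq_intros simp: power2_eq_square)
        show "continuous_on {0<..<1} ?r"
          using \<phi>0 by (intro continuous_intros continuous_on_subset[OF c\<phi>] continuous_on_subset[OF cq]) force+
      qed simp
      ultimately have "has_weak_deriv {0<..<1} (\<lambda>x. q x * v x - H x * (1 / \<phi> x))
        (\<lambda>x. (\<phi> x * v x + (- k x) * q x) - ((\<phi> x * f x) * (1 / \<phi> x) + H x * ?r x))"
        by (rule has_weak_deriv_diff) simp
      then show ?thesis
      proof (rule has_weak_deriv_cong_AE)
        show "AE x in lebesgue_on {0<..<1}. (\<phi> x * v x + (- k x) * q x) - ((\<phi> x * f x) * (1 / \<phi> x) + H x * ?r x) = u x - f x"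
          using \<phi>0 by (intro AE_I2) (auto simp: k_def u_def)
      qed (auto simp: g_def)
    qed
    have g0: "(g \<longlongrightarrow> 0) (at_right 0)"
    proof -
      \<comment> \<open>An exponent \<open>c > 1\<close> instead of \<open>2 \<alpha>\<close> makes \<open>\<integral>\<^sub>x\<^sup>1 t\<^bsup>-c\<^esup> dt\<close> at most a multiple of \<open>x\<^bsup>1-c\<^esup>\<close>
        without distinguishing cases; the factor \<open>q x \<le> M x\<close> compensates it since \<open>c < 2\<close>.\<close>
      define c where "c = max (2 * \<alpha>) (3 / 2)"
      have c: "1 < c" "c < 2" "2 * \<alpha> \<le> c" using \<alpha> by (auto simp: c_def)
      have mono: "A t \<le> A 1" if "t \<in> {0..1}" for t
        unfolding A_def using Ac(3) that
        by (intro integral_subset_le) (auto intro: integrable_on_subinterval)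
      have bound: "\<bar>g x\<bar> \<le> M\<^sup>2 * A 1 / (c - 1) * x powr (2 - c) + M * A x" if x: "x \<in> {0<..<1}" for x
      proof -
        have "integral {x..1} (\<lambda>t. t powr (- 2 * \<alpha>) * A t) \<le> integral {x..1} (\<lambda>t. t powr (- 2 * \<alpha>) * A 1)"
        proof (rule integral_le)
          show "(\<lambda>t. t powr (- 2 * \<alpha>) * A t) integrable_on {x..1}"
            using cA x by (auto intro!: integrable_continuous_real)
          show "(\<lambda>t. t powr (- 2 * \<alpha>) * A 1) integrable_on {x..1}"
            using x by (intro integrable_continuous_real continuous_intros) auto
        qed (use mono x in \<open>auto intro!: mult_left_mono\<close>)
        also have "\<dots> = integral {x..1} (\<lambda>t. t powr (- 2 * \<alpha>)) * A 1" by simp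
        also have "\<dots> \<le> x powr - (c - 1) / (c - 1) * A 1"
          using A0[of 1] c x by (intro mult_right_mono tail_integral_powr) auto
        finally have "M * integral {x..1} (\<lambda>t. t powr (- 2 * \<alpha>) * A t) \<le> M * (x powr - (c - 1) / (c - 1) * A 1)"
          using M by (intro mult_left_mono) auto
        with vb[of x] x have v: "\<bar>v x\<bar> \<le> M * (x powr - (c - 1) / (c - 1) * A 1)" by auto
        have "\<bar>q x * v x\<bar> \<le> (M * x) * (M * (x powr - (c - 1) / (c - 1) * A 1))"
          unfolding abs_mult using bd[of x] x v by (intro mult_mono) auto
        also have "\<dots> = M\<^sup>2 * A 1 / (c - 1) * (x * x powr - (c - 1))" by (simp add: power2_eq_square)
        also have "x * x powr - (c - 1) = x powr (2 - c)"
          using x powr_add[of x 1 "- (c - 1)"] by simp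
        finally have 1: "\<bar>q x * v x\<bar> \<le> M\<^sup>2 * A 1 / (c - 1) * x powr (2 - c)" .
        have "\<bar>H x / \<phi> x\<bar> \<le> \<bar>H x\<bar>" using bd[of x] x divide_left_mono[of 1 "\<phi> x" "\<bar>H x\<bar>"] by (simp add: abs_divide)
        with HA[of x] x have "\<bar>H x / \<phi> x\<bar> \<le> M * A x" by auto
        with 1 show ?thesis unfolding g_def by linarith
      qed
      have "((\<lambda>x. M\<^sup>2 * A 1 / (c - 1) * x powr (2 - c) + M * A x) \<longlongrightarrow> M\<^sup>2 * A 1 / (c - 1) * 0 + M * 0) (at_right 0)"
      proof (intro tendsto_add tendsto_mult tendsto_const)
        show "((\<lambda>x. x powr (2 - c)) \<longlongrightarrow> 0) (at_right 0)" using c by real_asymp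
        show "(A \<longlongrightarrow> 0) (at_right 0)"
          unfolding A_def by (rule indefinite_integral_tendsto_zero[OF fa])
      qed
      then have lim: "((\<lambda>x. M\<^sup>2 * A 1 / (c - 1) * x powr (2 - c) + M * A x) \<longlongrightarrow> 0) (at_right 0)" by simp
      have "\<forall>\<^sub>F x in at_right 0. norm (g x) \<le> M\<^sup>2 * A 1 / (c - 1) * x powr (2 - c) + M * A x"
        by (rule eventually_at_rightI[of 0 1]) (simp_all only: real_norm_def bound zero_less_one)
      then show ?thesis by (rule Lim_null_comparison) (rule lim)
    qed
    have ub: "\<forall>x\<in>{0<..<1}. \<bar>u x\<bar> \<le> M\<^sup>2 * iterated_integral \<alpha> f x"
    proof
      fix x :: real assume x: "x \<in> {0<..<1}"
      have "\<bar>u x\<bar> \<le> M * (M * integral {x..1} (\<lambda>t. t powr (- 2 * \<alpha>) * A t))"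
        unfolding u_def abs_mult using bd[of x] vb[of x] x by (intro mult_mono) auto
      then show "\<bar>u x\<bar> \<le> M\<^sup>2 * iterated_integral \<alpha> f x"
        by (simp add: A_def power2_eq_square)
    qed
    have "flux_pair \<alpha> f u g" by unfold_locales (fact cu u1 cg du wd g0)+
    with ub show "\<exists>u g. flux_pair \<alpha> f u g \<and> (\<forall>x\<in>{0<..<1}. \<bar>u x\<bar> \<le> M\<^sup>2 * iterated_integral \<alpha> f x)" by blast
  qed simp
qed

text \<open>By Hoelder's inequality the iterated integral is at most \<open>\<parallel>f\<parallel> \<integral>\<^sub>x\<^sup>1 t\<^bsup>b-1-\<theta>\<^esup> dt\<close>, where \<open>b = 2 - 2 \<alpha> > 0\<close> and
  \<open>\<theta> = 1/p\<close>, and this in turn is at most a multiple of \<open>x\<^bsup>-e\<^esup>\<close>, which is in \<open>L\<^sup>p\<close>.\<close>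

lemma iterated_integral_Lp_bound:
  assumes \<alpha>: "\<alpha> < 1" and p: "1 \<le> p" and M: "0 \<le> M"
  obtains K where "0 < K" "\<And>f u. f \<in> Lp_space p {0<..<1} \<Longrightarrow> u \<in> borel_measurable (lebesgue_on {0<..<1}) \<Longrightarrow>
    (\<And>x. x \<in> {0<..<1} \<Longrightarrow> \<bar>u x\<bar> \<le> M * iterated_integral \<alpha> f x) \<Longrightarrow>
    u \<in> Lp_space p {0<..<1} \<and> Lp_norm p {0<..<1} u \<le> K * Lp_norm p {0<..<1} f"
proof -
  define \<theta> where "\<theta> = enn2real (1 / p)"
  define b where "b = 2 - 2 * \<alpha>"
  have b: "0 < b" using \<alpha> by (simp add: b_def)
  have \<theta>: "0 \<le> \<theta>" by (simp add: \<theta>_def)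
  obtain e B where e: "e = 0 \<or> (0 < e \<and> e < \<theta>)" and B: "0 < B"
    and tail: "\<And>x. x \<in> {0<..1} \<Longrightarrow> integral {x..1} (\<lambda>t. t powr (b - 1 - \<theta>)) \<le> B * x powr - e"
  proof (cases "\<theta> = 0")
    case True
    show ?thesis
    proof (rule that[of 0 "1 / b"])
      fix x :: real assume x: "x \<in> {0<..1}"
      have i: "((\<lambda>t. t powr (b - 1)) has_integral (1 / b)) {0..1}"
        using has_integral_powr_from_0[of "b - 1" 1] b by simp
      have "integral {x..1} (\<lambda>t. t powr (b - 1)) \<le> integral {0..1} (\<lambda>t. t powr (b - 1))"
      proof (rule integral_subset_le)
        show "(\<lambda>t. t powr (b - 1)) integrable_on {0..1}" using i by (auto simp: integrable_on_def)
        then show "(\<lambda>t. t powr (b - 1)) integrable_on {x..1}"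
          by (rule integrable_on_subinterval) (use x in auto)
      qed (use x in auto)
      then show "integral {x..1} (\<lambda>t. t powr (b - 1 - \<theta>)) \<le> 1 / b * x powr - 0"
        using i x True by (simp add: integral_unique)
    qed (use b in auto)
  next
    case False
    \<comment> \<open>The exponent must be positive, less than \<open>\<theta>\<close> for integrability, and at least \<open>\<theta> - b\<close>.\<close>
    define e where "e = max (\<theta> / 2) (\<theta> - b)"
    have "0 < e" "e < \<theta>" "\<theta> - b \<le> e" using False \<theta> b by (auto simp: e_def)
    then show ?thesis using tail_integral_powr[of e "b - 1 - \<theta>"] that[of e "1 / e"] by auto
  qed
  define h where "h x = x powr - e" for x :: real
  have h: "h \<in> Lp_space p {0<..<1}"
    unfolding h_def using e by (intro Lp_powr[OF p]) (auto simp: \<theta>_def)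
  show ?thesis
  proof (rule that[of "M * B * Lp_norm p {0<..<1} h + 1"])
    show "0 < M * B * Lp_norm p {0<..<1} h + 1"
      using M B Lp_norm_nonneg[of p "{0<..<1}" h] by (intro add_nonneg_pos mult_nonneg_nonneg) auto
    fix f u :: "real \<Rightarrow> real"
    assume f: "f \<in> Lp_space p {0<..<1}" and um: "u \<in> borel_measurable (lebesgue_on {0<..<1})"
      and ub: "\<And>x. x \<in> {0<..<1} \<Longrightarrow> \<bar>u x\<bar> \<le> M * iterated_integral \<alpha> f x"
    let ?N = "Lp_norm p {0<..<1} f"
    have N: "0 \<le> ?N" by (rule Lp_norm_nonneg)
    have "integrable (lebesgue_on {0<..<1}) f" by (rule Lp_Holder(1)[OF p f]) simp
    then have fa: "integrable (lebesgue_on {0<..<1}) (\<lambda>s. \<bar>f s\<bar>)" by simp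
    note A = continuous_indefinite_LINT[OF fa]
    have Ab: "integral {0..t} (\<lambda>s. \<bar>f s\<bar>) \<le> t powr (1 - \<theta>) * ?N" if t: "t \<in> {0<..1}" for t
    proof -
      have s: "f \<in> Lp_space p {0<..<t}" "Lp_norm p {0<..<t} f \<le> ?N"
        using t by (auto intro!: Lp_subset[OF p f])
      have "(LINT s|lebesgue_on {0<..<t}. \<bar>f s\<bar>) \<le> t powr (1 - \<theta>) * Lp_norm p {0<..<t} f"
        unfolding \<theta>_def using Lp_Holder(2)[OF p s(1)] t by simp
      also have "\<dots> \<le> t powr (1 - \<theta>) * ?N" using s(2) by (intro mult_left_mono) auto
      finally show ?thesis using A(2)[of t] t by simp
    qed
    have u': "\<bar>u x\<bar> \<le> M * B * ?N * \<bar>h x\<bar>" if x: "x \<in> {0<..<1}" for x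
    proof -
      have "iterated_integral \<alpha> f x
        \<le> integral {x..1} (\<lambda>t. t powr (b - 1 - \<theta>) * ?N)"
      proof (rule integral_le)
        show "(\<lambda>t. t powr (- 2 * \<alpha>) * integral {0..t} (\<lambda>s. \<bar>f s\<bar>)) integrable_on {x..1}"
          using x by (intro integrable_continuous_real continuous_intros continuous_on_subset[OF A(1)]) auto
        show "(\<lambda>t. t powr (b - 1 - \<theta>) * ?N) integrable_on {x..1}"
          using x by (intro integrable_continuous_real continuous_intros) auto
        fix t assume t: "t \<in> {x..1}"
        have "t powr (- 2 * \<alpha>) * integral {0..t} (\<lambda>s. \<bar>f s\<bar>) \<le> t powr (- 2 * \<alpha>) * (t powr (1 - \<theta>) * ?N)"
          using Ab[of t] t x by (intro mult_left_mono) auto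
        also have "\<dots> = t powr (- 2 * \<alpha> + (1 - \<theta>)) * ?N" by (simp only: powr_add mult.assoc)
        also have "- 2 * \<alpha> + (1 - \<theta>) = b - 1 - \<theta>" by (simp add: b_def)
        finally show "t powr (- 2 * \<alpha>) * integral {0..t} (\<lambda>s. \<bar>f s\<bar>) \<le> t powr (b - 1 - \<theta>) * ?N" .
      qed
      also have "\<dots> = integral {x..1} (\<lambda>t. t powr (b - 1 - \<theta>)) * ?N" by simp
      also have "\<dots> \<le> B * x powr - e * ?N" using tail[of x] x N by (intro mult_right_mono) auto
      finally have "M * iterated_integral \<alpha> f x \<le> M * (B * x powr - e * ?N)"
        using M by (rule mult_left_mono)
      also have "\<dots> = M * B * ?N * \<bar>h x\<bar>" by (simp add: h_def mult_ac)
      finally show ?thesis using ub[OF x] by linarith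
    qed
    have ae: "AE x in lebesgue_on {0<..<1}. \<bar>u x\<bar> \<le> M * B * ?N * \<bar>h x\<bar>"
      by (intro AE_I2) (simp add: u')
    have nn: "0 \<le> M * B * ?N" using M B N by simp
    note D = Lp_dominated[OF p h um ae nn]
    have "M * B * ?N * Lp_norm p {0<..<1} h \<le> (M * B * Lp_norm p {0<..<1} h + 1) * ?N"
      using N by (simp add: algebra_simps)
    with D show "u \<in> Lp_space p {0<..<1} \<and> Lp_norm p {0<..<1} u \<le> (M * B * Lp_norm p {0<..<1} h + 1) * ?N"
      by auto
  qed
qed

section \<open>Uniqueness\<close>

text \<open>An energy argument in two steps: \<open>(g w)' = w\<^sup>2 + x\<^sup>c g\<^sup>2 \<ge> 0\<close> with limit \<open>0\<close> at \<open>1\<close> gives \<open>g w \<le> 0\<close>, and then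
  \<open>(g\<^sup>2)' = 2 g w \<le> 0\<close> with limit \<open>0\<close> at \<open>0\<close> gives \<open>g = 0\<close>.  Integrating
  \<open>(g w)'\<close> over \<open>(0, 1)\<close> would meet the boundary term \<open>g w\<close> at \<open>0\<close>, where \<open>w\<close> may be unbounded.\<close>

lemma homogeneous_problem_trivial:
  fixes w g :: "real \<Rightarrow> real"
  assumes cw: "continuous_on {0<..1} w" and w1: "w 1 = 0"
    and dw: "\<And>x. x \<in> {0<..<1} \<Longrightarrow> (w has_real_derivative x powr c * g x) (at x)"
    and dg: "\<And>x. x \<in> {0<..<1} \<Longrightarrow> (g has_real_derivative w x) (at x)"
    and g0: "(g \<longlongrightarrow> 0) (at_right 0)" and x: "x \<in> {0<..1}"
  shows "w x = 0"
proof -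
  have dh: "((\<lambda>x. g x * w x) has_real_derivative (w x)\<^sup>2 + x powr c * (g x)\<^sup>2) (at x)" if "x \<in> {0<..<1}" for x
    using DERIV_mult[OF dg[OF that] dw[OF that]] by (simp add: power2_eq_square mult_ac)
  have hmono: "g x * w x \<le> g y * w y" if "0 < x" "x \<le> y" "y < 1" for x y
  proof (rule DERIV_nonneg_imp_nondecreasing[OF that(2)])
    fix t assume "x \<le> t" "t \<le> y"
    then have "t \<in> {0<..<1}" using that by auto
    from dh[OF this] show "\<exists>d. ((\<lambda>x. g x * w x) has_real_derivative d) (at t) \<and> 0 \<le> d"
      by (intro exI conjI) auto
  qed
  obtain B where B: "\<And>t. t \<in> {1/2..1} \<Longrightarrow> \<bar>w t\<bar> \<le> B"
  proof -
    have "continuous_on {1/2..1} w" by (rule continuous_on_subset[OF cw]) auto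
    then have "bounded (w ` {1/2..1})" using compact_continuous_image compact_imp_bounded by blast
    then show ?thesis using that by (metis bounded_iff imageI real_norm_def)
  qed
  have B0: "0 \<le> B" using B[of 1] by auto
  have gb: "\<bar>g t\<bar> \<le> \<bar>g (1/2)\<bar> + B" if t: "t \<in> {1/2..<1}" for t
  proof -
    have "norm (g t - g (1/2)) \<le> B * norm (t - 1/2)"
    proof (rule field_differentiable_bound)
      show "convex {1/2..<1::real}" by simp
      show "(g has_real_derivative w z) (at z within {1/2..<1})" if "z \<in> {1/2..<1}" for z
        using dg[of z] that by (auto intro: has_field_derivative_at_within)
      show "norm (w z) \<le> B" if "z \<in> {1/2..<1}" for z using B[of z] that by auto
    qed (use t in auto)
    also have "\<dots> \<le> B * 1" using t B0 by (intro mult_left_mono) auto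
    finally show ?thesis by simp
  qed
  have wlim: "(w \<longlongrightarrow> 0) (at_left 1)"
  proof -
    have "continuous_on {1/2..1} w" by (rule continuous_on_subset[OF cw]) auto
    then have "(w \<longlongrightarrow> w 1) (at 1 within {1/2..1})" by (auto simp: continuous_on_def)
    then show ?thesis using w1 by (simp add: at_within_Icc_at_left)
  qed
  have hlim: "((\<lambda>y. g y * w y) \<longlongrightarrow> 0) (at_left 1)"
  proof (rule Lim_null_comparison)
    show "\<forall>\<^sub>F y in at_left 1. norm (g y * w y) \<le> (\<bar>g (1/2)\<bar> + B) * \<bar>w y\<bar>"
    proof (rule eventually_at_leftI[of "1/2"])
      show "norm (g y * w y) \<le> (\<bar>g (1/2)\<bar> + B) * \<bar>w y\<bar>" if "y \<in> {1/2<..<1}" for y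
        using gb[of y] that by (auto simp: abs_mult intro!: mult_right_mono)
    qed simp
    show "((\<lambda>y. (\<bar>g (1/2)\<bar> + B) * \<bar>w y\<bar>) \<longlongrightarrow> 0) (at_left 1)"
      using tendsto_mult_left[OF tendsto_rabs[OF wlim], of "\<bar>g (1/2)\<bar> + B"] by simp
  qed
  have h0: "g x * w x \<le> 0" if "x \<in> {0<..<1}" for x
  proof (rule tendsto_lowerbound[OF hlim])
    show "\<forall>\<^sub>F y in at_left 1. g x * w x \<le> g y * w y"
      by (rule eventually_at_leftI[of x]) (use that hmono in auto)
  qed simp
  have gsq: "g x = 0" if x: "x \<in> {0<..<1}" for x
  proof -
    have mono: "(g x)\<^sup>2 \<le> (g y)\<^sup>2" if y: "0 < y" "y \<le> x" for y
    proof (rule DERIV_nonpos_imp_nonincreasing[OF y(2)])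
      fix t assume "y \<le> t" "t \<le> x"
      then have t: "t \<in> {0<..<1}" using x y by auto
      have "((\<lambda>x. (g x)\<^sup>2) has_real_derivative 2 * (g t * w t)) (at t)"
        using dg[OF t] by (auto intro!: derivative_eq_intros)
      then show "\<exists>d. ((\<lambda>x. (g x)\<^sup>2) has_real_derivative d) (at t) \<and> d \<le> 0"
        using h0[OF t] by (intro exI[of _ "2 * (g t * w t)"] conjI) auto
    qed
    have "((\<lambda>y. (g y)\<^sup>2) \<longlongrightarrow> 0\<^sup>2) (at_right 0)" by (intro tendsto_intros g0)
    then have "(g x)\<^sup>2 \<le> 0\<^sup>2"
    proof (rule tendsto_lowerbound)
      show "\<forall>\<^sub>F y in at_right 0. (g x)\<^sup>2 \<le> (g y)\<^sup>2"
        by (rule eventually_at_rightI[of 0 x]) (use x mono in auto)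
    qed simp
    then show ?thesis by simp
  qed
  show ?thesis
  proof (cases "x = 1")
    case False
    have "w 1 = w x"
    proof (rule DERIV_isconst_end[where f = w])
      show "continuous_on {x..1} w" by (rule continuous_on_subset[OF cw]) (use x in auto)
      show "(w has_real_derivative 0) (at t)" if "x < t" "t < 1" for t
        using dw[of t] gsq[of t] that x by auto
    qed (use x False in auto)
    then show ?thesis using w1 by simp
  qed (use w1 in simp)
qed

text \<open>Translates the distributional definition of a solution into classical data: \<open>v\<close> is of class
  \<open>C\<^sup>1\<close> with continuous flux, and the equation becomes a weak derivative of the flux.\<close>

lemma solution_regularity:
  assumes p: "1 \<le> p" and s: "solves_problem \<alpha> p f v" and n: "neumann_properties \<alpha> p v"
  shows "continuous_on {0<..1} v" "v 1 = 0" "v \<in> Lp_space p {0<..<1}"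
    "(flux \<alpha> v \<longlongrightarrow> 0) (at_right 0)" "continuous_on {0<..<1} (flux \<alpha> v)"
    "has_weak_deriv {0<..<1} (flux \<alpha> v) (\<lambda>x. v x - f x)"
    "\<And>x. x \<in> {0<..<1} \<Longrightarrow> (v has_real_derivative x powr (- 2 * \<alpha>) * flux \<alpha> v x) (at x)"
proof -
  have cv: "continuous_on {0<..1} v" using s by (simp add: solves_problem_def)
  then show "continuous_on {0<..1} v" "v 1 = 0" "v \<in> Lp_space p {0<..<1}" "(flux \<alpha> v \<longlongrightarrow> 0) (at_right 0)"
    using s n by (auto simp: solves_problem_def neumann_properties_def)
  have C1: "\<exists>D. continuous_on {\<delta><..<1} D \<and> (\<forall>x\<in>{\<delta><..<1}. (v has_real_derivative D x) (at x))" if \<delta>: "\<delta> \<in> {0<..<1}" for \<delta>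
  proof -
    have "v \<in> sobolev 2 p {\<delta><..<1}" using s \<delta> by (auto simp: solves_problem_def W2p_loc_def)
    then obtain v1 v2 where v: "has_weak_deriv {\<delta><..<1} v v1" "v1 \<in> Lp_space p {\<delta><..<1}"
      "has_weak_deriv {\<delta><..<1} v1 v2" "v2 \<in> Lp_space p {\<delta><..<1}"
      by (auto simp: numeral_2_eq_2)
    have \<delta>1: "\<delta> < 1" using \<delta> by simp
    have i: "integrable (lebesgue_on {\<delta><..<1}) v1" "integrable (lebesgue_on {\<delta><..<1}) v2"
      using Lp_Holder_interval(1)[OF p _ \<delta>1] v by auto
    have c: "continuous_on {\<delta><..<1} v" by (rule continuous_on_subset[OF cv]) (use \<delta> in auto)
    show ?thesis using second_weak_deriv_imp_C1[OF \<delta>1 v(1,3) i c] by metis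
  qed
  have d: "(v has_real_derivative deriv v x) (at x)" "isCont (deriv v) x" if x: "x \<in> {0<..<1}" for x
  proof -
    obtain D where D: "continuous_on {x/2<..<1} D" "\<And>y. y \<in> {x/2<..<1} \<Longrightarrow> (v has_real_derivative D y) (at y)"
      using C1[of "x/2"] x by auto
    have eq: "deriv v y = D y" if "y \<in> {x/2<..<1}" for y
      using D(2)[OF that] by (rule DERIV_imp_deriv)
    show "(v has_real_derivative deriv v x) (at x)" using D(2)[of x] eq[of x] x by simp
    have "continuous_on {x/2<..<1} (deriv v)" using continuous_on_eq[OF D(1)] eq by metis
    then show "isCont (deriv v) x" using x by (simp add: continuous_on_eq_continuous_at)
  qed
  have "continuous_on {0<..<1} (deriv v)"
    by (intro continuous_at_imp_continuous_on ballI d)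
  then show "continuous_on {0<..<1} (flux \<alpha> v)"
    unfolding flux_def by (intro continuous_intros) auto
  show "(v has_real_derivative x powr (- 2 * \<alpha>) * flux \<alpha> v x) (at x)" if x: "x \<in> {0<..<1}" for x
  proof -
    have "x powr (- 2 * \<alpha>) * x powr (2 * \<alpha>) = 1" using x by (simp flip: powr_add)
    then have "x powr (- 2 * \<alpha>) * flux \<alpha> v x = deriv v x"
      unfolding flux_def by (metis mult.assoc mult_1)
    then show ?thesis using d(1)[OF x] by simp
  qed
  obtain v1 where "has_weak_deriv {0<..<1} (flux \<alpha> v) v1"
    using n by (auto simp: neumann_properties_def)
  then have wd: "has_weak_deriv {0<..<1} (flux \<alpha> v) (weak_deriv {0<..<1} (flux \<alpha> v))"
    by (intro weak_deriv_AE_eq(2)) auto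
  show "has_weak_deriv {0<..<1} (flux \<alpha> v) (\<lambda>x. v x - f x)"
  proof (rule has_weak_deriv_cong_AE[OF wd])
    have "AE x in lebesgue. x \<in> {0<..1} \<longrightarrow> - weak_deriv {0<..<1} (flux \<alpha> v) x + v x = f x"
      using s by (simp add: solves_problem_def)
    then show "AE x in lebesgue_on {0<..<1}. weak_deriv {0<..<1} (flux \<alpha> v) x = v x - f x"
      by (auto simp: AE_restrict_space_iff elim!: eventually_mono)
  qed auto
qed

lemma neumann_solution_unique:
  assumes p: "1 \<le> p" and u: "solves_problem \<alpha> p f u" "neumann_properties \<alpha> p u"
    and v: "solves_problem \<alpha> p f v" "neumann_properties \<alpha> p v" and x: "x \<in> {0<..1}"
  shows "v x = u x"
proof -
  note U = solution_regularity[OF p u] and V = solution_regularity[OF p v]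
  let ?w = "\<lambda>x. v x - u x" and ?g = "\<lambda>x. flux \<alpha> v x - flux \<alpha> u x"
  have "?w x = 0"
  proof (rule homogeneous_problem_trivial[where w = ?w and g = ?g and c = "- 2 * \<alpha>"])
    show cw: "continuous_on {0<..1} ?w" by (intro continuous_intros U V)
    show "?w 1 = 0" using U(2) V(2) by simp
    show "(?w has_real_derivative x powr (- 2 * \<alpha>) * ?g x) (at x)" if "x \<in> {0<..<1}" for x
      using DERIV_diff[OF V(7)[OF that] U(7)[OF that]] by (simp add: right_diff_distrib)
    show "(?g has_real_derivative ?w x) (at x)" if "x \<in> {0<..<1}" for x
    proof (rule continuous_weak_deriv_imp_C1[OF _ _ _ _ _ that])
      show "has_weak_deriv {0<..<1} ?g ?w"
        using has_weak_deriv_diff[OF V(6) U(6)] by simp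
      show "continuous_on {0<..<1} ?g" by (intro continuous_intros U V)
      show "continuous_on {0<..<1} ?w" by (rule continuous_on_subset[OF cw]) auto
      show "integrable (lebesgue_on {0<..<1}) ?w"
        using Lp_Holder(1)[OF p Lp_diff(1)[OF p V(3) U(3)]] by simp
    qed simp
    show "(?g \<longlongrightarrow> 0) (at_right 0)" using tendsto_diff[OF V(4) U(4)] by simp
  qed (rule x)
  then show ?thesis by simp
qed

section \<open>Estimates for a solution and its flux\<close>

text \<open>Subadditivity of \<open>t\<^sup>c\<close>, from \<open>t\<^sup>c = t t\<^bsup>c-1\<^esup> \<ge> t y\<^bsup>c-1\<^esup>\<close> for \<open>t \<le> y\<close>.\<close>

lemma powr_diff_le_powr:
  fixes x y c :: real
  assumes "0 \<le> x" "x \<le> y" "0 < c" "c \<le> 1"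
  shows "y powr c - x powr c \<le> (y - x) powr c"
proof (cases "x = 0 \<or> y = x")
  case True
  then show ?thesis using assms by auto
next
  case False
  then have xy: "0 < x" "x < y" using assms by auto
  have split: "t powr c \<ge> t * y powr (c - 1)" if t: "0 < t" "t \<le> y" for t
  proof -
    have "t * y powr (c - 1) \<le> t * t powr (c - 1)"
      using t assms by (intro mult_left_mono powr_mono2') auto
    also have "\<dots> = t powr c" using t powr_add[of t 1 "c - 1"] by simp
    finally show ?thesis .
  qed
  have "y powr c = y * y powr (c - 1)" using xy powr_add[of y 1 "c - 1"] by simp
  also have "\<dots> = (y - x) * y powr (c - 1) + x * y powr (c - 1)" by (simp add: algebra_simps)
  also have "\<dots> \<le> (y - x) powr c + x powr c"
    using split[of x] split[of "y - x"] xy by auto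
  finally show ?thesis by simp
qed

text \<open>The bound on the derivative makes \<open>(B / c) x\<^sup>c - u\<close> and \<open>(B / c) x\<^sup>c + u\<close> nondecreasing, so the increments of
  \<open>u\<close> are at most those of \<open>(B / c) x\<^sup>c\<close>.  In particular \<open>u\<close> is uniformly continuous and extends to \<open>0\<close>.\<close>

lemma holder_extension:
  fixes u g :: "real \<Rightarrow> real"
  assumes c: "0 < c" "c \<le> 1" and \<gamma>: "0 < \<gamma>" "\<gamma> \<le> c"
    and cu: "continuous_on {0<..1} u" and u1: "u 1 = 0"
    and du: "\<And>x. x \<in> {0<..<1} \<Longrightarrow> (u has_real_derivative x powr (c - 1) * g x) (at x)"
    and g: "\<And>x. x \<in> {0<..<1} \<Longrightarrow> \<bar>g x\<bar> \<le> B"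
  shows "\<exists>w\<in>holder_space \<gamma> {0..1}. (\<forall>x\<in>{0<..1}. w x = u x) \<and> holder_norm \<gamma> {0..1} w \<le> 2 / c * B"
proof -
  have B0: "0 \<le> B" using g[of "1/2"] by auto
  have ordered: "\<bar>u y - u x\<bar> \<le> B / c * (y - x) powr \<gamma>" if xy: "0 < x" "x \<le> y" "y \<le> 1" for x y
  proof -
    have sgn: "\<sigma> * (u y - u x) \<le> B / c * (y powr c - x powr c)" if \<sigma>: "\<bar>\<sigma>\<bar> = 1" for \<sigma>
    proof -
      have "B / c * x powr c - \<sigma> * u x \<le> B / c * y powr c - \<sigma> * u y"
      proof (rule DERIV_nonneg_imp_increasing_open[OF xy(2)])
        show "continuous_on {x..y} (\<lambda>x. B / c * x powr c - \<sigma> * u x)"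
          using xy by (intro continuous_intros continuous_on_subset[OF cu]) auto
        fix t assume t: "x < t" "t < y"
        then have t': "t \<in> {0<..<1}" using xy by auto
        have "((\<lambda>x. B / c * x powr c - \<sigma> * u x) has_real_derivative
            B / c * (c * t powr (c - 1)) - \<sigma> * (t powr (c - 1) * g t)) (at t)"
          using t' by (intro DERIV_diff DERIV_cmult du has_real_derivative_powr) auto
        also have "B / c * (c * t powr (c - 1)) - \<sigma> * (t powr (c - 1) * g t) = t powr (c - 1) * (B - \<sigma> * g t)"
          using c by (simp add: algebra_simps)
        finally have D: "((\<lambda>x. B / c * x powr c - \<sigma> * u x) has_real_derivative t powr (c - 1) * (B - \<sigma> * g t)) (at t)" .
        have "\<sigma> * g t \<le> \<bar>\<sigma>\<bar> * \<bar>g t\<bar>" using abs_mult[of \<sigma> "g t"] by linarith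
        then have "0 \<le> B - \<sigma> * g t" using g[OF t'] \<sigma> by simp
        then show "\<exists>d. ((\<lambda>x. B / c * x powr c - \<sigma> * u x) has_real_derivative d) (at t) \<and> 0 \<le> d"
          using D by (intro exI[of _ "t powr (c - 1) * (B - \<sigma> * g t)"]) auto
      qed
      then show ?thesis by (simp add: algebra_simps)
    qed
    have "\<bar>u y - u x\<bar> \<le> B / c * (y powr c - x powr c)"
      using sgn[of 1] sgn[of "-1"] by auto
    also have "\<dots> \<le> B / c * (y - x) powr \<gamma>"
    proof (rule mult_left_mono)
      have "y powr c - x powr c \<le> (y - x) powr c"
        using xy c by (intro powr_diff_le_powr) auto
      also have "\<dots> \<le> (y - x) powr \<gamma>"
      proof (cases "x = y")
        case False
        then show ?thesis using xy \<gamma> by (intro powr_mono') auto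
      qed simp
      finally show "y powr c - x powr c \<le> (y - x) powr \<gamma>" .
    qed (use B0 c in auto)
    finally show ?thesis .
  qed
  have hol: "\<bar>u x - u y\<bar> \<le> B / c * \<bar>x - y\<bar> powr \<gamma>" if "x \<in> {0<..1}" "y \<in> {0<..1}" for x y
    using ordered[of x y] ordered[of y x] that by (cases "x \<le> y") (auto simp: abs_minus_commute)
  have "uniformly_continuous_on {0<..1} u"
    unfolding uniformly_continuous_on_def
  proof (intro allI impI)
    fix e :: real assume e: "0 < e"
    define K where "K = B / c + 1"
    have K: "0 < K" "B / c \<le> K" using B0 c by (auto simp: K_def intro: add_nonneg_pos)
    define d where "d = (e / K) powr (1 / \<gamma>)"
    have d: "0 < d" using e K by (simp add: d_def)
    show "\<exists>d>0. \<forall>x\<in>{0<..1}. \<forall>x'\<in>{0<..1}. dist x' x < d \<longrightarrow> dist (u x') (u x) < e"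
    proof (intro exI[of _ d] conjI d ballI impI)
      fix x x' :: real assume x: "x \<in> {0<..1}" "x' \<in> {0<..1}" and "dist x' x < d"
      then have "\<bar>x' - x\<bar> powr \<gamma> < d powr \<gamma>" using \<gamma> by (intro powr_less_mono2) (auto simp: dist_real_def)
      also have "d powr \<gamma> = e / K" using \<gamma> e K by (simp add: d_def powr_powr)
      finally have "K * \<bar>x' - x\<bar> powr \<gamma> < e" using K by (simp add: field_simps)
      moreover have "\<bar>u x' - u x\<bar> \<le> K * \<bar>x' - x\<bar> powr \<gamma>"
        using hol[OF x(2,1)] K(2) by (meson mult_right_mono order_trans powr_ge_zero)
      ultimately show "dist (u x') (u x) < e" by (simp add: dist_real_def)
    qed
  qed
  then obtain w where w: "uniformly_continuous_on (closure {0<..1}) w" "\<And>x. x \<in> {0<..1} \<Longrightarrow> u x = w x"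
    by (rule uniformly_continuous_on_extension_on_closure) blast
  have "closure {0<..1::real} = {0..1}" by (simp add: closure_greaterThanAtMost)
  then have cw: "continuous_on {0..1} w" using w(1) by (simp add: uniformly_continuous_imp_continuous)
  have at0: "\<bar>w y - w 0\<bar> \<le> B / c * \<bar>y - 0\<bar> powr \<gamma>" if y: "y \<in> {0<..1}" for y
  proof -
    have "(w \<longlongrightarrow> w 0) (at 0 within {0..1})" using cw by (auto simp: continuous_on_def)
    then have wl: "(w \<longlongrightarrow> w 0) (at_right 0)" by (simp add: at_within_Icc_at_right)
    have l1: "((\<lambda>x. B / c * \<bar>y - x\<bar> powr \<gamma>) \<longlongrightarrow> B / c * \<bar>y - 0\<bar> powr \<gamma>) (at_right 0)"
      using y by (intro tendsto_intros) auto
    have l2: "((\<lambda>x. \<bar>w y - w x\<bar>) \<longlongrightarrow> \<bar>w y - w 0\<bar>) (at_right 0)" by (intro tendsto_intros wl)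
    show ?thesis
    proof (rule tendsto_le[OF _ l1 l2])
      show "\<forall>\<^sub>F x in at_right 0. \<bar>w y - w x\<bar> \<le> B / c * \<bar>y - x\<bar> powr \<gamma>"
        by (rule eventually_at_rightI[of 0 1]) (use hol y w(2) in auto)
    qed simp
  qed
  have holw: "\<bar>w x - w y\<bar> \<le> B / c * \<bar>x - y\<bar> powr \<gamma>" if "x \<in> {0..1}" "y \<in> {0..1}" for x y
  proof (cases "x = 0 \<or> y = 0")
    case True
    then show ?thesis using at0[of x] at0[of y] that by (cases "x = y") (auto simp: abs_minus_commute)
  next
    case False
    then show ?thesis using hol[of x y] w(2)[of x] w(2)[of y] that by auto
  qed
  have sup: "\<bar>w x\<bar> \<le> B / c" if "x \<in> {0..1}" for x
  proof -
    have "w 1 = 0" using u1 w(2)[of 1] by simp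
    then have "\<bar>w x\<bar> \<le> B / c * \<bar>x - 1\<bar> powr \<gamma>" using holw[of x 1] that by simp
    also have "\<dots> \<le> B / c * 1" using that B0 c \<gamma> by (intro mult_left_mono powr_le1) auto
    finally show ?thesis by simp
  qed
  have quot: "q \<le> B / c" if mem: "q \<in> holder_quotients \<gamma> {0..1} w" for q
  proof -
    obtain x y where q: "q = \<bar>w x - w y\<bar> / \<bar>x - y\<bar> powr \<gamma>" "x \<in> {0..1}" "y \<in> {0..1}" "x \<noteq> y"
      using mem unfolding holder_quotients_def by blast
    then show ?thesis using holw[of x y] by (simp add: divide_le_eq)
  qed
  have ne: "holder_quotients \<gamma> {0..1} w \<noteq> {}"
  proof -
    have "\<bar>w 0 - w 1\<bar> / \<bar>0 - 1\<bar> powr \<gamma> \<in> holder_quotients \<gamma> {0..1} w"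
      unfolding holder_quotients_def by (intro CollectI exI[of _ 0] exI[of _ 1]) auto
    then show ?thesis by blast
  qed
  show ?thesis
  proof (intro bexI[of _ w] conjI)
    show "w \<in> holder_space \<gamma> {0..1}"
      unfolding holder_space_def using sup quot by (auto intro!: bdd_aboveI2[of _ _ "B / c"] bdd_aboveI[of _ "B / c"])
    show "\<forall>x\<in>{0<..1}. w x = u x" using w(2) by simp
    have "(SUP x\<in>{0..1}. \<bar>w x\<bar>) \<le> B / c" using sup by (intro cSUP_least) auto
    moreover have "Sup (holder_quotients \<gamma> {0..1} w) \<le> B / c" using ne quot by (intro cSup_least) auto
    ultimately show "holder_norm \<gamma> {0..1} w \<le> 2 / c * B" unfolding holder_norm_def by simp
  qed
qed

text \<open>Both sides have the same weak derivative and the same limit at \<open>0\<close>.\<close>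

lemma flux_eq_integral:
  assumes wd: "has_weak_deriv {0<..<1} g w" and wi: "integrable (lebesgue_on {0<..<1}) w"
    and cg: "continuous_on {0<..<1} g" and g0: "(g \<longlongrightarrow> 0) (at_right 0)" and x: "x \<in> {0<..<1}"
  shows "g x = integral {0..x} w"
proof -
  note G = continuous_indefinite_LINT[OF wi]
  define P where "P x = integral {0..x} w" for x
  have cP: "continuous_on {0<..<1} P"
    unfolding P_def by (rule continuous_on_subset[OF G(1)]) auto
  have "has_weak_deriv {0<..<1} P w"
    unfolding P_def by (rule has_weak_deriv_indefinite[OF wi]) simp
  then obtain k where k: "\<And>x. x \<in> {0<..<1} \<Longrightarrow> g x = P x + k"
    using same_weak_deriv_differ_by_const[OF _ wd _ cg cP] by (metis zero_less_one)
  have "(P \<longlongrightarrow> 0) (at_right 0)"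
    unfolding P_def by (rule indefinite_integral_tendsto_zero[OF wi])
  then have "((\<lambda>x. g x - P x) \<longlongrightarrow> 0 - 0) (at_right 0)" by (intro tendsto_diff g0)
  moreover have "((\<lambda>x. g x - P x) \<longlongrightarrow> k) (at_right 0)"
  proof (rule tendsto_eventually)
    show "\<forall>\<^sub>F x in at_right 0. g x - P x = k"
      by (rule eventually_at_rightI[of 0 1]) (use k in auto)
  qed
  ultimately have "k = 0" using tendsto_unique[of "at_right (0::real)"] by fastforce
  then show ?thesis using k[OF x] by (simp add: P_def)
qed

locale neumann_pair = flux_pair +
  fixes p :: ennreal
  assumes p: "1 \<le> p" and f: "f \<in> Lp_space p {0<..<1}" and u: "u \<in> Lp_space p {0<..<1}"
begin

abbreviation I :: "real set" where "I \<equiv> {0<..<1}"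

abbreviation w :: "real \<Rightarrow> real" where "w \<equiv> \<lambda>x. u x - f x"

abbreviation W :: real where "W \<equiv> Lp_norm p I w"

lemma w_Lp: "w \<in> Lp_space p I"
  by (rule Lp_diff(1)[OF p u f])

lemma w_integrable: "integrable (lebesgue_on I) w"
  by (rule Lp_Holder(1)[OF p w_Lp]) simp

lemma deriv_u: "x \<in> I \<Longrightarrow> deriv u x = x powr (- 2 * \<alpha>) * g x"
  by (rule DERIV_imp_deriv[OF du])

lemma flux_u: "x \<in> I \<Longrightarrow> flux \<alpha> u x = g x"
  by (simp add: flux_def deriv_u flip: powr_add mult.assoc)

text \<open>The source of all bounds for the size of the flux.\<close>

lemma g_le_integral:
  assumes x: "x \<in> I"
  shows "\<bar>g x\<bar> \<le> integral {0..x} (\<lambda>t. \<bar>w t\<bar>)"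
proof -
  have a: "integrable (lebesgue_on I) (\<lambda>t. \<bar>w t\<bar>)" using w_integrable by simp
  have "g x = (LINT t|lebesgue_on {0<..<x}. w t)"
    using flux_eq_integral[OF wd w_integrable cg g0 x] continuous_indefinite_LINT(2)[OF w_integrable, of x] x by simp
  then have "\<bar>g x\<bar> \<le> (LINT t|lebesgue_on {0<..<x}. \<bar>w t\<bar>)" by simp
  then show ?thesis using continuous_indefinite_LINT(2)[OF a, of x] x by simp
qed

lemma g_Holder:
  assumes x: "x \<in> I"
  shows "\<bar>g x\<bar> \<le> x powr (1 - enn2real (1 / p)) * Lp_norm p {0<..<x} w"
proof -
  have a: "integrable (lebesgue_on I) (\<lambda>t. \<bar>w t\<bar>)" using w_integrable by simp
  have "w \<in> Lp_space p {0<..<x}" using x by (intro Lp_subset(1)[OF p w_Lp]) auto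
  then have "(LINT t|lebesgue_on {0<..<x}. \<bar>w t\<bar>) \<le> x powr (1 - enn2real (1 / p)) * Lp_norm p {0<..<x} w"
    using x by (intro Lp_Holder(2)[OF p]) auto
  then show ?thesis using g_le_integral[OF x] continuous_indefinite_LINT(2)[OF a, of x] x by simp
qed

lemma theta_le_1: "enn2real (1 / p) \<le> 1"
  by (cases rule: exponent_cases[OF p]) auto

lemma g_bound:
  assumes x: "x \<in> I"
  shows "\<bar>g x\<bar> \<le> W"
proof -
  have "Lp_norm p {0<..<x} w \<le> W" using x by (intro Lp_subset(2)[OF p w_Lp]) auto
  moreover have "x powr (1 - enn2real (1 / p)) \<le> 1" using x theta_le_1 by (intro powr_le1) auto
  ultimately have "x powr (1 - enn2real (1 / p)) * Lp_norm p {0<..<x} w \<le> 1 * W"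
    by (intro mult_mono) (auto simp: Lp_norm_nonneg)
  then show ?thesis using g_Holder[OF x] by linarith
qed

lemma g_measurable: "g \<in> borel_measurable (lebesgue_on I)"
  by (intro continuous_imp_measurable_on_sets_lebesgue cg) auto

text \<open>On \<open>(0, 1)\<close> the function \<open>x powr - 0\<close> is the constant \<open>1\<close>; this form makes it an instance of
  \<open>Lp_powr\<close>.\<close>

lemma Lp_of_bounded_multiple:
  assumes "h \<in> borel_measurable (lebesgue_on I)" "\<And>x. x \<in> I \<Longrightarrow> \<bar>h x\<bar> \<le> W"
  shows "h \<in> Lp_space p I" "Lp_norm p I h \<le> W * Lp_norm p I (\<lambda>x. x powr - 0)"
proof -
  have one: "(\<lambda>x. x powr - 0) \<in> Lp_space p I" by (rule Lp_powr[OF p]) simp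
  have "AE x in lebesgue_on I. \<bar>h x\<bar> \<le> W * \<bar>x powr - 0\<bar>"
    using assms(2) by (intro AE_I2) simp
  from Lp_dominated[OF p one assms(1) this Lp_norm_nonneg]
  show "h \<in> Lp_space p I" "Lp_norm p I h \<le> W * Lp_norm p I (\<lambda>x. x powr - 0)" by auto
qed

lemma g_Lp: "g \<in> Lp_space p I" "Lp_norm p I g \<le> W * Lp_norm p I (\<lambda>x. x powr - 0)"
  by (rule Lp_of_bounded_multiple[OF g_measurable g_bound]; assumption)+

lemma flux_AE: "AE x in lebesgue_on I. g x = flux \<alpha> u x"
  by (intro AE_I2) (simp add: flux_u)

lemma has_weak_deriv_flux: "has_weak_deriv I (flux \<alpha> u) w"
  by (rule has_weak_deriv_cong_AE[OF wd _ flux_AE]) auto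

lemma weak_deriv_flux: "AE x in lebesgue_on I. weak_deriv I (flux \<alpha> u) x = w x"
  by (rule weak_deriv_AE_eq(1)[OF _ has_weak_deriv_flux]) simp

lemma flux_sobolev: "flux \<alpha> u \<in> sobolev 1 p I"
  using Lp_cong_AE(1)[OF p g_Lp(1) _ flux_AE] has_weak_deriv_flux w_Lp by auto

lemma flux_sobolev_norm:
  "sobolev_norm 1 p I (flux \<alpha> u) \<le> (Lp_norm p I (\<lambda>x. x powr - 0) + 1) * W"
proof -
  have "Lp_norm p I (flux \<alpha> u) \<le> W * Lp_norm p I (\<lambda>x. x powr - 0)"
    using Lp_cong_AE(2)[OF p g_Lp(1) _ flux_AE] g_Lp(2) by simp
  moreover have "AE x in lebesgue_on I. w x = weak_deriv I (flux \<alpha> u) x"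
    using weak_deriv_flux by eventually_elim simp
  then have "Lp_norm p I (weak_deriv I (flux \<alpha> u)) \<le> W"
    by (intro Lp_cong_AE(2)[OF p w_Lp]) auto
  ultimately show ?thesis by (simp add: algebra_simps)
qed

lemma flux_tendsto: "(flux \<alpha> u \<longlongrightarrow> 0) (at_right 0)"
proof (rule Lim_transform_eventually[OF g0])
  show "\<forall>\<^sub>F x in at_right 0. g x = flux \<alpha> u x"
    by (rule eventually_at_rightI[of 0 1]) (auto simp: flux_u)
qed

text \<open>The product rule applied to \<open>u' = g x\<^bsup>-2\<alpha>\<^esup>\<close>.\<close>

definition u'' :: "real \<Rightarrow> real" where
  "u'' x = w x * x powr (- 2 * \<alpha>) + g x * (- 2 * \<alpha> * x powr (- 2 * \<alpha> - 1))"

lemma has_weak_deriv_deriv: "has_weak_deriv I (deriv u) u''"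
proof -
  have "has_weak_deriv I (\<lambda>x. g x * x powr (- 2 * \<alpha>)) u''"
    unfolding u''_def
  proof (rule has_weak_deriv_mult[OF wd])
    show "((\<lambda>x. x powr (- 2 * \<alpha>)) has_real_derivative - 2 * \<alpha> * x powr (- 2 * \<alpha> - 1)) (at x)" if "x \<in> I" for x
      using that by (intro has_real_derivative_powr) auto
    show "continuous_on I (\<lambda>x. - 2 * \<alpha> * x powr (- 2 * \<alpha> - 1))"
      by (intro continuous_intros) auto
  qed simp
  then show ?thesis
    by (rule has_weak_deriv_cong_AE) (auto intro!: AE_I2 simp: deriv_u)
qed

lemma weak_deriv_deriv: "AE x in lebesgue_on I. weak_deriv I (deriv u) x = u'' x"
  by (rule weak_deriv_AE_eq(1)[OF _ has_weak_deriv_deriv]) simp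

lemma has_weak_deriv_u: "has_weak_deriv I u (deriv u)"
proof (rule has_weak_deriv_C1)
  show "(u has_real_derivative deriv u x) (at x)" if "x \<in> I" for x
    using du[OF that] deriv_u[OF that] by simp
  show "continuous_on I (deriv u)"
  proof (rule continuous_on_eq)
    show "continuous_on I (\<lambda>x. x powr (- 2 * \<alpha>) * g x)" by (intro continuous_intros cg) auto
  qed (simp add: deriv_u)
qed simp

lemma Lp_mult_powr:
  assumes h: "h \<in> Lp_space p I" and \<delta>: "\<delta> \<in> I"
  shows "(\<lambda>x. h x * x powr c) \<in> Lp_space p {\<delta><..<1}"
proof -
  have h': "h \<in> Lp_space p {\<delta><..<1}" using \<delta> by (intro Lp_subset(1)[OF p h]) auto
  have [measurable]: "h \<in> borel_measurable (lebesgue_on {\<delta><..<1})" using h' by (rule Lp_space_measurable)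
  have [measurable]: "(\<lambda>x. x powr c) \<in> borel_measurable (lebesgue_on {\<delta><..<1})"
    using \<delta> by (intro continuous_imp_measurable_on_sets_lebesgue continuous_intros) auto
  have le: "x powr c \<le> 1 + \<delta> powr c" if "x \<in> {\<delta><..<1}" for x
  proof (cases "0 \<le> c")
    case True
    then have "x powr c \<le> 1" using that \<delta> by (intro powr_le1) auto
    then show ?thesis using powr_ge_zero[of \<delta> c] by linarith
  next
    case False
    then have "x powr c \<le> \<delta> powr c" using that \<delta> by (intro powr_mono2') auto
    then show ?thesis by linarith
  qed
  show ?thesis
  proof (rule Lp_dominated(1)[OF p h'])
    show "AE x in lebesgue_on {\<delta><..<1}. \<bar>h x * x powr c\<bar> \<le> (1 + \<delta> powr c) * \<bar>h x\<bar>"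
      using le by (intro AE_I2) (auto simp: abs_mult mult.commute intro!: mult_left_mono)
    show "0 \<le> 1 + \<delta> powr c" using powr_ge_zero[of \<delta> c] by linarith
  qed measurable
qed

lemma u_W2p_loc: "u \<in> W2p_loc p"
  unfolding W2p_loc_def
proof (intro CollectI ballI)
  fix \<delta> :: real assume \<delta>: "\<delta> \<in> I"
  have 0: "u \<in> Lp_space p {\<delta><..<1}" using \<delta> by (intro Lp_subset(1)[OF p u]) auto
  have w1: "has_weak_deriv {\<delta><..<1} u (deriv u)" and w2: "has_weak_deriv {\<delta><..<1} (deriv u) u''"
    using \<delta> by (auto intro!: has_weak_deriv_subset[OF has_weak_deriv_u] has_weak_deriv_subset[OF has_weak_deriv_deriv])
  have "(\<lambda>x. g x * x powr (- 2 * \<alpha>)) \<in> Lp_space p {\<delta><..<1}"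
    by (rule Lp_mult_powr[OF g_Lp(1) \<delta>])
  then have 1: "deriv u \<in> Lp_space p {\<delta><..<1}"
    by (rule Lp_cong_AE(1)[OF p]) (use \<delta> in \<open>auto intro!: AE_I2 simp: deriv_u\<close>)
  have a: "(\<lambda>x. w x * x powr (- 2 * \<alpha>)) \<in> Lp_space p {\<delta><..<1}"
    by (rule Lp_mult_powr[OF w_Lp \<delta>])
  have g': "(\<lambda>x. - 2 * \<alpha> * g x) \<in> Lp_space p I"
    by (rule Lp_dominated(1)[OF p g_Lp(1), of _ "\<bar>2 * \<alpha>\<bar>"]) (use g_measurable in \<open>auto simp: abs_mult\<close>)
  have "(\<lambda>x. - 2 * \<alpha> * g x * x powr (- 2 * \<alpha> - 1)) \<in> Lp_space p {\<delta><..<1}"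
    by (rule Lp_mult_powr[OF g' \<delta>])
  from Lp_add(1)[OF p a this] have 2: "u'' \<in> Lp_space p {\<delta><..<1}"
    unfolding u''_def[abs_def] by (simp add: mult_ac)
  show "u \<in> sobolev 2 p {\<delta><..<1}"
    using 0 1 2 w1 w2 by (auto simp: numeral_2_eq_2)
qed

lemma solves: "solves_problem \<alpha> p f u"
  unfolding solves_problem_def
proof (intro conjI u_W2p_loc cu u1)
  have "AE x in lebesgue. x \<in> I \<longrightarrow> weak_deriv I (flux \<alpha> u) x = w x"
    using weak_deriv_flux by (simp add: AE_restrict_space_iff)
  moreover have "AE x in lebesgue. x \<noteq> (1::real)"
    by (rule AE_completion) (rule AE_lborel_singleton)
  ultimately show "AE x in lebesgue. x \<in> {0<..1} \<longrightarrow> - weak_deriv I (flux \<alpha> u) x + u x = f x"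
    by eventually_elim auto
qed

text \<open>Absolute continuity of the integral of \<open>\<bar>w\<bar>\<^sup>p\<close>; for \<open>p = \<infinity>\<close> the norm over a shrinking interval
  need not tend to \<open>0\<close>.\<close>

lemma Lp_norm_shrinking_tendsto:
  assumes "p < \<infinity>"
  shows "((\<lambda>x. Lp_norm p {0<..<x} w) \<longlongrightarrow> 0) (at_right 0)"
proof (cases rule: exponent_cases[OF p])
  case 1
  then show ?thesis using assms by simp
next
  case (2 r)
  have i: "integrable (lebesgue_on I) (\<lambda>x. \<bar>w x\<bar> powr r)"
    using w_Lp 2 by (simp add: Lp_space_finite)
  note P = continuous_indefinite_LINT[OF i]
  have "((\<lambda>x. integral {0..x} (\<lambda>x. \<bar>w x\<bar> powr r)) \<longlongrightarrow> 0) (at_right 0)"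
    by (rule indefinite_integral_tendsto_zero[OF i])
  then have "((\<lambda>x. integral {0..x} (\<lambda>x. \<bar>w x\<bar> powr r) powr (1 / r)) \<longlongrightarrow> 0) (at_right 0)"
  proof (rule tendsto_zero_powrI)
    show "\<forall>\<^sub>F x in at_right 0. 0 \<le> integral {0..x} (\<lambda>x. \<bar>w x\<bar> powr r)"
      by (rule eventually_at_rightI[of 0 1]) (use P(2) in auto)
  qed (use 2 in \<open>auto intro!: tendsto_const\<close>)
  then show ?thesis
  proof (rule Lim_transform_eventually)
    show "\<forall>\<^sub>F x in at_right 0. integral {0..x} (\<lambda>x. \<bar>w x\<bar> powr r) powr (1 / r) = Lp_norm p {0<..<x} w"
      by (rule eventually_at_rightI[of 0 1]) (use P(2) 2 in \<open>auto simp: Lp_space_finite\<close>)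
  qed
qed

lemma weighted_deriv_tendsto:
  assumes "p < \<infinity>"
  shows "((\<lambda>x. x powr (2 * \<alpha> - 1 + enn2real (1 / p)) * deriv u x) \<longlongrightarrow> 0) (at_right 0)"
proof (rule Lim_null_comparison[OF _ Lp_norm_shrinking_tendsto[OF assms]])
  show "\<forall>\<^sub>F x in at_right 0. norm (x powr (2 * \<alpha> - 1 + enn2real (1 / p)) * deriv u x) \<le> Lp_norm p {0<..<x} w"
  proof (rule eventually_at_rightI[of 0 1])
    fix x :: real assume x: "x \<in> I"
    let ?\<theta> = "enn2real (1 / p)"
    have "x powr (2 * \<alpha> - 1 + ?\<theta>) * deriv u x = (x powr (2 * \<alpha> - 1 + ?\<theta>) * x powr (- 2 * \<alpha>)) * g x"
      by (simp add: deriv_u[OF x])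
    also have "x powr (2 * \<alpha> - 1 + ?\<theta>) * x powr (- 2 * \<alpha>) = x powr (?\<theta> - 1)"
      by (simp flip: powr_add)
    finally have "norm (x powr (2 * \<alpha> - 1 + ?\<theta>) * deriv u x) = x powr (?\<theta> - 1) * \<bar>g x\<bar>"
      by (simp add: abs_mult)
    also have "\<dots> \<le> x powr (?\<theta> - 1) * (x powr (1 - ?\<theta>) * Lp_norm p {0<..<x} w)"
      by (intro mult_left_mono g_Holder x) auto
    also have "\<dots> = Lp_norm p {0<..<x} w"
      using x by (simp flip: powr_add mult.assoc)
    finally show "norm (x powr (2 * \<alpha> - 1 + ?\<theta>) * deriv u x) \<le> Lp_norm p {0<..<x} w" .
  qed simp
qed

abbreviation scaled_deriv :: "real \<Rightarrow> real" where
  "scaled_deriv \<equiv> \<lambda>x. x powr (2 * \<alpha> - 1) * deriv u x"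

abbreviation scaled_deriv2 :: "real \<Rightarrow> real" where
  "scaled_deriv2 \<equiv> \<lambda>x. x powr (2 * \<alpha>) * weak_deriv I (deriv u) x"

text \<open>Here \<open>x\<^bsup>2\<alpha>-1\<^esup> u' = g / x\<close> is dominated by the average of \<open>\<bar>w\<bar>\<close> over \<open>(0, x)\<close>, and
  \<open>x\<^bsup>2\<alpha>\<^esup> u'' = w - 2 \<alpha> g / x\<close>.\<close>

lemma Hardy_bounds:
  assumes K: "0 < K" "\<And>h. h \<in> Lp_space p I \<Longrightarrow>
    mean_abs h \<in> Lp_space p I \<and>
    Lp_norm p I (mean_abs h) \<le> K * Lp_norm p I h"
  shows "scaled_deriv \<in> Lp_space p I"
    "Lp_norm p I scaled_deriv \<le> K * W"
    "scaled_deriv2 \<in> Lp_space p I"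
    "Lp_norm p I scaled_deriv2 \<le> 2 * (1 + \<bar>2 * \<alpha>\<bar> * K) * W"
proof -
  have eq: "scaled_deriv x = g x / x" if x: "x \<in> I" for x
  proof -
    have "x powr (2 * \<alpha> - 1) * x powr (- 2 * \<alpha>) = x powr (2 * \<alpha> - 1 + - 2 * \<alpha>)"
      by (rule powr_add[symmetric])
    also have "\<dots> = 1 / x" using x by (simp add: powr_minus divide_inverse)
    finally have "x powr (2 * \<alpha> - 1) * x powr (- 2 * \<alpha>) = 1 / x" .
    then show ?thesis by (simp add: deriv_u[OF x] flip: mult.assoc)
  qed
  have dm: "scaled_deriv \<in> borel_measurable (lebesgue_on I)"
  proof (intro continuous_imp_measurable_on_sets_lebesgue)
    show "continuous_on I scaled_deriv"
    proof (rule continuous_on_eq)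
      show "continuous_on I (\<lambda>x. g x / x)" by (intro continuous_intros cg) auto
    qed (simp only: eq)
  qed auto
  note H = K(2)[OF w_Lp]
  have "AE x in lebesgue_on I. \<bar>scaled_deriv x\<bar> \<le> 1 * \<bar>mean_abs w x\<bar>"
  proof (rule AE_I2)
    fix x :: real assume "x \<in> space (lebesgue_on I)"
    then have x: "x \<in> I" by simp
    have "\<bar>scaled_deriv x\<bar> = \<bar>g x\<bar> / x" using eq[OF x] x by simp
    also have "\<dots> \<le> mean_abs w x"
      using g_le_integral[OF x] x by (intro divide_right_mono) auto
    finally show "\<bar>scaled_deriv x\<bar> \<le> 1 * \<bar>mean_abs w x\<bar>" by linarith
  qed
  note D = Lp_dominated[OF p conjunct1[OF H] dm this zero_le_one]
  show d1: "scaled_deriv \<in> Lp_space p I" by (rule D)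
  show d2: "Lp_norm p I scaled_deriv \<le> K * W" using D(2) H by linarith
  have m: "(\<lambda>x. - (2 * \<alpha>) * scaled_deriv x) \<in> borel_measurable (lebesgue_on I)" using dm by simp
  have ae: "AE x in lebesgue_on I. \<bar>- (2 * \<alpha>) * scaled_deriv x\<bar> \<le> \<bar>2 * \<alpha>\<bar> * \<bar>scaled_deriv x\<bar>"
    by (intro AE_I2) (simp add: abs_mult)
  note E = Lp_dominated[OF p d1 m ae abs_ge_zero]
  note S = Lp_add[OF p w_Lp E(1)]
  have aeq: "AE x in lebesgue_on I. w x + - (2 * \<alpha>) * scaled_deriv x = x powr (2 * \<alpha>) * weak_deriv I (deriv u) x"
    using weak_deriv_deriv AE_space
  proof eventually_elim
    case (elim x)
    then have x: "x \<in> I" by simp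
    have 1: "x powr (2 * \<alpha>) * x powr (- 2 * \<alpha>) = 1" using x by (simp flip: powr_add)
    have "x powr (2 * \<alpha>) * x powr (- 2 * \<alpha> - 1) = x powr (2 * \<alpha> + (- 2 * \<alpha> - 1))"
      by (rule powr_add[symmetric])
    also have "\<dots> = 1 / x" using x by (simp add: powr_minus divide_inverse)
    finally have 2: "x powr (2 * \<alpha>) * x powr (- 2 * \<alpha> - 1) = 1 / x" .
    have "x powr (2 * \<alpha>) * u'' x = w x * (x powr (2 * \<alpha>) * x powr (- 2 * \<alpha>)) - 2 * \<alpha> * g x * (x powr (2 * \<alpha>) * x powr (- 2 * \<alpha> - 1))"
      unfolding u''_def by (simp only: distrib_left diff_conv_add_uminus mult_minus_left mult_minus_right mult_ac)
    also have "\<dots> = w x - 2 * \<alpha> * (g x / x)" unfolding 1 2 by simp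
    finally show ?case using elim eq[OF x] by simp
  qed
  show "scaled_deriv2 \<in> Lp_space p I"
    by (rule Lp_cong_AE(1)[OF p S(1) _ aeq]) simp
  have "Lp_norm p I scaled_deriv2 \<le> Lp_norm p I (\<lambda>x. w x + - (2 * \<alpha>) * scaled_deriv x)"
    by (rule Lp_cong_AE(2)[OF p S(1) _ aeq]) simp
  also have "\<dots> \<le> 2 * (W + \<bar>2 * \<alpha>\<bar> * Lp_norm p I scaled_deriv)"
    by (rule order_trans[OF S(2)]) (intro mult_left_mono add_left_mono E(2), simp)
  also have "\<dots> \<le> 2 * (W + \<bar>2 * \<alpha>\<bar> * (K * W))" using d2 by (intro mult_left_mono add_left_mono) auto
  finally show "Lp_norm p I scaled_deriv2 \<le> 2 * (1 + \<bar>2 * \<alpha>\<bar> * K) * W"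
    by (simp add: algebra_simps)
qed

lemma properties: "neumann_properties \<alpha> p u"
proof -
  have "scaled_deriv \<in> Lp_space p I \<and>
        scaled_deriv2 \<in> Lp_space p I" if p1: "1 < p"
  proof -
    obtain K where "0 < K" "\<And>h. h \<in> Lp_space p I \<Longrightarrow>
      mean_abs h \<in> Lp_space p I \<and>
      Lp_norm p I (mean_abs h) \<le> K * Lp_norm p I h"
      using Hardy_inequality[OF p1] by blast
    from Hardy_bounds(1,3)[OF this] show ?thesis by simp
  qed
  then show ?thesis
    unfolding neumann_properties_def using u flux_tendsto weighted_deriv_tendsto flux_sobolev by blast
qed

lemma holder_bound:
  assumes "0 < \<alpha>" "\<alpha> < 1 / 2"
  shows "\<exists>v\<in>holder_space (1 / 2 - \<alpha>) {0..1}. (\<forall>x\<in>{0<..1}. v x = u x) \<and>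
    holder_norm (1 / 2 - \<alpha>) {0..1} v \<le> 2 / (1 - 2 * \<alpha>) * W"
proof (rule holder_extension[OF _ _ _ _ cu u1 _ g_bound])
  show "(u has_real_derivative x powr (1 - 2 * \<alpha> - 1) * g x) (at x)" if "x \<in> I" for x
    using du[OF that] by simp
qed (use assms in auto)

lemma sobolev_bound:
  assumes "\<alpha> \<le> 0"
  shows "u \<in> sobolev 1 p I"
    "sobolev_norm 1 p I u \<le> Lp_norm p I u + W * Lp_norm p I (\<lambda>x. x powr - 0)"
proof -
  have b: "\<bar>deriv u x\<bar> \<le> W" if x: "x \<in> I" for x
  proof -
    have "x powr (- 2 * \<alpha>) \<le> 1" using x assms by (intro powr_le1) auto
    then have "x powr (- 2 * \<alpha>) * \<bar>g x\<bar> \<le> 1 * W"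
      using g_bound[OF x] by (intro mult_mono) auto
    then show ?thesis by (simp add: deriv_u[OF x] abs_mult)
  qed
  have m: "deriv u \<in> borel_measurable (lebesgue_on I)"
  proof (intro continuous_imp_measurable_on_sets_lebesgue)
    show "continuous_on I (deriv u)"
    proof (rule continuous_on_eq)
      show "continuous_on I (\<lambda>x. x powr (- 2 * \<alpha>) * g x)" by (intro continuous_intros cg) auto
    qed (simp add: deriv_u)
  qed auto
  note D = Lp_of_bounded_multiple[OF m b]
  have D1: "deriv u \<in> Lp_space p I" by (rule D(1))
  have ae: "AE x in lebesgue_on I. deriv u x = weak_deriv I u x"
    using weak_deriv_AE_eq(1)[OF zero_less_one has_weak_deriv_u] by eventually_elim simp
  show "u \<in> sobolev 1 p I" using u has_weak_deriv_u D1 by auto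
  have "Lp_norm p I (weak_deriv I u) \<le> W * Lp_norm p I (\<lambda>x. x powr - 0)"
    using Lp_cong_AE(2)[OF p D1 _ ae] D(2) by simp
  then show "sobolev_norm 1 p I u \<le> Lp_norm p I u + W * Lp_norm p I (\<lambda>x. x powr - 0)"
    by simp
qed

end

section \<open>The Neumann problem\<close>

lemma neumann_pair_exists:
  assumes \<alpha>: "\<alpha> < 1" and p: "1 \<le> p"
  obtains K where "0 < K" "\<And>f. f \<in> Lp_space p {0<..<1} \<Longrightarrow>
    \<exists>u g. neumann_pair \<alpha> f u g p \<and> Lp_norm p {0<..<1} u \<le> K * Lp_norm p {0<..<1} f"
proof -
  obtain M where M: "0 \<le> M" and sol: "\<And>f. integrable (lebesgue_on {0<..<1}) f \<Longrightarrow>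
    \<exists>u g. flux_pair \<alpha> f u g \<and> (\<forall>x\<in>{0<..<1}. \<bar>u x\<bar> \<le> M * iterated_integral \<alpha> f x)"
    using neumann_solution_formula[OF \<alpha>] by blast
  obtain K where K: "0 < K" and bound: "\<And>f u. f \<in> Lp_space p {0<..<1} \<Longrightarrow> u \<in> borel_measurable (lebesgue_on {0<..<1}) \<Longrightarrow>
    (\<And>x. x \<in> {0<..<1} \<Longrightarrow> \<bar>u x\<bar> \<le> M * iterated_integral \<alpha> f x) \<Longrightarrow>
    u \<in> Lp_space p {0<..<1} \<and> Lp_norm p {0<..<1} u \<le> K * Lp_norm p {0<..<1} f"
    using iterated_integral_Lp_bound[OF \<alpha> p M] by blast
  show ?thesis
  proof (rule that[OF K])
    fix f :: "real \<Rightarrow> real" assume f: "f \<in> Lp_space p {0<..<1}"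
    have "integrable (lebesgue_on {0<..<1}) f" by (rule Lp_Holder(1)[OF p f]) simp
    from sol[OF this] obtain u g where ug: "flux_pair \<alpha> f u g"
      and le: "\<forall>x\<in>{0<..<1}. \<bar>u x\<bar> \<le> M * iterated_integral \<alpha> f x"
      by blast
    interpret flux_pair \<alpha> f u g by (rule ug)
    have um: "u \<in> borel_measurable (lebesgue_on {0<..<1})"
      by (intro continuous_imp_measurable_on_sets_lebesgue continuous_on_subset[OF cu]) auto
    have ub: "u \<in> Lp_space p {0<..<1} \<and> Lp_norm p {0<..<1} u \<le> K * Lp_norm p {0<..<1} f"
      by (rule bound[OF f um]) (use le in blast)
    have "neumann_pair \<alpha> f u g p"
      by unfold_locales (use p f ub in auto)
    with ub show "\<exists>u g. neumann_pair \<alpha> f u g p \<and> Lp_norm p {0<..<1} u \<le> K * Lp_norm p {0<..<1} f" by blast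
  qed
qed

theorem theorem1p2:
  fixes \<alpha> :: real and p :: ennreal
  assumes "\<alpha> < 1" and "1 \<le> p"
  shows "\<exists>C>0. \<forall>f\<in>Lp_space p {0<..<1}. \<exists>u.
     solves_problem \<alpha> p f u \<and> neumann_properties \<alpha> p u \<and>
     (\<forall>v. solves_problem \<alpha> p f v \<and> neumann_properties \<alpha> p v \<longrightarrow> (\<forall>x\<in>{0<..1}. v x = u x)) \<and>
     Lp_norm p {0<..<1} u \<le> C * Lp_norm p {0<..<1} f \<and>
     sobolev_norm 1 p {0<..<1} (flux \<alpha> u) \<le> C * Lp_norm p {0<..<1} f \<and>
     (p > 1 \<longrightarrow>
        Lp_norm p {0<..<1} (\<lambda>x. x powr (2 * \<alpha> - 1) * deriv u x)
        + Lp_norm p {0<..<1} (\<lambda>x. x powr (2 * \<alpha>) * weak_deriv {0<..<1} (deriv u) x)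
        \<le> C * Lp_norm p {0<..<1} f) \<and>
     (0 < \<alpha> \<and> \<alpha> < 1 / 2 \<longrightarrow>
        (\<exists>w\<in>holder_space (1 / 2 - \<alpha>) {0..1}.
           (\<forall>x\<in>{0<..1}. w x = u x) \<and>
           holder_norm (1 / 2 - \<alpha>) {0..1} w \<le> C * Lp_norm p {0<..<1} f)) \<and>
     (\<alpha> \<le> 0 \<longrightarrow>
        u \<in> sobolev 1 p {0<..<1} \<and>
        sobolev_norm 1 p {0<..<1} u \<le> C * Lp_norm p {0<..<1} f)"
proof -
  let ?I = "{0<..<1::real}"
  obtain K where K: "0 < K" and ex: "\<And>f. f \<in> Lp_space p ?I \<Longrightarrow>
    \<exists>u g. neumann_pair \<alpha> f u g p \<and> Lp_norm p ?I u \<le> K * Lp_norm p ?I f"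
    using neumann_pair_exists[OF assms] by blast
  obtain H where H: "0 < H" and Hardy: "p > 1 \<Longrightarrow> h \<in> Lp_space p ?I \<Longrightarrow>
    mean_abs h \<in> Lp_space p ?I \<and>
    Lp_norm p ?I (mean_abs h) \<le> H * Lp_norm p ?I h" for h
    \<comment> \<open>For \<open>p = 1\<close> any positive \<open>H\<close> will do, since the assertion is then void.\<close>
    using Hardy_inequality[of p] by (cases "p > 1") (blast intro: zero_less_one)+
  define L where "L = Lp_norm p ?I (\<lambda>x. x powr - 0)"
  define B where "B = 2 * (K + 1)"
  define C3 where "C3 = (L + 1) * B"
  define C4 where "C4 = (H + 2 * (1 + \<bar>2 * \<alpha>\<bar> * H)) * B"
  define C5 where "C5 = 2 / \<bar>1 - 2 * \<alpha>\<bar> * B"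
  define C6 where "C6 = K + B * L"
  define C where "C = K + C3 + C4 + C5 + C6"
  have L: "0 \<le> L" unfolding L_def by (rule Lp_norm_nonneg)
  have B: "0 < B" using K by (simp add: B_def)
  have nn: "0 \<le> C3" "0 \<le> C4" "0 \<le> C5" "0 \<le> C6"
    using K L B H by (auto simp: C3_def C4_def C5_def C6_def)
  then have C: "0 < C" "K \<le> C" "C3 \<le> C" "C4 \<le> C" "C5 \<le> C" "C6 \<le> C"
    using K unfolding C_def by linarith+
  show ?thesis
  proof (intro exI[of _ C] conjI C(1) ballI)
    fix f assume f: "f \<in> Lp_space p ?I"
    obtain u g where "neumann_pair \<alpha> f u g p" and uK: "Lp_norm p ?I u \<le> K * Lp_norm p ?I f"
      using ex[OF f] by blast
    then interpret neumann_pair \<alpha> f u g p by simp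
    let ?N = "Lp_norm p ?I f"
    have N: "0 \<le> ?N" by (rule Lp_norm_nonneg)
    have CN: "c * ?N \<le> C * ?N" if "c \<le> C" for c using that N by (rule mult_right_mono)
    have W: "W \<le> B * ?N"
      using Lp_diff(2)[OF p u f] uK by (simp add: B_def algebra_simps)
    have WC: "c * W \<le> c * B * ?N" if "0 \<le> c" for c
      using mult_left_mono[OF W that] by (simp add: mult.assoc)
    show "\<exists>u. solves_problem \<alpha> p f u \<and> neumann_properties \<alpha> p u \<and>
     (\<forall>v. solves_problem \<alpha> p f v \<and> neumann_properties \<alpha> p v \<longrightarrow> (\<forall>x\<in>{0<..1}. v x = u x)) \<and>
     Lp_norm p ?I u \<le> C * ?N \<and>
     sobolev_norm 1 p ?I (flux \<alpha> u) \<le> C * ?N \<and>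
     (p > 1 \<longrightarrow>
        Lp_norm p ?I (\<lambda>x. x powr (2 * \<alpha> - 1) * deriv u x)
        + Lp_norm p ?I (\<lambda>x. x powr (2 * \<alpha>) * weak_deriv ?I (deriv u) x) \<le> C * ?N) \<and>
     (0 < \<alpha> \<and> \<alpha> < 1 / 2 \<longrightarrow>
        (\<exists>w\<in>holder_space (1 / 2 - \<alpha>) {0..1}. (\<forall>x\<in>{0<..1}. w x = u x) \<and>
           holder_norm (1 / 2 - \<alpha>) {0..1} w \<le> C * ?N)) \<and>
     (\<alpha> \<le> 0 \<longrightarrow> u \<in> sobolev 1 p ?I \<and> sobolev_norm 1 p ?I u \<le> C * ?N)"
    proof (intro exI[of _ u] conjI impI allI ballI)
      show "solves_problem \<alpha> p f u" by (rule solves)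
      show "neumann_properties \<alpha> p u" by (rule properties)
      show "v x = u x" if "solves_problem \<alpha> p f v \<and> neumann_properties \<alpha> p v" "x \<in> {0<..1}" for v x
        using neumann_solution_unique[OF p solves properties] that by blast
      show "Lp_norm p ?I u \<le> C * ?N" using uK CN[OF C(2)] by linarith
      show "sobolev_norm 1 p ?I (flux \<alpha> u) \<le> C * ?N"
        using flux_sobolev_norm WC[of "L + 1"] CN[OF C(3)] L unfolding C3_def L_def by linarith
      show "u \<in> sobolev 1 p ?I" if "\<alpha> \<le> 0" using sobolev_bound(1)[OF that] .
      show "sobolev_norm 1 p ?I u \<le> C * ?N" if "\<alpha> \<le> 0"
      proof -
        have "sobolev_norm 1 p ?I u \<le> K * ?N + L * W"
          using sobolev_bound(2)[OF that] uK by (simp add: L_def mult.commute)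
        also have "\<dots> \<le> K * ?N + L * B * ?N" using WC[OF L] by simp
        also have "\<dots> = C6 * ?N" by (simp add: C6_def algebra_simps)
        finally show ?thesis using CN[OF C(6)] by linarith
      qed
    next
      assume p1: "p > 1"
      have "Lp_norm p ?I (\<lambda>x. x powr (2 * \<alpha> - 1) * deriv u x)
        + Lp_norm p ?I (\<lambda>x. x powr (2 * \<alpha>) * weak_deriv ?I (deriv u) x) \<le> H * W + 2 * (1 + \<bar>2 * \<alpha>\<bar> * H) * W"
        using Hardy_bounds(2,4)[OF H Hardy[OF p1]] by (intro add_mono) auto
      also have "\<dots> = (H + 2 * (1 + \<bar>2 * \<alpha>\<bar> * H)) * W" by (simp add: algebra_simps)
      also have "\<dots> \<le> C4 * ?N" unfolding C4_def using H by (intro WC) auto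
      finally show "Lp_norm p ?I (\<lambda>x. x powr (2 * \<alpha> - 1) * deriv u x)
        + Lp_norm p ?I (\<lambda>x. x powr (2 * \<alpha>) * weak_deriv ?I (deriv u) x) \<le> C * ?N"
        using CN[OF C(4)] by linarith
    next
      assume a: "0 < \<alpha> \<and> \<alpha> < 1 / 2"
      have "2 / (1 - 2 * \<alpha>) * W \<le> C5 * ?N"
        using WC[of "2 / (1 - 2 * \<alpha>)"] a by (simp add: C5_def)
      then have "2 / (1 - 2 * \<alpha>) * W \<le> C * ?N" using CN[OF C(5)] by linarith
      then show "\<exists>w\<in>holder_space (1 / 2 - \<alpha>) {0..1}. (\<forall>x\<in>{0<..1}. w x = u x) \<and>
           holder_norm (1 / 2 - \<alpha>) {0..1} w \<le> C * ?N"
        using holder_bound a by (meson order_trans)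
    qed
  qed
qed

end
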